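(* Let $V=\bigotimes_{i=1}^nV_i$ with $V_i$ a complex Hilbert space of dimension $d_i$, and let $m\ge1$. For the action of $\mathrm{GL}_{\mathbf d}$ on $\mathrm{End}(V)^{\oplus m}$, every tuple $(M_1,\dots,M_m)$ of normal matrices has a closed orbit.
   Context: $\mathrm{GL}_{\mathbf d}=\times_{i=1}^n\mathrm{GL}(\mathbb C^{d_i})$ acts on $\mathrm{End}(V)=\bigotimes_i\mathrm{End}(V_i)$ by conjugation by $\bigotimes_ig_i$, and on $\mathrm{End}(V)^{\oplus m}$ by simultaneous conjugation. "Closed" means Zariski closed. *)

theory Defs
  imports "Jordan_Normal_Form.Schur_Decomposition"
begin

section \<open>Tensor products of spaces and operators\<close>

text \<open>
  A complex Hilbert space of dimension \<open>d\<close> is taken to be \<open>\<complex>\<^sup>d\<close> with its standard inner product,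
  that is, an orthonormal basis has been chosen; \<open>End(\<complex>\<^sup>d)\<close> is \<open>carrier_mat d d\<close>.  A list \<open>ds\<close>
  of dimensions stands for the tensor product \<open>V\<close> of the spaces of dimensions \<open>ds ! i\<close>, for
  \<open>i < length ds\<close>.  The tensor products of basis vectors are an orthonormal basis of \<open>V\<close>;
  ordered lexicographically, they identify
  \<open>V\<close> with \<open>\<complex>\<^sup>N\<close> for \<open>N = prod_list ds\<close>, and the tensor product of operators becomes
  the Kronecker product of matrices.
\<close>

definition kron :: "complex mat \<Rightarrow> complex mat \<Rightarrow> complex mat" where
  "kron A B = mat (dim_row A * dim_row B) (dim_col A * dim_col B)
     (\<lambda>(i, j). A $$ (i div dim_row B, j div dim_col B) * B $$ (i mod dim_row B, j mod dim_col B))"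

fun tensor_mat :: "complex mat list \<Rightarrow> complex mat" where
  "tensor_mat [] = 1\<^sub>m 1"
| "tensor_mat (A # As) = kron A (tensor_mat As)"

definition normal_mat :: "complex mat \<Rightarrow> bool" where
  "normal_mat A \<longleftrightarrow> square_mat A \<and> A * mat_adjoint A = mat_adjoint A * A"

definition mat_tuples :: "nat \<Rightarrow> nat \<Rightarrow> complex mat list set" where
  "mat_tuples N m = {Ms. length Ms = m \<and> set Ms \<subseteq> carrier_mat N N}"


section \<open>The action of the product of general linear groups\<close>

definition GL :: "nat \<Rightarrow> complex mat set" where
  "GL d = {g \<in> carrier_mat d d. invertible_mat g}"

definition GL_prod :: "nat list \<Rightarrow> complex mat list set" where
  "GL_prod ds = {gs. length gs = length ds \<and> (\<forall>i < length ds. gs ! i \<in> GL (ds ! i))}"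

text \<open>
  The value of \<open>mat_inverse\<close> is an option; for \<open>gs \<in> GL_prod ds\<close> it is never \<open>None\<close> here, see
  \<open>tensor_mat_inverse\<close> below.
\<close>

definition tensor_conj :: "complex mat list \<Rightarrow> complex mat \<Rightarrow> complex mat" where
  "tensor_conj gs M = tensor_mat gs * M * the (mat_inverse (tensor_mat gs))"

definition local_orbit :: "nat list \<Rightarrow> complex mat list \<Rightarrow> complex mat list set" where
  "local_orbit ds Ms = {map (tensor_conj gs) Ms | gs. gs \<in> GL_prod ds}"


section \<open>Zariski closed sets of tuples of matrices\<close>

text \<open>
  The polynomial functions on the affine space \<open>mat_tuples N m\<close>, of dimension \<open>m * N\<^sup>2\<close>, in the
  coordinates given by the matrix entries.
\<close>

inductive_set poly_funs :: "nat \<Rightarrow> nat \<Rightarrow> (complex mat list \<Rightarrow> complex) set"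
  for N m :: nat where
  const: "(\<lambda>_. c) \<in> poly_funs N m"
| coord: "k < m \<Longrightarrow> i < N \<Longrightarrow> j < N \<Longrightarrow> (\<lambda>X. (X ! k) $$ (i, j)) \<in> poly_funs N m"
| add: "p \<in> poly_funs N m \<Longrightarrow> q \<in> poly_funs N m \<Longrightarrow> (\<lambda>X. p X + q X) \<in> poly_funs N m"
| mult: "p \<in> poly_funs N m \<Longrightarrow> q \<in> poly_funs N m \<Longrightarrow> (\<lambda>X. p X * q X) \<in> poly_funs N m"

definition zariski_closed :: "nat \<Rightarrow> nat \<Rightarrow> complex mat list set \<Rightarrow> bool" where
  "zariski_closed N m S \<longleftrightarrow>
     (\<exists>P \<subseteq> poly_funs N m. S = {X \<in> mat_tuples N m. \<forall>p \<in> P. p X = 0})"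


section \<open>Well-definedness of the action\<close>

lemma kron_carrier:
  assumes "A \<in> carrier_mat a b" "B \<in> carrier_mat c d"
  shows "kron A B \<in> carrier_mat (a * c) (b * d)"
  using assms by (auto simp: kron_def)

lemma div_less_of_mult: "i < a * c \<Longrightarrow> i div c < (a::nat)"
  by (simp add: less_mult_imp_div_less)

lemma mod_less_of_mult: "i < a * c \<Longrightarrow> i mod c < (c::nat)"
  by (cases "c = 0") auto

lemma sum_div_mod:
  fixes f g :: "nat \<Rightarrow> complex"
  shows "(\<Sum>k<b * d. f (k div d) * g (k mod d)) = (\<Sum>k<b. f k) * (\<Sum>l<d. g l)"
proof (cases "d = 0")
  case False
  have "(\<Sum>k<b * d. f (k div d) * g (k mod d)) = (\<Sum>(k, l)\<in>{..<b} \<times> {..<d}. f k * g l)"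
    by (rule sum.reindex_bij_witness[where i = "\<lambda>(k, l). k * d + l" and j = "\<lambda>k. (k div d, k mod d)"])
      (use False in \<open>auto simp: less_mult_imp_div_less mult.commute[of d] intro: mod_less_of_mult
         dest!: less_mult_imp_div_less\<close>,
       metis Suc_leI add.commute add_less_cancel_left mult_Suc mult_le_mono1 order_less_le_trans)
  then show ?thesis
    by (simp add: sum_product sum.cartesian_product)
qed auto

lemma kron_mult:
  assumes A: "A \<in> carrier_mat a a" and B: "B \<in> carrier_mat c c"
    and A': "A' \<in> carrier_mat a a" and B': "B' \<in> carrier_mat c c"
  shows "kron A B * kron A' B' = kron (A * A') (B * B')"
proof (rule eq_matI)
  fix i j
  assume "i < dim_row (kron (A * A') (B * B'))" "j < dim_col (kron (A * A') (B * B'))"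
  then have i: "i < a * c" and j: "j < a * c"
    using assms by (auto simp: kron_def)
  note ij = div_less_of_mult[OF i] mod_less_of_mult[OF i] div_less_of_mult[OF j] mod_less_of_mult[OF j]
  have "(kron A B * kron A' B') $$ (i, j)
      = (\<Sum>k<a * c. (A $$ (i div c, k div c) * A' $$ (k div c, j div c))
                    * (B $$ (i mod c, k mod c) * B' $$ (k mod c, j mod c)))"
    using assms i j
    by (auto simp: kron_def scalar_prod_def atLeast0LessThan ac_simps intro!: sum.cong)
  also have "\<dots> = (\<Sum>k<a. A $$ (i div c, k) * A' $$ (k, j div c))
                * (\<Sum>l<c. B $$ (i mod c, l) * B' $$ (l, j mod c))"
    by (rule sum_div_mod)
  also have "\<dots> = kron (A * A') (B * B') $$ (i, j)"
    using assms i j ij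
    by (auto simp: kron_def scalar_prod_def atLeast0LessThan)
  finally show "(kron A B * kron A' B') $$ (i, j) = kron (A * A') (B * B') $$ (i, j)" .
qed (use assms in \<open>auto simp: kron_def\<close>)

lemma kron_one: "kron (1\<^sub>m a) (1\<^sub>m c) = 1\<^sub>m (a * c)"
proof (rule eq_matI)
  fix i j
  assume "i < dim_row (1\<^sub>m (a * c) :: complex mat)" "j < dim_col (1\<^sub>m (a * c) :: complex mat)"
  then have i: "i < a * c" and j: "j < a * c" by auto
  have "i = j \<longleftrightarrow> i div c = j div c \<and> i mod c = j mod c"
    by (metis div_mult_mod_eq)
  then show "kron (1\<^sub>m a) (1\<^sub>m c) $$ (i, j) = 1\<^sub>m (a * c) $$ (i, j)"
    using i j div_less_of_mult[OF i] mod_less_of_mult[OF i] div_less_of_mult[OF j] mod_less_of_mult[OF j]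
    by (auto simp: kron_def)
qed (auto simp: kron_def)

lemma GL_inverse:
  assumes "g \<in> GL d"
  obtains h where "h \<in> carrier_mat d d" "g * h = 1\<^sub>m d" "h * g = 1\<^sub>m d"
proof -
  from assms have g: "g \<in> carrier_mat d d" by (simp add: GL_def)
  from assms obtain h where h: "inverts_mat g h" "inverts_mat h g"
    by (auto simp: GL_def invertible_mat_def)
  have gh: "g * h = 1\<^sub>m d" and hg: "h * g = 1\<^sub>m (dim_row h)"
    using h g by (auto simp: inverts_mat_def)
  have "dim_col h = d" using arg_cong[OF gh, of dim_col] by simp
  moreover have "dim_row h = d" using arg_cong[OF hg, of dim_col] g by simp
  ultimately show thesis using that[of h] gh hg by auto
qed

lemma tensor_mat_GL:
  assumes "gs \<in> GL_prod ds"
  shows "tensor_mat gs \<in> GL (prod_list ds)"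
  using assms
proof (induction gs arbitrary: ds)
  case Nil
  then show ?case by (auto simp: GL_prod_def GL_def invertible_mat_def inverts_mat_def intro!: exI[of _ "1\<^sub>m (Suc 0)"])
next
  case (Cons g gs)
  then obtain d ds' where ds: "ds = d # ds'"
    by (cases ds) (auto simp: GL_prod_def)
  have g: "g \<in> GL d" and gs: "gs \<in> GL_prod ds'"
    using Cons.prems unfolding ds GL_prod_def by (auto simp: All_less_Suc2)
  define T where "T = tensor_mat gs"
  define N where "N = prod_list ds'"
  have T: "T \<in> GL N" unfolding T_def N_def by (rule Cons.IH[OF gs])
  obtain h where h: "h \<in> carrier_mat d d" "g * h = 1\<^sub>m d" "h * g = 1\<^sub>m d"
    using GL_inverse[OF g] .
  obtain S where S: "S \<in> carrier_mat N N" "T * S = 1\<^sub>m N" "S * T = 1\<^sub>m N"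
    using GL_inverse[OF T] .
  have car: "g \<in> carrier_mat d d" "T \<in> carrier_mat N N" using g T by (auto simp: GL_def)
  have "kron g T * kron h S = 1\<^sub>m (d * N)" "kron h S * kron g T = 1\<^sub>m (d * N)"
    using kron_mult[OF car h(1) S(1)] kron_mult[OF h(1) S(1) car] h S by (simp_all add: kron_one)
  then have "kron g T \<in> GL (d * N)"
    using kron_carrier[OF car] kron_carrier[OF h(1) S(1)]
    by (auto simp: GL_def invertible_mat_def inverts_mat_def intro!: exI[of _ "kron h S"])
  then show ?case by (simp add: ds T_def N_def)
qed

lemma tensor_mat_inverse:
  assumes "gs \<in> GL_prod ds"
  shows "\<exists>H \<in> carrier_mat (prod_list ds) (prod_list ds). mat_inverse (tensor_mat gs) = Some H \<and>
    tensor_mat gs * H = 1\<^sub>m (prod_list ds) \<and> H * tensor_mat gs = 1\<^sub>m (prod_list ds)"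
proof -
  let ?N = "prod_list ds" and ?T = "tensor_mat gs"
  have T: "?T \<in> GL ?N" by (rule tensor_mat_GL[OF assms])
  then have car: "?T \<in> carrier_mat ?N ?N" by (simp add: GL_def)
  obtain S where "S \<in> carrier_mat ?N ?N" "?T * S = 1\<^sub>m ?N" "S * ?T = 1\<^sub>m ?N"
    using GL_inverse[OF T] .
  then have "?T \<in> Units (ring_mat TYPE(complex) ?N ())"
    using car by (auto simp: Units_def ring_mat_def)
  then obtain H where "mat_inverse ?T = Some H"
    using mat_inverse(1)[OF car, where b = "()"] by (cases "mat_inverse ?T") auto
  then show ?thesis using mat_inverse(2)[OF car] by blast
qed

end

theory Submission
  imports Defs "HOL-Analysis.Continuum_Not_Denumerable"
begin

text \<open>
  Let \<open>G\<close> be the product of the general linear groups, \<open>M\<close> a tuple of normal matrices, and \<open>X\<close> a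
  point of the Zariski closure of the orbit of \<open>M\<close>.  The theorem says that \<open>X\<close> lies in the orbit.
  The proof follows the Hilbert--Mumford criterion and the idea of Kempf and Ness that points
  which are critical for the norm have closed orbits; the part of limits along curves in \<open>G\<close> is
  taken by a place of the field \<open>\<complex>\<close>.

  Choose \<open>g\<close> in \<open>G\<close> so generic that an integral polynomial relation between the entries of \<open>g M\<close>
  and of \<open>M\<close> holds only if it holds with every other element of \<open>G\<close> in place of \<open>g\<close>; a cardinality
  argument finds such a \<open>g\<close> (\<open>generic_point\<close>).  A relation that holds on the orbit holds at \<open>X\<close>,
  so sending the entries of \<open>g M\<close> to those of \<open>X\<close>, and the entries of \<open>M\<close> to themselves, extends to
  a ring homomorphism, and further to a place: a valuation ring \<open>O\<close> in \<open>\<complex>\<close> with a residue map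
  from \<open>O\<close> to \<open>\<complex>\<close> (\<open>place_extension\<close>, \<open>place_of_closure_point\<close>).  Over \<open>O\<close> there is a Smith
  normal form \<open>g = a t b\<close> with \<open>a\<close> and \<open>b\<close> invertible over \<open>O\<close> and \<open>t\<close> diagonal.  The
  residue of \<open>a\<close> is an element of \<open>G\<close>; it moves \<open>X\<close> to a point \<open>X'\<close> that is the residue of \<open>t b M\<close>.
  Let \<open>M'\<close> be the residue of \<open>b M\<close>.  The entries of \<open>t\<close> may be taken of the form \<open>exp \<lambda>\<close> with
  weights \<open>\<lambda>\<close> on which the valuation is a total order (\<open>logarithms_of_values\<close>).  Conjugation by \<open>t\<close>
  multiplies matrix entries by exponentials of differences of weights.  Hence the nonzero entries of \<open>M'\<close> have
  weights on one side of zero, those of \<open>X'\<close> have weights on the other side, and \<open>M'\<close> and \<open>X'\<close>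
  have the same part \<open>X\<^sub>0\<close> of weight zero (\<open>weights_of_residue\<close>).

  Normality enters now.  The residue of \<open>b\<close> is a lower triangular element of \<open>G\<close> times a unitary
  one.  The unitary factor keeps \<open>M\<close> normal, the triangular one respects the order of the weights,
  and a normal block triangular matrix is block diagonal (\<open>normal_block_triangular\<close>).  Therefore
  \<open>X\<^sub>0\<close> is in the orbit of \<open>M\<close> (\<open>normal_block_diagonal_in_orbit\<close>).

  It remains to connect \<open>X'\<close> with \<open>X\<^sub>0\<close>, which so far is only a limit of conjugates of \<open>X'\<close>.  The rank of the map \<open>\<xi> \<mapsto> [\<xi>, X]\<close> on the Lie algebra of \<open>G\<close> can only drop
  in the closure of the orbit (\<open>rank_semicontinuous\<close>), so for \<open>X'\<close> it is at most what it is for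
  \<open>X\<^sub>0\<close>.  The map for \<open>X\<^sub>0\<close> is the leading part of the map for \<open>X'\<close>, and the diagonal matrix \<open>\<lambda>\<close> is in
  its kernel.  Because of the ranks, \<open>\<lambda>\<close> lifts to an element \<open>\<xi>\<close> of the kernel for \<open>X'\<close> that
  differs from \<open>\<lambda>\<close> by terms of nonzero weight on the side of \<open>X'\<close> (\<open>kernel_lift\<close>).  A unipotent
  element \<open>u\<close> of \<open>G\<close> conjugates \<open>\<xi>\<close> to \<open>\<lambda>\<close> (\<open>unipotent_diagonalisation\<close>), so \<open>u X'\<close> commutes
  with \<open>\<lambda>\<close>, has weight zero, and is \<open>X\<^sub>0\<close> (\<open>conj_to_part0\<close>).
\<close>

section \<open>Places of the complex numbers\<close>

text \<open>
  A ring homomorphism to \<open>\<complex>\<close> from a subring of \<open>\<complex>\<close>, given by its graph.  As a graph it is a subring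
  of \<open>\<complex> \<times> \<complex>\<close>; that it is single-valued is a condition on the fibre over \<open>0\<close> alone.
\<close>

definition partial_hom :: "(complex \<times> complex) set \<Rightarrow> bool" where
  "partial_hom Q \<longleftrightarrow> (1, 1) \<in> Q \<and> (\<forall>x y. (x, y) \<in> Q \<longrightarrow> (- x, - y) \<in> Q) \<and>
     (\<forall>x y x' y'. (x, y) \<in> Q \<longrightarrow> (x', y') \<in> Q \<longrightarrow> (x + x', y + y') \<in> Q \<and> (x * x', y * y') \<in> Q) \<and>
     (\<forall>y. (0, y) \<in> Q \<longrightarrow> y = 0)"

lemma partial_homI:
  assumes "(1, 1) \<in> Q" "\<And>x y. (x, y) \<in> Q \<Longrightarrow> (- x, - y) \<in> Q"
    "\<And>x y x' y'. (x, y) \<in> Q \<Longrightarrow> (x', y') \<in> Q \<Longrightarrow> (x + x', y + y') \<in> Q"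
    "\<And>x y x' y'. (x, y) \<in> Q \<Longrightarrow> (x', y') \<in> Q \<Longrightarrow> (x * x', y * y') \<in> Q"
    "\<And>y. (0, y) \<in> Q \<Longrightarrow> y = 0"
  shows "partial_hom Q"
  using assms unfolding partial_hom_def by blast

context
  fixes Q :: "(complex \<times> complex) set"
  assumes hom: "partial_hom Q"
begin

lemma ph_one: "(1, 1) \<in> Q"
  and ph_uminus: "(x, y) \<in> Q \<Longrightarrow> (- x, - y) \<in> Q"
  and ph_add: "(x, y) \<in> Q \<Longrightarrow> (x', y') \<in> Q \<Longrightarrow> (x + x', y + y') \<in> Q"
  and ph_mult: "(x, y) \<in> Q \<Longrightarrow> (x', y') \<in> Q \<Longrightarrow> (x * x', y * y') \<in> Q"
  and ph_zeroD: "(0, y) \<in> Q \<Longrightarrow> y = 0"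
  using hom unfolding partial_hom_def by blast+

lemma ph_zero: "(0, 0) \<in> Q"
  using ph_add[OF ph_one ph_uminus[OF ph_one]] by simp

lemma ph_diff: "(x, y) \<in> Q \<Longrightarrow> (x', y') \<in> Q \<Longrightarrow> (x - x', y - y') \<in> Q"
  using ph_add[of x y "- x'" "- y'"] ph_uminus[of x' y'] by simp

lemma ph_unique: "(x, y) \<in> Q \<Longrightarrow> (x, y') \<in> Q \<Longrightarrow> y = y'"
  using ph_diff[of x y x y'] ph_zeroD[of "y - y'"] by simp

lemma ph_sum: "(\<And>i. i \<in> S \<Longrightarrow> (f i, f' i) \<in> Q) \<Longrightarrow> (sum f S, sum f' S) \<in> Q"
  by (induction S rule: infinite_finite_induct) (auto intro: ph_zero ph_add)

lemma ph_power: "(x, y) \<in> Q \<Longrightarrow> (x ^ n, y ^ n) \<in> Q"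
  by (induction n) (auto intro: ph_one ph_mult)

end

text \<open>
  Pairs of polynomials stand for polynomials over the subring: the second member collects the images
  of the coefficients of the first.
\<close>

definition coeff_rel :: "(complex \<times> complex) set \<Rightarrow> complex poly \<Rightarrow> complex poly \<Rightarrow> bool" where
  "coeff_rel Q p p' \<longleftrightarrow> (\<forall>i. (coeff p i, coeff p' i) \<in> Q)"

context
  fixes Q :: "(complex \<times> complex) set"
  assumes hom: "partial_hom Q"
begin

lemma coeff_rel_add: "coeff_rel Q p p' \<Longrightarrow> coeff_rel Q q q' \<Longrightarrow> coeff_rel Q (p + q) (p' + q')"
  and coeff_rel_diff: "coeff_rel Q p p' \<Longrightarrow> coeff_rel Q q q' \<Longrightarrow> coeff_rel Q (p - q) (p' - q')"
  and coeff_rel_mult: "coeff_rel Q p p' \<Longrightarrow> coeff_rel Q q q' \<Longrightarrow> coeff_rel Q (p * q) (p' * q')"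
  and coeff_rel_monom: "(x, y) \<in> Q \<Longrightarrow> coeff_rel Q (monom x n) (monom y n)"
  unfolding coeff_rel_def coeff_mult
  by (auto intro!: ph_add[OF hom] ph_diff[OF hom] ph_sum[OF hom] ph_mult[OF hom] ph_zero[OF hom])

text \<open>The subring of \<open>\<complex> \<times> \<complex>\<close> that \<open>Q\<close> and the pair \<open>(x, z)\<close> generate.\<close>

definition adjoin :: "complex \<Rightarrow> complex \<Rightarrow> (complex \<times> complex) set" where
  "adjoin x z = {(poly p x, poly p' z) | p p'. coeff_rel Q p p'}"

lemma adjoinI: "coeff_rel Q p p' \<Longrightarrow> (poly p x, poly p' z) \<in> adjoin x z"
  unfolding adjoin_def by blast

lemma adjoin_superset: "Q \<subseteq> adjoin x z" "(x, z) \<in> adjoin x z"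
proof -
  show "Q \<subseteq> adjoin x z"
  proof
    fix a assume "a \<in> Q"
    then obtain u v where a: "a = (u, v)" "(u, v) \<in> Q" by (cases a) auto
    from adjoinI[OF coeff_rel_monom[OF a(2), of 0], of x z] show "a \<in> adjoin x z"
      by (simp add: a poly_monom)
  qed
  from adjoinI[OF coeff_rel_monom[OF ph_one[OF hom], of 1], of x z]
  show "(x, z) \<in> adjoin x z" by (simp add: poly_monom)
qed

text \<open>
  A value \<open>z\<close> can be assigned to \<open>x\<close> as soon as \<open>z\<close> is a root of the image of every polynomial that
  vanishes at \<open>x\<close>.
\<close>

lemma partial_hom_adjoin:
  assumes "\<And>p p'. coeff_rel Q p p' \<Longrightarrow> poly p x = 0 \<Longrightarrow> poly p' z = 0"
  shows "partial_hom (adjoin x z)"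
proof (rule partial_homI)
  show "(1, 1) \<in> adjoin x z" using adjoin_superset ph_one[OF hom] by blast
next
  fix a b assume "(a, b) \<in> adjoin x z"
  then obtain p p' where p: "coeff_rel Q p p'" "a = poly p x" "b = poly p' z"
    unfolding adjoin_def by auto
  have "coeff_rel Q (0 - p) (0 - p')"
    by (rule coeff_rel_diff[OF _ p(1)]) (simp add: coeff_rel_def ph_zero[OF hom])
  from adjoinI[OF this, of x z] show "(- a, - b) \<in> adjoin x z" using p by simp
next
  fix a b a' b' assume "(a, b) \<in> adjoin x z" "(a', b') \<in> adjoin x z"
  then obtain p p' q q' where p: "coeff_rel Q p p'" "a = poly p x" "b = poly p' z"
    and q: "coeff_rel Q q q'" "a' = poly q x" "b' = poly q' z"
    unfolding adjoin_def by auto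
  show "(a + a', b + b') \<in> adjoin x z" "(a * a', b * b') \<in> adjoin x z"
    using adjoinI[OF coeff_rel_add[OF p(1) q(1)], of x z]
      adjoinI[OF coeff_rel_mult[OF p(1) q(1)], of x z] p q by simp_all
next
  fix b assume "(0, b) \<in> adjoin x z"
  then show "b = 0" using assms unfolding adjoin_def by auto
qed

end

text \<open>
  The domain of \<open>Q\<close> is a valuation ring, and the elements outside it are sent to infinity: their
  inverses have value \<open>0\<close>.
\<close>

locale place =
  fixes Q :: "(complex \<times> complex) set"
  assumes hom: "partial_hom Q"
    and val: "x \<in> Domain Q \<or> (inverse x, 0) \<in> Q"

locale maximal_partial_hom =
  fixes Q :: "(complex \<times> complex) set"
  assumes hom: "partial_hom Q"
    and max: "partial_hom Q' \<Longrightarrow> Q \<subseteq> Q' \<Longrightarrow> Q' = Q"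
begin

text \<open>
  A maximal homomorphism extends to fractions whose denominator has nonzero image, so those fractions
  are in its domain already.
\<close>

lemma local:
  assumes xy: "(x, y) \<in> Q" and y: "y \<noteq> 0"
  shows "(inverse x, inverse y) \<in> Q"
proof -
  define Q' where "Q' = {(a / s, b / t) | a b s t. (a, b) \<in> Q \<and> (s, t) \<in> Q \<and> t \<noteq> 0}"
  have nz: "s \<noteq> 0" if "(s, t) \<in> Q" "t \<noteq> 0" for s t
    using that ph_zeroD[OF hom] by blast
  have I: "(a / s, b / t) \<in> Q'" if "(a, b) \<in> Q" "(s, t) \<in> Q" "t \<noteq> 0" for a b s t
    unfolding Q'_def using that by blast
  have sub: "Q \<subseteq> Q'"
  proof
    fix p assume "p \<in> Q"
    then show "p \<in> Q'" using I[of "fst p" "snd p" 1 1] ph_one[OF hom] by simp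
  qed
  have "partial_hom Q'"
  proof (rule partial_homI)
    show "(1, 1) \<in> Q'" using sub ph_one[OF hom] by blast
  next
    fix u v assume "(u, v) \<in> Q'"
    then obtain a b s t where *: "u = a / s" "v = b / t" "(a, b) \<in> Q" "(s, t) \<in> Q" "t \<noteq> 0"
      unfolding Q'_def by blast
    from I[OF ph_uminus[OF hom *(3)] *(4,5)] show "(- u, - v) \<in> Q'" using * by simp
  next
    fix u v u' v' assume "(u, v) \<in> Q'" "(u', v') \<in> Q'"
    then obtain a b s t a' b' s' t'
      where *: "u = a / s" "v = b / t" "(a, b) \<in> Q" "(s, t) \<in> Q" "t \<noteq> 0"
        and **: "u' = a' / s'" "v' = b' / t'" "(a', b') \<in> Q" "(s', t') \<in> Q" "t' \<noteq> 0"
      unfolding Q'_def by blast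
    have ne: "s \<noteq> 0" "s' \<noteq> 0" using nz * ** by blast+
    have m: "(s * s', t * t') \<in> Q" "t * t' \<noteq> 0" using * ** ph_mult[OF hom] by auto
    have "(a * s' + a' * s, b * t' + b' * t) \<in> Q"
      using * ** by (intro ph_add[OF hom] ph_mult[OF hom])
    from I[OF this m] show "(u + u', v + v') \<in> Q'"
      using * ** ne by (simp add: add_frac_eq)
    from I[OF ph_mult[OF hom *(3) **(3)] m] show "(u * u', v * v') \<in> Q'" using * ** by simp
  next
    fix v assume "(0, v) \<in> Q'"
    then obtain a b s t where "0 = a / s" "v = b / t" "(a, b) \<in> Q" "(s, t) \<in> Q" "t \<noteq> 0"
      unfolding Q'_def by blast
    then show "v = 0" using nz[of s t] ph_zeroD[OF hom] by auto
  qed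
  then have "Q' = Q" using max sub by blast
  then show ?thesis using I[OF ph_one[OF hom] xy y] by (simp add: divide_inverse)
qed

text \<open>
  If \<open>x\<close> has no value then no \<open>z\<close> can be assigned to it, so the residues of the polynomials that
  vanish at \<open>x\<close> have no common root.  They form an ideal over the residue field; an element of
  least degree divides all others, so it has no root and is constant.
\<close>

lemma obstruction:
  assumes x: "x \<notin> Domain Q"
  obtains p where "coeff_rel Q p 1" "poly p x = 0"
proof -
  define J where "J p p' \<longleftrightarrow> coeff_rel Q p p' \<and> poly p x = 0" for p p'
  have noroot: "\<exists>p p'. J p p' \<and> poly p' z \<noteq> 0" for z
  proof (rule ccontr)
    assume "\<not> ?thesis"
    then have "partial_hom (adjoin Q x z)"
      by (intro partial_hom_adjoin[OF hom]) (auto simp: J_def)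
    then have "adjoin Q x z = Q" using max adjoin_superset(1)[OF hom] by blast
    then show False using x adjoin_superset(2)[OF hom, of x z] by blast
  qed
  have "\<exists>n h h'. J h h' \<and> h' \<noteq> 0 \<and> degree h' = n" using noroot[of 0] by force
  then obtain n where n: "n = (LEAST n. \<exists>h h'. J h h' \<and> h' \<noteq> 0 \<and> degree h' = n)"
    and ex: "\<exists>h h'. J h h' \<and> h' \<noteq> 0 \<and> degree h' = n"
    using LeastI_ex[of "\<lambda>n. \<exists>h h'. J h h' \<and> h' \<noteq> 0 \<and> degree h' = n"] by blast
  then obtain h h' where h: "J h h'" "h' \<noteq> 0" and deg: "degree h' = n" by blast
  have least: "n \<le> degree p'" if "J p p'" "p' \<noteq> 0" for p p'
    unfolding n by (rule Least_le) (use that in blast)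
  have lc: "(inverse (coeff h n), inverse (coeff h' n)) \<in> Q"
    using h deg local[of "coeff h n" "coeff h' n"] unfolding J_def coeff_rel_def
    by (metis leading_coeff_0_iff)
  have dvd: "h' dvd p'" if "J p p'" for p p'
    using that
  proof (induction "degree p'" arbitrary: p p' rule: less_induct)
    case less
    show ?case
    proof (cases "p' = 0")
      case False
      have le: "n \<le> degree p'" using least[OF less.prems False] .
      define k where "k = degree p' - n"
      define c where "c = coeff p (degree p') * inverse (coeff h n)"
      define c' where "c' = coeff p' (degree p') * inverse (coeff h' n)"
      have cQ: "(c, c') \<in> Q"
        unfolding c_def c'_def using less.prems lc
        by (intro ph_mult[OF hom]) (auto simp: J_def coeff_rel_def)
      define r r' where "r = p - monom c k * h" and "r' = p' - monom c' k * h'"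
      have J: "J r r'" using less.prems h cQ coeff_rel_diff[OF hom]
        coeff_rel_mult[OF hom] coeff_rel_monom[OF hom]
        unfolding J_def r_def r'_def by (simp add: poly_monom)
      have p'eq: "p' = r' + monom c' k * h'" unfolding r'_def by simp
      have c'0: "c' \<noteq> 0" unfolding c'_def using False h deg by auto
      have degm: "degree (monom c' k * h') = degree p'"
        using c'0 h deg le by (subst degree_mult_eq) (auto simp: degree_monom_eq k_def)
      have "h' dvd r'"
      proof (cases "r' = 0")
        case False
        have "coeff r' (degree p') = 0"
        proof -
          have "coeff (monom c' k * h') (degree p') = c' * coeff h' n"
            using le by (simp add: coeff_monom_mult k_def)
          then show ?thesis unfolding r'_def c'_def using h deg by auto
        qed
        moreover have "degree r' \<le> degree p'"
          unfolding r'_def using degm degree_diff_le by (metis order_refl)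
        ultimately have "degree r' < degree p'"
          using False by (metis leading_coeff_0_iff le_neq_implies_less)
        then show ?thesis using less.hyps J by blast
      qed auto
      then show ?thesis by (subst p'eq) simp
    qed auto
  qed
  have n0: "n = 0"
  proof (rule ccontr)
    assume "n \<noteq> 0"
    then have "\<not> constant (poly h')" using deg by (simp add: constant_degree)
    then obtain z where "poly h' z = 0" using fundamental_theorem_of_algebra by blast
    then show False using noroot[of z] dvd by (metis dvd_trans poly_eq_0_iff_dvd)
  qed
  define c where "c = inverse (coeff h 0)"
  define c' where "c' = inverse (coeff h' 0)"
  have "h' = [:coeff h' 0:]" using deg n0 by (metis degree_eq_zeroE coeff_pCons_0)
  then have 1: "monom c' 0 * h' = 1"
    using h unfolding c'_def monom_0
    by (metis left_inverse mult_smult_left one_pCons pCons_0_0 smult_1_left smult_pCons mult_pCons_left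
        add.right_neutral mult_zero_left smult_0_right)
  have "coeff_rel Q (monom c 0 * h) (monom c' 0 * h')"
    using h lc n0 unfolding J_def c_def c'_def
    by (intro coeff_rel_mult[OF hom] coeff_rel_monom[OF hom]) auto
  then have "coeff_rel Q (monom c 0 * h) 1" using 1 by simp
  moreover have "poly (monom c 0 * h) x = 0" using h by (simp add: J_def)
  ultimately show thesis using that by blast
qed

text \<open>
  If neither \<open>x\<close> nor its inverse had a value, then both would satisfy relations as in \<open>obstruction\<close>.
\<close>

lemma valuation: "x \<in> Domain Q \<or> inverse x \<in> Domain Q"
proof (rule ccontr)
  assume nv: "\<not> ?thesis"
  define R where "R x p \<longleftrightarrow> coeff_rel Q p 1 \<and> poly p x = 0" for x p
  have x0: "x \<noteq> 0" using nv ph_zero[OF hom] by auto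
  \<comment> \<open>Of two such relations of least degree, for \<open>x\<close> and for its inverse, the one with the
    smaller degree lowers the degree of the other.\<close>
  have False if y0: "y \<noteq> 0" and p: "R y p" and min: "\<And>p'. R y p' \<Longrightarrow> degree p \<le> degree p'"
    and q: "R (inverse y) q" and le: "degree q \<le> degree p" for y p q
  proof -
    let ?n = "degree p" and ?l = "degree q"
    have q0Q: "(coeff q 0, 1) \<in> Q" and pQ: "(coeff p ?n, coeff 1 ?n) \<in> Q"
      and p0Q: "(coeff p 0, 1) \<in> Q"
      using p q unfolding R_def coeff_rel_def by (metis coeff_1 lead_coeff_1 degree_1)+
    have n0: "?n \<noteq> 0"
    proof
      assume "?n = 0"
      then have "coeff p 0 = 0"
        using p unfolding R_def by (metis degree_eq_zeroE poly_pCons coeff_pCons_0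
            add.right_neutral mult_zero_right poly_0)
      then show False using p0Q ph_zeroD[OF hom, of 1] by simp
    qed
    then have pn: "(coeff p ?n, 0) \<in> Q" using pQ by simp
    have q00: "coeff q 0 \<noteq> 0" using q0Q ph_zeroD[OF hom, of 1] by auto
    define c where "c = coeff p ?n * inverse (coeff q 0)"
    have cQ: "(c, 0) \<in> Q"
      using ph_mult[OF hom pn local[OF q0Q]] unfolding c_def by simp
    \<comment> \<open>The reflected polynomial turns a relation for the inverse into one for \<open>y\<close>; its leading coefficient is the constant coefficient of \<open>q\<close>, a unit.\<close>
    define r where "r = p - monom c (?n - ?l) * reflect_poly q"
    have "coeff_rel Q (reflect_poly q) (\<Sum>i\<le>?l. monom (coeff 1 (?l - i)) i)"
      unfolding coeff_rel_def
    proof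
      fix i
      show "(coeff (reflect_poly q) i, coeff (\<Sum>i\<le>?l. monom (coeff 1 (?l - i)) i) i) \<in> Q"
      proof -
        have "coeff (\<Sum>i\<le>?l. monom (coeff 1 (?l - i)) i) i
            = (if i \<le> ?l then coeff (1 :: complex poly) (?l - i) else 0)"
          by (simp add: coeff_sum)
        moreover have "(coeff q (?l - i), coeff 1 (?l - i)) \<in> Q"
          using q unfolding R_def coeff_rel_def by blast
        ultimately show ?thesis
          using ph_zero[OF hom] by (simp add: coeff_reflect_poly del: coeff_1)
      qed
    qed
    then have "coeff_rel Q r (1 - monom 0 (?n - ?l) * (\<Sum>i\<le>?l. monom (coeff 1 (?l - i)) i))"
      unfolding r_def using p cQ unfolding R_def
      by (intro coeff_rel_diff[OF hom] coeff_rel_mult[OF hom] coeff_rel_monom[OF hom]) auto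
    then have rel: "coeff_rel Q r 1" by simp
    have "poly (reflect_poly q) y = 0"
      using q y0 unfolding R_def by (simp add: poly_reflect_poly_nz)
    then have Rr: "R y r" using rel p unfolding R_def r_def by simp
    have "coeff (monom c (?n - ?l) * reflect_poly q) ?n = c * coeff q 0"
      using le by (simp add: coeff_monom_mult coeff_reflect_poly)
    then have "coeff r ?n = 0" unfolding r_def c_def using q00 by simp
    moreover have "degree r \<le> ?n"
      unfolding r_def
    proof (rule degree_diff_le[OF order_refl])
      have "degree (monom c (?n - ?l) * reflect_poly q) \<le> (?n - ?l) + ?l"
        by (intro order.trans[OF degree_mult_le] add_mono degree_monom_le degree_reflect_poly_le)
      then show "degree (monom c (?n - ?l) * reflect_poly q) \<le> ?n" using le by simp
    qed
    ultimately have "degree r < ?n"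
      using n0 by (metis degree_0 leading_coeff_0_iff le_neq_implies_less neq0_conv)
    then show False using min[OF Rr] by simp
  qed note descent = this
  have ex: "\<exists>p. R y p \<and> (\<forall>p'. R y p' \<longrightarrow> degree p \<le> degree p')" if y: "y \<notin> Domain Q" for y
  proof -
    obtain p where "R y p" using obstruction[OF y] unfolding R_def by blast
    then show ?thesis using ex_has_least_nat[of "R y" p degree] by blast
  qed
  obtain p where p: "R x p" "\<And>p'. R x p' \<Longrightarrow> degree p \<le> degree p'"
    using ex[of x] nv by blast
  obtain q where q: "R (inverse x) q" "\<And>p'. R (inverse x) p' \<Longrightarrow> degree q \<le> degree p'"
    using ex[of "inverse x"] nv by blast
  show False
    using descent[of x p q] descent[of "inverse x" q p] p q x0 by (cases "degree q \<le> degree p") auto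
qed

lemma is_place: "place Q"
proof
  fix x
  show "x \<in> Domain Q \<or> (inverse x, 0) \<in> Q"
  proof (rule ccontr)
    assume *: "\<not> ?thesis"
    then obtain y where y: "(inverse x, y) \<in> Q" using valuation[of x] by blast
    then have "y \<noteq> 0" using * by auto
    from local[OF y this] show False using * by auto
  qed
qed (rule hom)

end

text \<open>
  Zorn's lemma: the union of a chain of graphs of homomorphisms is such a graph.
\<close>

theorem place_extension:
  assumes hom: "partial_hom Q0"
  obtains Q where "place Q" "Q0 \<subseteq> Q"
proof -
  let ?A = "{Q. partial_hom Q \<and> Q0 \<subseteq> Q}"
  have "\<exists>M\<in>?A. \<forall>X\<in>?A. M \<subseteq> X \<longrightarrow> X = M"
  proof (rule subset_Zorn_nonempty)
    show "?A \<noteq> {}" using hom by blast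
  next
    fix C assume C: "C \<noteq> {}" "subset.chain ?A C"
    have ph: "\<And>Q. Q \<in> C \<Longrightarrow> partial_hom Q" using C(2) by (auto simp: subset.chain_def)
    have two: "\<exists>Q\<in>C. a \<in> Q \<and> b \<in> Q" if ab: "a \<in> \<Union>C" "b \<in> \<Union>C" for a b
    proof -
      obtain Q1 Q2 where Q: "Q1 \<in> C" "a \<in> Q1" "Q2 \<in> C" "b \<in> Q2" using ab by blast
      then have "Q1 \<subseteq> Q2 \<or> Q2 \<subseteq> Q1" using C(2) unfolding subset.chain_def by blast
      then show ?thesis using Q by blast
    qed
    have "partial_hom (\<Union>C)"
    proof (rule partial_homI)
      show "(1, 1) \<in> \<Union>C" using C(1) ph ph_one by blast
    next
      show "(- x, - y) \<in> \<Union>C" if "(x, y) \<in> \<Union>C" for x y using that ph ph_uminus by blast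
    next
      show "(x + x', y + y') \<in> \<Union>C" if "(x, y) \<in> \<Union>C" "(x', y') \<in> \<Union>C" for x y x' y'
        using two[OF that] ph ph_add by blast
    next
      show "(x * x', y * y') \<in> \<Union>C" if "(x, y) \<in> \<Union>C" "(x', y') \<in> \<Union>C" for x y x' y'
        using two[OF that] ph ph_mult by blast
    next
      show "y = 0" if "(0, y) \<in> \<Union>C" for y using that ph ph_zeroD by blast
    qed
    moreover have "Q0 \<subseteq> \<Union>C" using C unfolding subset.chain_def by blast
    ultimately show "\<Union>C \<in> ?A" by blast
  qed
  then obtain Q where M: "Q \<in> ?A" "\<forall>X\<in>?A. Q \<subseteq> X \<longrightarrow> X = Q" by (rule bexE)
  have Q: "partial_hom Q" "Q0 \<subseteq> Q" using M(1) by simp_all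
  have max: "X = Q" if "partial_hom X" "Q \<subseteq> X" for X
  proof -
    have "X \<in> ?A" using that Q(2) by simp
    from bspec[OF M(2) this] that(2) show ?thesis by (rule mp)
  qed
  interpret maximal_partial_hom Q
    by standard (use Q max in blast)+
  show thesis using that[OF is_place Q(2)] .
qed

section \<open>Matrices over the valuation ring of a place\<close>

definition diagm :: "nat \<Rightarrow> (nat \<Rightarrow> complex) \<Rightarrow> complex mat" where
  "diagm d f = mat d d (\<lambda>(i, j). if i = j then f i else 0)"

lemma diagm_carrier [simp]: "diagm d f \<in> carrier_mat d d"
  by (simp add: diagm_def)

lemma diagm_dims [simp]: "dim_row (diagm d f) = d" "dim_col (diagm d f) = d"
  by (simp_all add: diagm_def)

lemma diagm_index: "i < d \<Longrightarrow> j < d \<Longrightarrow> diagm d f $$ (i, j) = (if i = j then f i else 0)"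
  by (simp add: diagm_def)

lemma square_mult_carrier [simp]:
  "A \<in> carrier_mat d d \<Longrightarrow> B \<in> carrier_mat d d \<Longrightarrow> A * B \<in> carrier_mat d d"
  by simp

lemma square_mult_assoc:
  fixes A :: "'a :: semiring_0 mat"
  assumes "A \<in> carrier_mat d d" "B \<in> carrier_mat d d" "C \<in> carrier_mat d d"
  shows "A * B * C = A * (B * C)"
  using assms by (rule assoc_mult_mat)

lemma mult_inverse_pair:
  fixes a b :: "'a :: comm_ring_1 mat"
  assumes "a \<in> carrier_mat d d" "a' \<in> carrier_mat d d" "b \<in> carrier_mat d d" "b' \<in> carrier_mat d d"
    "a * a' = 1\<^sub>m d" "b * b' = 1\<^sub>m d"
  shows "(a * b) * (b' * a') = 1\<^sub>m d"
proof -
  have "(a * b) * (b' * a') = a * (b * (b' * a'))"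
    using assms(1-4) by (intro square_mult_assoc[of _ d]) auto
  also have "b * (b' * a') = (b * b') * a'"
    using assms(1-4) by (intro square_mult_assoc[of _ d, symmetric]) auto
  finally show ?thesis using assms by simp
qed

lemma mult_index:
  "A \<in> carrier_mat n k \<Longrightarrow> B \<in> carrier_mat k m \<Longrightarrow> i < n \<Longrightarrow> j < m \<Longrightarrow>
    (A * B) $$ (i, j) = (\<Sum>l<k. A $$ (i, l) * (B $$ (l, j) :: 'a :: semiring_0))"
  by (auto simp: scalar_prod_def atLeast0LessThan intro!: sum.cong)

lemma diagm_mult_index:
  assumes "A \<in> carrier_mat d m" "i < d" "j < m"
  shows "(diagm d f * A) $$ (i, j) = f i * A $$ (i, j)"
proof -
  have "(diagm d f * A) $$ (i, j) = (\<Sum>l<d. (if l = i then f i * A $$ (i, j) else 0))"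
    unfolding mult_index[OF diagm_carrier assms] by (rule sum.cong) (auto simp: diagm_index assms)
  then show ?thesis using assms by simp
qed

lemma mult_diagm_index:
  assumes "A \<in> carrier_mat m d" "i < m" "j < d"
  shows "(A * diagm d f) $$ (i, j) = A $$ (i, j) * f j"
proof -
  have "(A * diagm d f) $$ (i, j) = (\<Sum>l<d. (if l = j then A $$ (i, j) * f j else 0))"
    unfolding mult_index[OF assms(1) diagm_carrier assms(2,3)]
    by (rule sum.cong) (auto simp: diagm_index assms)
  then show ?thesis using assms by simp
qed

lemma diagm_mult: "diagm d f * diagm d g = diagm d (\<lambda>i. f i * g i)"
  by (rule eq_matI) (auto simp: diagm_index diagm_mult_index[OF diagm_carrier] simp del: index_mult_mat(1))

lemma diagm_one: "(\<And>i. i < d \<Longrightarrow> f i = 1) \<Longrightarrow> diagm d f = 1\<^sub>m d"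
  by (rule eq_matI) (auto simp: diagm_index)

context place
begin

abbreviation integral :: "complex \<Rightarrow> bool" where "integral x \<equiv> x \<in> Domain Q"

lemma integral_0 [simp, intro]: "integral 0" and integral_1 [simp, intro]: "integral 1"
  by (rule DomainI[OF ph_zero[OF hom]]) (rule DomainI[OF ph_one[OF hom]])

lemma integral_add [simp, intro]: "integral x \<Longrightarrow> integral y \<Longrightarrow> integral (x + y)"
  by (elim DomainE) (rule DomainI, erule (1) ph_add[OF hom])

lemma integral_mult [simp, intro]: "integral x \<Longrightarrow> integral y \<Longrightarrow> integral (x * y)"
  by (elim DomainE) (rule DomainI, erule (1) ph_mult[OF hom])

lemma integral_diff [simp, intro]: "integral x \<Longrightarrow> integral y \<Longrightarrow> integral (x - y)"
  by (elim DomainE) (rule DomainI, erule (1) ph_diff[OF hom])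

lemma integral_uminus [simp, intro]: "integral x \<Longrightarrow> integral (- x)"
  by (elim DomainE) (rule DomainI, erule ph_uminus[OF hom])

lemma integral_sum: "(\<And>i. i \<in> S \<Longrightarrow> integral (f i)) \<Longrightarrow> integral (sum f S)"
  by (induction S rule: infinite_finite_induct) auto

lemma integral_power: "integral x \<Longrightarrow> integral (x ^ n)"
  by (induction n) auto

lemma integral_or: "integral x \<or> integral (inverse x)"
  using val by blast

text \<open>A valuation ring is integrally closed.\<close>

lemma integral_of_power:
  assumes "integral (x ^ n)" "n > 0"
  shows "integral x"
proof (rule ccontr)
  assume "\<not> integral x"
  then have "(inverse x, 0) \<in> Q" "x \<noteq> 0" using val by auto
  then have *: "(inverse x ^ n, 0) \<in> Q" using ph_power[OF hom] assms(2) by (metis power_0_left less_numeral_extra(3))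
  obtain y where "(x ^ n, y) \<in> Q" using assms by blast
  from ph_mult[OF hom this *] have "(1, 0) \<in> Q"
    using \<open>x \<noteq> 0\<close> by (simp flip: power_mult_distrib)
  then show False using ph_unique[OF hom ph_one[OF hom]] by fastforce
qed

text \<open>
  The logarithms of the units form a \<open>\<rat>\<close>-subspace of \<open>\<complex>\<close>, because roots of units are units.
  A complement \<open>W\<close> splits the valuation: every nonzero number is a unit times \<open>exp w\<close> with
  \<open>w \<in> W\<close>, and \<open>exp w\<close> is a unit for \<open>w = 0\<close> only.
\<close>

lemma logarithms_of_values:
  obtains W where "0 \<in> W" "\<And>v w. v \<in> W \<Longrightarrow> w \<in> W \<Longrightarrow> v + w \<in> W" "\<And>w. w \<in> W \<Longrightarrow> - w \<in> W"
    "\<And>s. \<exists>w\<in>W. integral (exp (s - w)) \<and> integral (exp (w - s))"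
    "\<And>w. w \<in> W \<Longrightarrow> integral (exp w) \<Longrightarrow> integral (exp (- w)) \<Longrightarrow> w = 0"
proof -
  \<comment> \<open>An additive complement need not exist for a subgroup, but it does for a subspace over the rationals.\<close>
  interpret V: vector_space "\<lambda>(q::rat) (x::complex). of_rat q * x"
    by unfold_locales (auto simp: algebra_simps of_rat_add of_rat_mult)
  define U where "U = {s. integral (exp s) \<and> integral (exp (- s))}"
  have nat: "of_nat n * s \<in> U" if "s \<in> U" for s n
  proof -
    have "exp (- (of_nat n * s)) = exp (- s) ^ n" by (metis exp_of_nat_mult mult_minus_right)
    then show ?thesis using that by (auto simp: U_def exp_of_nat_mult intro: integral_power)
  qed
  have int: "of_int k * s \<in> U" if "s \<in> U" for s k
  proof (cases "k \<ge> 0")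
    case True
    then show ?thesis using nat[OF that, of "nat k"] by simp
  next
    case False
    have "- s \<in> U" using that by (simp add: U_def)
    from nat[OF this, of "nat (- k)"] show ?thesis using False by simp
  qed
  have root: "s / of_nat n \<in> U" if "s \<in> U" "n > 0" for s n
  proof -
    have "exp (s / of_nat n) ^ n = exp s" "exp (- (s / of_nat n)) ^ n = exp (- s)"
      using that(2) by (simp_all flip: exp_of_nat_mult)
    then show ?thesis
      using integral_of_power[OF _ that(2), of "exp (s / of_nat n)"] that(1)
        integral_of_power[OF _ that(2), of "exp (- (s / of_nat n))"]
      unfolding U_def by simp
  qed
  have sub: "V.subspace U"
  proof (rule V.subspaceI)
    show "0 \<in> U" by (simp add: U_def)
    show "x + y \<in> U" if "x \<in> U" "y \<in> U" for x y
      using that by (simp add: U_def exp_add exp_diff divide_inverse exp_minus)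
    show "of_rat q * x \<in> U" if "x \<in> U" for q x
    proof (cases q)
      case (Fract a b)
      have "of_rat q * x = (of_int a * x) / of_nat (nat b)"
        using Fract by (simp add: of_rat_rat)
      then show ?thesis using root[OF int[OF that, of a], of "nat b"] Fract by simp
    qed
  qed
  obtain B where B: "B \<subseteq> U" "V.independent B" "U \<subseteq> V.span B"
    using V.maximal_independent_subset[of U] by blast
  have UB: "U = V.span B" using B sub by (simp add: V.span_subspace)
  let ?B = "V.extend_basis B"
  have ind: "V.independent ?B" and sup: "B \<subseteq> ?B" and all: "V.span ?B = UNIV"
    using B V.extend_basis_superset V.independent_extend_basis V.span_extend_basis by auto
  let ?W = "V.span (?B - B)"
  have "B \<union> (?B - B) = ?B" using sup by blast
  then have split: "\<exists>u\<in>U. \<exists>w\<in>?W. s = u + w" for s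
    using V.span_Un[of B "?B - B"] all UB by force
  have zero: "w = 0" if "w \<in> U" "w \<in> ?W" for w
  proof -
    have "V.representation ?B w b = 0" for b
    proof (rule ccontr)
      assume "V.representation ?B w b \<noteq> 0"
      moreover have "V.representation ?B w = V.representation B w"
        using that UB by (intro V.representation_extend ind sup) auto
      moreover have "V.representation ?B w = V.representation (?B - B) w"
        using that by (intro V.representation_extend ind) auto
      ultimately show False
        using V.representation_ne_zero[of B w b] V.representation_ne_zero[of "?B - B" w b] by auto
    qed
    then show ?thesis using V.sum_nonzero_representation_eq[OF ind, of w] all by simp
  qed
  show thesis
  proof (rule that[of ?W])
    show "\<exists>w\<in>?W. integral (exp (s - w)) \<and> integral (exp (w - s))" for s
    proof -
      obtain u w where "u \<in> U" "w \<in> ?W" "s = u + w" using split by blast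
      then show ?thesis by (intro bexI[of _ w]) (auto simp: U_def)
    qed
  qed (use zero in \<open>auto simp: U_def V.span_zero V.span_add V.span_neg\<close>)
qed

subsection \<open>Invertible matrices over the valuation ring\<close>

definition integral_mat :: "complex mat \<Rightarrow> bool" where
  "integral_mat A \<longleftrightarrow> (\<forall>i < dim_row A. \<forall>j < dim_col A. integral (A $$ (i, j)))"

definition unimodular :: "nat \<Rightarrow> complex mat \<Rightarrow> complex mat \<Rightarrow> bool" where
  "unimodular d a a' \<longleftrightarrow> a \<in> carrier_mat d d \<and> a' \<in> carrier_mat d d \<and> integral_mat a \<and> integral_mat a' \<and>
     a * a' = 1\<^sub>m d \<and> a' * a = 1\<^sub>m d"

lemma integral_mat_mult:
  assumes "A \<in> carrier_mat n k" "B \<in> carrier_mat k m" "integral_mat A" "integral_mat B"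
  shows "integral_mat (A * B)"
  unfolding integral_mat_def
proof (intro allI impI)
  fix i j assume "i < dim_row (A * B)" "j < dim_col (A * B)"
  then show "integral ((A * B) $$ (i, j))"
    using assms unfolding mult_index[OF assms(1,2), of i j]
    by (subst mult_index[OF assms(1,2)]) (auto intro!: integral_sum simp: integral_mat_def)
qed

lemma unimodular_one: "unimodular d (1\<^sub>m d) (1\<^sub>m d)"
  by (auto simp: unimodular_def integral_mat_def)

lemma unimodular_mult:
  assumes "unimodular d a a'" "unimodular d b b'"
  shows "unimodular d (a * b) (b' * a')"
  using assms mult_inverse_pair[of a d a' b b'] mult_inverse_pair[of b' d b a' a]
  unfolding unimodular_def by (auto intro: integral_mat_mult)

lemma unimodular_diagm:
  assumes "\<And>i. i < d \<Longrightarrow> integral (f i) \<and> integral (g i) \<and> f i * g i = 1"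
  shows "unimodular d (diagm d f) (diagm d g)"
  unfolding unimodular_def diagm_mult
  using assms by (auto simp: integral_mat_def diagm_index mult.commute intro!: diagm_one)

text \<open>
  The values of nonzero numbers are totally ordered.
\<close>

lemma least_value:
  assumes "finite S" "S \<noteq> {}" "0 \<notin> S"
  shows "\<exists>p\<in>S. \<forall>x\<in>S. integral (x / p)"
  using assms
proof (induction S rule: finite_ne_induct)
  case (insert y S)
  then obtain p where p: "p \<in> S" "\<And>x. x \<in> S \<Longrightarrow> integral (x / p)" by auto
  have p0: "p \<noteq> 0" "y \<noteq> 0" using p insert by auto
  show ?case
  proof (cases "integral (y / p)")
    case False
    then have *: "integral (p / y)" using integral_or[of "y / p"] by simp
    have "integral (x / y)" if "x \<in> S" for x
    proof -
      have "x / y = (x / p) * (p / y)" using p0 by simp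
      then show ?thesis using integral_mult[OF p(2)[OF that] *] by metis
    qed
    then show ?thesis using p0 by auto
  qed (use p in auto)
qed auto

lemma unimodular_swap:
  assumes "k < d" "l < d"
  shows "unimodular d (swaprows_mat d k l) (swaprows_mat d k l)"
  using assms swaprows_mat_inv[OF assms] by (auto simp: unimodular_def integral_mat_def)

lemma integral_mat_four_block:
  assumes "A \<in> carrier_mat n1 m1" "B \<in> carrier_mat n1 m2" "C \<in> carrier_mat n2 m1" "D \<in> carrier_mat n2 m2"
    "integral_mat A" "integral_mat B" "integral_mat C" "integral_mat D"
  shows "integral_mat (four_block_mat A B C D)"
  using assms unfolding integral_mat_def by (auto simp: four_block_mat_def Let_def)

text \<open>
  An entry of least value divides all others; two transpositions move it to the corner.
\<close>

lemma pivot_form: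
  assumes A: "A \<in> carrier_mat (Suc d) (Suc d)" "A \<noteq> 0\<^sub>m (Suc d) (Suc d)"
  obtains P1 P2 M p where "unimodular (Suc d) P1 P1" "unimodular (Suc d) P2 P2" "A = P1 * M * P2"
    "M \<in> carrier_mat (Suc d) (Suc d)" "p \<noteq> 0" "M $$ (0, 0) = p"
    "\<And>i j. i < Suc d \<Longrightarrow> j < Suc d \<Longrightarrow> integral (M $$ (i, j) / p)"
proof -
  define S where "S = {A $$ (i, j) | i j. i < Suc d \<and> j < Suc d} - {0}"
  have "S \<subseteq> (\<lambda>(i, j). A $$ (i, j)) ` ({..<Suc d} \<times> {..<Suc d})" unfolding S_def by auto
  then have fin: "finite S" by (rule finite_subset) simp
  have "S \<noteq> {}"
  proof
    assume "S = {}"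
    then have "A = 0\<^sub>m (Suc d) (Suc d)" using A(1) unfolding S_def by (intro eq_matI) auto
    then show False using A(2) by contradiction
  qed
  then obtain p where p: "p \<in> S" "\<And>x. x \<in> S \<Longrightarrow> integral (x / p)"
    using least_value[OF fin] unfolding S_def by blast
  then obtain i0 j0 where ij: "i0 < Suc d" "j0 < Suc d" "A $$ (i0, j0) = p" and p0: "p \<noteq> 0"
    unfolding S_def by auto
  have quot: "integral (A $$ (i, j) / p)" if "i < Suc d" "j < Suc d" for i j
    using p(2)[of "A $$ (i, j)"] that unfolding S_def by (cases "A $$ (i, j) = 0") auto
  define P1 P2 :: "complex mat" where "P1 = swaprows_mat (Suc d) 0 i0" and "P2 = swaprows_mat (Suc d) 0 j0"
  have P1: "unimodular (Suc d) P1 P1" and P2: "unimodular (Suc d) P2 P2"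
    unfolding P1_def P2_def using ij by (auto intro: unimodular_swap)
  have Pc: "P1 \<in> carrier_mat (Suc d) (Suc d)" "P2 \<in> carrier_mat (Suc d) (Suc d)"
    using P1 P2 by (auto simp: unimodular_def)
  define M where "M = P1 * A * P2"
  have M: "M \<in> carrier_mat (Suc d) (Suc d)" using Pc A unfolding M_def by auto
  have Mind: "M $$ (i, j) = A $$ (if i = 0 then i0 else if i = i0 then 0 else i,
      if j = 0 then j0 else if j = j0 then 0 else j)" if "i < Suc d" "j < Suc d" for i j
  proof -
    have 1: "P1 * A = swaprows 0 i0 A"
      unfolding P1_def using swaprows_mat[OF A(1), of 0 i0] ij by simp
    have "M = (P2\<^sup>T * (P1 * A)\<^sup>T)\<^sup>T"
      unfolding M_def using Pc A by (subst transpose_mult[symmetric, of "P1 * A" "Suc d" "Suc d" P2 "Suc d"]) auto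
    moreover have "P2\<^sup>T = P2" unfolding P2_def by (rule eq_matI) auto
    moreover have "P2 * (P1 * A)\<^sup>T = swaprows 0 j0 (P1 * A)\<^sup>T"
      unfolding P2_def using swaprows_mat[of "(P1 * A)\<^sup>T" "Suc d" "Suc d" 0 j0] ij A Pc by simp
    ultimately have "M = (swaprows 0 j0 (swaprows 0 i0 A)\<^sup>T)\<^sup>T" using 1 by simp
    then show ?thesis using that ij A by auto
  qed
  have M00: "M $$ (0, 0) = p" using Mind[of 0 0] ij by simp
  have Mquot: "integral (M $$ (i, j) / p)" if "i < Suc d" "j < Suc d" for i j
    unfolding Mind[OF that] using that ij by (intro quot) auto
  have "A = (P1 * P1) * A * (P2 * P2)" using P1 P2 A(1) by (simp add: unimodular_def)
  also have "\<dots> = P1 * M * P2" unfolding M_def using A(1) Pc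
    by (simp add: square_mult_assoc[of _ "Suc d"])
  finally show thesis using that P1 P2 M p0 M00 Mquot by blast
qed

text \<open>
  The inverse of a block matrix with rows \<open>(1, 0)\<close> and \<open>(c, a)\<close> has rows \<open>(1, 0)\<close> and \<open>(- a' c, a')\<close>.
\<close>

lemma unimodular_lower_border:
  assumes a: "unimodular d a a'" and c: "c \<in> carrier_mat d 1" "integral_mat c"
  shows "\<exists>e. unimodular (Suc d) (four_block_mat (1\<^sub>m 1) (0\<^sub>m 1 d) c a) e"
proof -
  have ac: "a \<in> carrier_mat d d" "a' \<in> carrier_mat d d" "integral_mat a" "integral_mat a'"
    "a * a' = 1\<^sub>m d" "a' * a = 1\<^sub>m d" using a by (auto simp: unimodular_def)
  define E where "E = four_block_mat (1\<^sub>m 1) (0\<^sub>m 1 d) c a"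
  define E' where "E' = four_block_mat (1\<^sub>m 1) (0\<^sub>m 1 d) (- (a' * c)) a'"
  have one: "1\<^sub>m (Suc d) = (four_block_mat (1\<^sub>m 1) (0\<^sub>m 1 d) (0\<^sub>m d 1) (1\<^sub>m d) :: complex mat)"
    by (rule eq_matI) (auto simp: four_block_mat_def Let_def)
  have mz: "- 0\<^sub>m n k = (0\<^sub>m n k :: complex mat)" for n k by (rule eq_matI) auto
  have c': "a' * c \<in> carrier_mat d 1" using ac c by auto
  have E: "E \<in> carrier_mat (Suc d) (Suc d)" "E' \<in> carrier_mat (Suc d) (Suc d)"
    unfolding E_def E'_def using ac by (metis four_block_carrier_mat one_carrier_mat plus_1_eq_Suc)+
  have "E' * E = 1\<^sub>m (Suc d)" unfolding E_def E'_def one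
  proof (subst mult_four_block_mat[of _ 1 1 _ d _ d _ _ 1 _ d])
    show "four_block_mat (1\<^sub>m 1 * 1\<^sub>m 1 + 0\<^sub>m 1 d * c) (1\<^sub>m 1 * 0\<^sub>m 1 d + 0\<^sub>m 1 d * a)
        (- (a' * c) * 1\<^sub>m 1 + a' * c) (- (a' * c) * 0\<^sub>m 1 d + a' * a)
      = four_block_mat (1\<^sub>m 1) (0\<^sub>m 1 d) (0\<^sub>m d 1) (1\<^sub>m d)"
      using ac c c' by (simp add: uminus_l_inv_mat[of _ d 1] mz)
  qed (use ac c c' in auto)
  moreover from this have "E * E' = 1\<^sub>m (Suc d)" using mat_mult_left_right_inverse[OF E(2,1)] by simp
  moreover have "integral_mat (0\<^sub>m n k)" "integral_mat (1\<^sub>m n)" for n k by (auto simp: integral_mat_def)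
  moreover have "integral_mat (- (a' * c))"
    using integral_mat_mult[OF ac(2) c(1) ac(4) c(2)] by (auto simp: integral_mat_def)
  ultimately have "unimodular (Suc d) E E'"
    using E ac c c' unfolding unimodular_def E_def E'_def
    by (auto intro!: integral_mat_four_block[of _ 1 1 _ d _ d])
  then show ?thesis unfolding E_def by blast
qed

lemma unimodular_transpose:
  assumes "unimodular d a a'"
  shows "unimodular d a\<^sup>T a'\<^sup>T"
proof -
  have "a\<^sup>T * a'\<^sup>T = (a' * a)\<^sup>T" "a'\<^sup>T * a\<^sup>T = (a * a')\<^sup>T"
    using assms unfolding unimodular_def by (metis transpose_mult)+
  then show ?thesis using assms by (auto simp: unimodular_def integral_mat_def)
qed

lemma unimodular_upper_border:
  assumes b: "unimodular d b b'" and r: "r \<in> carrier_mat 1 d" "integral_mat r"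
  shows "\<exists>e. unimodular (Suc d) (four_block_mat (1\<^sub>m 1) r (0\<^sub>m d 1) b) e"
proof -
  obtain e where "unimodular (Suc d) (four_block_mat (1\<^sub>m 1) (0\<^sub>m 1 d) r\<^sup>T b\<^sup>T) e"
    using unimodular_lower_border[OF unimodular_transpose[OF b], of "r\<^sup>T"] r
    by (auto simp: integral_mat_def)
  from unimodular_transpose[OF this]
  have "unimodular (Suc d) (four_block_mat (1\<^sub>m 1) (0\<^sub>m 1 d) r\<^sup>T b\<^sup>T)\<^sup>T e\<^sup>T" .
  moreover have "(four_block_mat (1\<^sub>m 1) (0\<^sub>m 1 d) r\<^sup>T b\<^sup>T)\<^sup>T = four_block_mat (1\<^sub>m 1) r (0\<^sub>m d 1) b"
    using r b by (intro eq_matI) (auto simp: four_block_mat_def Let_def unimodular_def)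
  ultimately show ?thesis by auto
qed

text \<open>
  Elimination with a pivot of least value stays inside the valuation ring.  Only the pivot and the
  Schur complement \<open>C\<close> remain; the entries of \<open>C\<close> are multiples of the pivot.
\<close>

theorem smith_form:
  assumes "A \<in> carrier_mat d d"
  shows "\<exists>a a' b b' t. unimodular d a a' \<and> unimodular d b b' \<and> A = a * diagm d t * b \<and>
    (\<forall>i j. i \<le> j \<longrightarrow> j < d \<longrightarrow> (\<exists>e. integral e \<and> t j = e * t i))"
  using assms
proof (induction d arbitrary: A)
  case 0
  then have "A = 1\<^sub>m 0 * diagm 0 (\<lambda>_. 0) * 1\<^sub>m 0" by (auto intro!: eq_matI)
  then show ?case using unimodular_one[of 0] by fastforce
next
  case (Suc d)
  show ?case
  proof (cases "A = 0\<^sub>m (Suc d) (Suc d)")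
    case True
    then have "A = diagm (Suc d) (\<lambda>_. 0)" by (intro eq_matI) (auto simp: diagm_index)
    then have "A = 1\<^sub>m (Suc d) * diagm (Suc d) (\<lambda>_. 0) * 1\<^sub>m (Suc d)" by simp
    moreover have "\<exists>e. integral e \<and> (0::complex) = e * 0" by (intro exI[of _ 0]) simp
    ultimately show ?thesis using unimodular_one[of "Suc d"] by blast
  next
    case False
    obtain P1 P2 M p where P1: "unimodular (Suc d) P1 P1" and P2: "unimodular (Suc d) P2 P2"
      and AM: "A = P1 * M * P2" and M: "M \<in> carrier_mat (Suc d) (Suc d)" and p0: "p \<noteq> 0"
      and M00: "M $$ (0, 0) = p" and Mquot: "\<And>i j. i < Suc d \<Longrightarrow> j < Suc d \<Longrightarrow> integral (M $$ (i, j) / p)"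
      using pivot_form[OF Suc.prems False] by blast
    define C where "C = mat d d (\<lambda>(i, j). M $$ (Suc i, Suc j) - M $$ (Suc i, 0) * M $$ (0, Suc j) / p)"
    have C: "C \<in> carrier_mat d d" unfolding C_def by simp
    obtain a a' b b' t where ab: "unimodular d a a'" "unimodular d b b'" "C = a * diagm d t * b"
      and div: "\<And>i j. i \<le> j \<Longrightarrow> j < d \<Longrightarrow> \<exists>e. integral e \<and> t j = e * t i"
      using Suc.IH[OF C] by blast
    have abc: "a \<in> carrier_mat d d" "a' \<in> carrier_mat d d" "b \<in> carrier_mat d d" "b' \<in> carrier_mat d d"
      "integral_mat a" "integral_mat a'" "integral_mat b" "integral_mat b'"
      "a * a' = 1\<^sub>m d" "a' * a = 1\<^sub>m d" "b * b' = 1\<^sub>m d" "b' * b = 1\<^sub>m d"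
      using ab by (auto simp: unimodular_def)
    have tdiv: "\<exists>e. integral e \<and> t i = e * p" if "i < d" for i
    proof -
      define C' where "C' = mat d d (\<lambda>(i, j). M $$ (Suc i, Suc j) / p - (M $$ (Suc i, 0) / p) * (M $$ (0, Suc j) / p))"
      have C': "C' \<in> carrier_mat d d" "integral_mat C'"
        unfolding C'_def integral_mat_def using Mquot
        by (auto simp del: times_divide_times_eq times_divide_eq_left times_divide_eq_right
            intro!: integral_diff integral_mult)
      have CC': "C = p \<cdot>\<^sub>m C'" unfolding C_def C'_def using p0 by (intro eq_matI) (auto simp: field_simps)
      have "a' * C * b' = (a' * a) * diagm d t * (b * b')"
        unfolding ab(3) using abc(1-4) by (simp add: square_mult_assoc[of _ d])
      also have "\<dots> = diagm d t" unfolding abc using left_mult_one_mat right_mult_one_mat diagm_carrier by metis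
      finally have "diagm d t = p \<cdot>\<^sub>m (a' * C' * b')"
        unfolding CC' using abc(1-4) C' by (simp add: mult_smult_distrib[of _ d d _ d] mult_smult_assoc_mat[of _ d d _ d])
      then have "t i = p * (a' * C' * b') $$ (i, i)"
        using that abc C' by (metis diagm_dims diagm_index index_smult_mat(1,2,3))
      moreover have "integral_mat (a' * C' * b')"
        using abc C' by (intro integral_mat_mult[of _ d d _ d]) auto
      ultimately show ?thesis using that abc C' unfolding integral_mat_def
        by (intro exI[of _ "(a' * C' * b') $$ (i, i)"]) (auto simp: mult.commute)
    qed
    define r where "r = mat 1 d (\<lambda>(i, j). M $$ (0, Suc j) / p)"
    define c where "c = mat d 1 (\<lambda>(i, j). M $$ (Suc i, 0) / p)"
    have rc: "r \<in> carrier_mat 1 d" "c \<in> carrier_mat d 1" "integral_mat r" "integral_mat c"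
      unfolding r_def c_def integral_mat_def using Mquot by auto
    define a2 where "a2 = four_block_mat (1\<^sub>m 1) (0\<^sub>m 1 d) c a"
    define b2 where "b2 = four_block_mat (1\<^sub>m 1) r (0\<^sub>m d 1) b"
    define t' where "t' = (\<lambda>i. case i of 0 \<Rightarrow> p | Suc k \<Rightarrow> t k)"
    obtain a2' b2' where a2: "unimodular (Suc d) a2 a2'" and b2: "unimodular (Suc d) b2 b2'"
      using unimodular_lower_border[OF ab(1) rc(2,4)] unimodular_upper_border[OF ab(2) rc(1,3)]
      unfolding a2_def b2_def by blast
    have diag: "diagm (Suc d) t' = four_block_mat (p \<cdot>\<^sub>m 1\<^sub>m 1) (0\<^sub>m 1 d) (0\<^sub>m d 1) (diagm d t)"
      by (rule eq_matI) (auto simp: four_block_mat_def Let_def diagm_def t'_def split: nat.splits)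
    have "a2 * diagm (Suc d) t' * b2 = four_block_mat (p \<cdot>\<^sub>m 1\<^sub>m 1) (p \<cdot>\<^sub>m r) (p \<cdot>\<^sub>m c) (p \<cdot>\<^sub>m (c * r) + C)"
    proof -
      have "a2 * diagm (Suc d) t' = four_block_mat (p \<cdot>\<^sub>m 1\<^sub>m 1) (0\<^sub>m 1 d) (p \<cdot>\<^sub>m c) (a * diagm d t)"
        unfolding a2_def diag using abc rc
        by (subst mult_four_block_mat[of _ 1 1 _ d _ d _ _ 1 _ d]) (auto simp: mult_smult_distrib[of _ _ 1])
      moreover have pr: "p \<cdot>\<^sub>m 1\<^sub>m (Suc 0) * r + 0\<^sub>m (Suc 0) d = p \<cdot>\<^sub>m r"
        using rc mult_smult_assoc_mat[of "1\<^sub>m 1" 1 1 r d p] by simp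
      moreover have "four_block_mat (p \<cdot>\<^sub>m 1\<^sub>m 1) (0\<^sub>m 1 d) (p \<cdot>\<^sub>m c) (a * diagm d t) * b2 = four_block_mat (p \<cdot>\<^sub>m 1\<^sub>m 1) (p \<cdot>\<^sub>m r) (p \<cdot>\<^sub>m c) (p \<cdot>\<^sub>m (c * r) + C)"
        unfolding b2_def ab(3) using abc rc
        by (subst mult_four_block_mat[of _ 1 1 _ d _ d _ _ 1 _ d])
          (auto simp: pr)
      ultimately show ?thesis by simp
    qed
    also have "\<dots> = M"
    proof (rule eq_matI)
      fix i j assume "i < dim_row M" "j < dim_col M"
      then have "i < Suc d" "j < Suc d" using M by auto
      then show "four_block_mat (p \<cdot>\<^sub>m 1\<^sub>m 1) (p \<cdot>\<^sub>m r) (p \<cdot>\<^sub>m c) (p \<cdot>\<^sub>m (c * r) + C) $$ (i, j) = M $$ (i, j)"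
        using p0 M00 by (cases i; cases j)
          (auto simp: r_def c_def C_def four_block_mat_def Let_def scalar_prod_def)
    qed (use M rc C in auto)
    finally have Meq: "M = a2 * diagm (Suc d) t' * b2" ..
    have "P1 \<in> carrier_mat (Suc d) (Suc d)" "P2 \<in> carrier_mat (Suc d) (Suc d)"
      "a2 \<in> carrier_mat (Suc d) (Suc d)" "b2 \<in> carrier_mat (Suc d) (Suc d)"
      using P1 P2 a2 b2 by (auto simp: unimodular_def)
    then have eq: "A = (P1 * a2) * diagm (Suc d) t' * (b2 * P2)"
      unfolding AM Meq by (simp add: square_mult_assoc[of _ "Suc d"])
    have "\<exists>e. integral e \<and> t' j = e * t' i" if le: "i \<le> j" "j < Suc d" for i j
    proof (cases i)
      case 0
      show ?thesis
      proof (cases j)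
        case 0
        then show ?thesis using \<open>i = 0\<close> by (intro exI[of _ 1]) simp
      qed (use 0 tdiv le in \<open>auto simp: t'_def\<close>)
    next
      case (Suc k)
      then obtain l where "j = Suc l" using le by (cases j) auto
      then show ?thesis using div[of k l] Suc le by (simp add: t'_def)
    qed
    then show ?thesis using eq unimodular_mult[OF P1 a2] unimodular_mult[OF b2 P2] by blast
  qed
qed

text \<open>
  The unit parts of the diagonal entries of the Smith form are moved into the left factor, which leaves
  exponentials of elements of \<open>W\<close>.
\<close>

theorem cartan_decomposition:
  assumes A: "A \<in> carrier_mat d d" "A' \<in> carrier_mat d d" "A * A' = 1\<^sub>m d"
    and W: "\<And>s. \<exists>w\<in>W. integral (exp (s - w)) \<and> integral (exp (w - s))"
  obtains a a' b b' l where "unimodular d a a'" "unimodular d b b'" "A = a * diagm d (\<lambda>i. exp (l i)) * b"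
    "\<And>i. l i \<in> W" "\<And>i j. i \<le> j \<Longrightarrow> j < d \<Longrightarrow> integral (exp (l j - l i))"
proof -
  obtain a a' b b' t where ab: "unimodular d a a'" "unimodular d b b'" "A = a * diagm d t * b"
    and div: "\<And>i j. i \<le> j \<Longrightarrow> j < d \<Longrightarrow> \<exists>e. integral e \<and> t j = e * t i"
    using smith_form[OF A(1)] by blast
  have abc: "a \<in> carrier_mat d d" "a' \<in> carrier_mat d d" "b \<in> carrier_mat d d" "b' \<in> carrier_mat d d"
    "a' * a = 1\<^sub>m d"
    using ab by (auto simp: unimodular_def)
  have t0: "t i \<noteq> 0" if "i < d" for i
  proof -
    have "diagm d t * (b * A' * a) = (a' * a) * (diagm d t * (b * A' * a))"
      using abc A by (simp add: left_mult_one_mat[of _ d d])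
    also have "\<dots> = a' * (A * A') * a" unfolding ab(3)
      using abc(1-4) A(1,2)
      by (simp add: square_mult_assoc[of _ d])
    also have "\<dots> = 1\<^sub>m d" unfolding A(3) using abc by simp
    finally have "(diagm d t * (b * A' * a)) $$ (i, i) = 1" using that by simp
    moreover have "b * A' * a \<in> carrier_mat d d" using abc A by auto
    ultimately show ?thesis using diagm_mult_index[of "b * A' * a" d d i i t] that by auto
  qed
  have "\<exists>s. exp s = t i" if "i < d" for i
  proof -
    obtain x r where *: "t i = of_real r * exp x" using complex_exp_exists by blast
    then have "r \<noteq> 0" using t0[OF that] by auto
    have "exp (x + (if r > 0 then of_real (ln r) else of_real (ln (- r)) + \<i> * of_real pi)) = t i"
      unfolding * using \<open>r \<noteq> 0\<close>
      by (auto simp: exp_add exp_of_real exp_pi_i simp flip: of_real_exp)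
    then show ?thesis by blast
  qed
  then obtain s where s: "\<And>i. i < d \<Longrightarrow> exp (s i) = t i" by metis
  have "\<forall>i. \<exists>w. w \<in> W \<and> integral (exp (s i - w)) \<and> integral (exp (w - s i))" using W by blast
  from choice[OF this] obtain l where l: "\<And>i. l i \<in> W" "\<And>i. integral (exp (s i - l i))"
    "\<And>i. integral (exp (l i - s i))" by blast
  let ?u = "diagm d (\<lambda>i. exp (s i - l i))"
  have u: "unimodular d ?u (diagm d (\<lambda>i. exp (l i - s i)))"
    using l by (intro unimodular_diagm) (auto simp flip: exp_add)
  have "diagm d t = ?u * diagm d (\<lambda>i. exp (l i))"
    unfolding diagm_mult using s by (intro eq_matI) (auto simp: diagm_index simp flip: exp_add)
  then have "A = (a * ?u) * diagm d (\<lambda>i. exp (l i)) * b"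
    unfolding ab(3) using abc by (simp add: square_mult_assoc[of _ d])
  moreover have "integral (exp (l j - l i))" if ij: "i \<le> j" "j < d" for i j
  proof -
    obtain e where e: "integral e" "t j = e * t i" using div[OF ij] by blast
    have "exp (l j - l i) = exp (l j - s j) * (exp (s j) / exp (s i)) * exp (s i - l i)"
      by (simp flip: exp_diff exp_add)
    also have "exp (s j) / exp (s i) = t j / t i" using s ij by simp
    also have "t j / t i = e" using e t0[of i] ij by simp
    finally show ?thesis using e l by simp
  qed
  ultimately show thesis using that unimodular_mult[OF ab(1) u] ab(2) l(1) by blast
qed

end

section \<open>Families of matrices, their tensor products and their weights\<close>

definition square_family :: "nat list \<Rightarrow> (nat \<Rightarrow> complex mat) \<Rightarrow> bool" where
  "square_family ds A \<longleftrightarrow> (\<forall>s < length ds. A s \<in> carrier_mat (ds ! s) (ds ! s))"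

text \<open>
  Families are indexed by all natural numbers, with meaning for indices below \<open>length ds\<close> only, so
  that they can be shifted in inductions on \<open>ds\<close>.
\<close>

definition tens :: "nat list \<Rightarrow> (nat \<Rightarrow> complex mat) \<Rightarrow> complex mat" where
  "tens ds A = tensor_mat (map A [0..<length ds])"

lemma choose_families:
  "(\<And>s. s < (n :: nat) \<Longrightarrow> \<exists>x y. P s x y) \<Longrightarrow> \<exists>f g. \<forall>s<n. P s (f s) (g s)"
  by metis

lemma all_less_Cons:
  "(\<forall>s < length (d # ds). P s ((d # ds) ! s)) \<longleftrightarrow> P 0 d \<and> (\<forall>s < length ds. P (Suc s) (ds ! s))"
  by (auto simp: All_less_Suc2)

lemma square_family_Cons:
  "square_family (d # ds) A \<longleftrightarrow> A 0 \<in> carrier_mat d d \<and> square_family ds (\<lambda>s. A (Suc s))"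
  unfolding square_family_def by (rule all_less_Cons)

lemma tens_Nil: "tens [] A = 1\<^sub>m 1"
  by (simp add: tens_def)

lemma tens_Cons: "tens (d # ds) A = kron (A 0) (tens ds (\<lambda>s. A (Suc s)))"
  by (simp add: tens_def map_upt_Suc del: upt_Suc)

lemma tens_cong: "(\<And>s. s < length ds \<Longrightarrow> A s = B s) \<Longrightarrow> tens ds A = tens ds B"
  by (auto simp: tens_def intro!: arg_cong[where f = tensor_mat])

lemma tens_carrier [simp]:
  "square_family ds A \<Longrightarrow> tens ds A \<in> carrier_mat (prod_list ds) (prod_list ds)"
  by (induction ds arbitrary: A) (auto simp: tens_Nil tens_Cons square_family_Cons intro!: kron_carrier)

lemma tens_mult:
  "square_family ds A \<Longrightarrow> square_family ds B \<Longrightarrow> tens ds A * tens ds B = tens ds (\<lambda>s. A s * B s)"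
proof (induction ds arbitrary: A B)
  case (Cons d ds)
  then show ?case
    by (simp add: square_family_Cons tens_Cons kron_mult[of _ d _ "prod_list ds"])
qed (simp add: tens_Nil)

lemma tens_one: "(\<And>s. s < length ds \<Longrightarrow> A s = 1\<^sub>m (ds ! s)) \<Longrightarrow> tens ds A = 1\<^sub>m (prod_list ds)"
proof (induction ds arbitrary: A)
  case (Cons d ds)
  have "tens ds (\<lambda>s. A (Suc s)) = 1\<^sub>m (prod_list ds)" using Cons.prems by (intro Cons.IH) fastforce
  moreover have "A 0 = 1\<^sub>m d" using Cons.prems[of 0] by simp
  ultimately show ?case by (simp add: tens_Cons kron_one)
qed (simp add: tens_Nil)

lemma kron_index:
  assumes "A \<in> carrier_mat a a" "B \<in> carrier_mat c c" "i < a * c" "j < a * c"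
  shows "kron A B $$ (i, j) = A $$ (i div c, j div c) * B $$ (i mod c, j mod c)"
  using assms by (auto simp: kron_def)

lemma kron_indices:
  assumes "(i::nat) < a * c"
  shows "i div c < a" "i mod c < c"
  using div_less_of_mult[OF assms] mod_less_of_mult[OF assms] .

lemma eq_iff_div_mod: "(i::nat) = j \<longleftrightarrow> i div c = j div c \<and> i mod c = j mod c"
  by (metis div_mult_mod_eq)

text \<open>
  The weight of the basis vector \<open>I\<close> of the tensor product, when basis vector \<open>i\<close> of factor \<open>s\<close> has
  weight \<open>l s i\<close>: a sum, as the weights are logarithms of diagonal entries.
\<close>

fun wt :: "nat list \<Rightarrow> (nat \<Rightarrow> nat \<Rightarrow> complex) \<Rightarrow> nat \<Rightarrow> complex" where
  "wt [] l I = 0"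
| "wt (d # ds) l I = l 0 (I div prod_list ds) + wt ds (\<lambda>s. l (Suc s)) (I mod prod_list ds)"

lemma wt_mem:
  assumes "0 \<in> W" "\<And>v w. v \<in> W \<Longrightarrow> w \<in> W \<Longrightarrow> v + w \<in> W" "\<And>s i. l s i \<in> W"
  shows "wt ds l I \<in> W"
  using assms(3) by (induction ds arbitrary: l I) (auto intro: assms(1,2))

lemma tens_diagm:
  "tens ds (\<lambda>s. diagm (ds ! s) (\<lambda>i. exp (l s i))) = diagm (prod_list ds) (\<lambda>I. exp (wt ds l I))"
proof (induction ds arbitrary: l)
  case (Cons d ds)
  let ?N = "prod_list ds"
  show ?case
  proof (rule eq_matI)
    fix I J assume "I < dim_row (diagm (prod_list (d # ds)) (\<lambda>I. exp (wt (d # ds) l I)))"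
      "J < dim_col (diagm (prod_list (d # ds)) (\<lambda>I. exp (wt (d # ds) l I)))"
    then have IJ: "I < d * ?N" "J < d * ?N" by auto
    have eq: "I = J \<longleftrightarrow> I div ?N = J div ?N \<and> I mod ?N = J mod ?N" by (rule eq_iff_div_mod)
    show "tens (d # ds) (\<lambda>s. diagm ((d # ds) ! s) (\<lambda>i. exp (l s i))) $$ (I, J)
        = diagm (prod_list (d # ds)) (\<lambda>I. exp (wt (d # ds) l I)) $$ (I, J)"
      using IJ kron_indices[OF IJ(1)] kron_indices[OF IJ(2)]
      by (simp add: tens_Cons Cons kron_index[of _ d _ ?N] diagm_index exp_add eq)
  qed (simp_all add: tens_Cons Cons kron_def)
qed (auto simp: tens_Nil diagm_def intro!: eq_matI)

text \<open>
  The matrix unit \<open>(i, j)\<close> is an eigenvector of the bracket with the diagonal matrix \<open>l\<close>, with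
  eigenvalue \<open>l i - l j\<close>.  This difference is its weight.  All entries of \<open>A\<close> have weights in \<open>C\<close> if
  \<open>supp d l C A\<close> holds, and \<open>part0\<close> keeps the entries of weight zero.
\<close>

definition supp :: "nat \<Rightarrow> (nat \<Rightarrow> complex) \<Rightarrow> complex set \<Rightarrow> complex mat \<Rightarrow> bool" where
  "supp d l C A \<longleftrightarrow> (\<forall>i < d. \<forall>j < d. A $$ (i, j) \<noteq> 0 \<longrightarrow> l i - l j \<in> C)"

lemma suppD: "supp d l C A \<Longrightarrow> i < d \<Longrightarrow> j < d \<Longrightarrow> A $$ (i, j) \<noteq> 0 \<Longrightarrow> l i - l j \<in> C"
  unfolding supp_def by blast

definition part0 :: "nat \<Rightarrow> (nat \<Rightarrow> complex) \<Rightarrow> complex mat \<Rightarrow> complex mat" where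
  "part0 d l A = mat d d (\<lambda>(i, j). if l i = l j then A $$ (i, j) else 0)"

lemma part0_carrier [simp]: "part0 d l A \<in> carrier_mat d d"
  by (simp add: part0_def)

lemma part0_dims [simp]: "dim_row (part0 d l A) = d" "dim_col (part0 d l A) = d"
  by (simp_all add: part0_def)

lemma part0_index: "i < d \<Longrightarrow> j < d \<Longrightarrow> part0 d l A $$ (i, j) = (if l i = l j then A $$ (i, j) else 0)"
  by (simp add: part0_def)

lemma part0_one: "part0 d l (1\<^sub>m d) = 1\<^sub>m d"
  by (rule eq_matI) (auto simp: part0_def)

lemma square_family_part0: "square_family ds (\<lambda>s. part0 (ds ! s) (l s) (A s))"
  by (simp add: square_family_def)

text \<open>
  The nonnegative elements of a partial order that is compatible with addition.
\<close>

locale cone =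
  fixes C :: "complex set"
  assumes zero: "0 \<in> C" and add: "c \<in> C \<Longrightarrow> c' \<in> C \<Longrightarrow> c + c' \<in> C"
    and pointed: "c \<in> C \<Longrightarrow> - c \<in> C \<Longrightarrow> c = 0"
begin

lemma sum_zeroD: "c \<in> C \<Longrightarrow> c' \<in> C \<Longrightarrow> c + c' = 0 \<Longrightarrow> c = 0 \<and> c' = 0"
  using pointed[of c] pointed[of c'] by (metis add_eq_0_iff add.commute)

lemma supp_mult:
  assumes "A \<in> carrier_mat d d" "B \<in> carrier_mat d d" "supp d l C A" "supp d l C B"
  shows "supp d l C (A * B)"
  unfolding supp_def
proof (intro allI impI)
  fix i j assume ij: "i < d" "j < d" "(A * B) $$ (i, j) \<noteq> 0"
  from ij(3) obtain k where "k < d" "A $$ (i, k) * B $$ (k, j) \<noteq> 0"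
    unfolding mult_index[OF assms(1,2) ij(1,2)]
    by (elim sum.not_neutral_contains_not_neutral) (simp only: lessThan_iff)
  then have "l i - l k \<in> C" "l k - l j \<in> C" using assms(3,4) ij by (auto simp: supp_def)
  from add[OF this] show "l i - l j \<in> C" by simp
qed

text \<open>
  Weights add up under multiplication, and two nonnegative weights with sum zero are zero.  So on
  matrices with nonnegative weights the part of weight zero is multiplicative.
\<close>

lemma part0_mult:
  assumes "A \<in> carrier_mat d d" "B \<in> carrier_mat d d" "supp d l C A" "supp d l C B"
  shows "part0 d l (A * B) = part0 d l A * part0 d l B"
proof (rule eq_matI)
  fix i j assume "i < dim_row (part0 d l A * part0 d l B)" "j < dim_col (part0 d l A * part0 d l B)"
  then have ij: "i < d" "j < d" by (auto simp: part0_def)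
  have "(part0 d l A * part0 d l B) $$ (i, j)
      = (\<Sum>k<d. if l i = l k \<and> l k = l j then A $$ (i, k) * B $$ (k, j) else 0)"
    unfolding mult_index[OF part0_carrier part0_carrier ij] using ij
    by (intro sum.cong) (auto simp: part0_index)
  also have "\<dots> = (if l i = l j then (\<Sum>k<d. A $$ (i, k) * B $$ (k, j)) else 0)"
  proof (cases "l i = l j")
    case True
    have "(if l i = l k \<and> l k = l j then A $$ (i, k) * B $$ (k, j) else 0) = A $$ (i, k) * B $$ (k, j)"
      if "k \<in> {..<d}" for k
    proof (cases "A $$ (i, k) * B $$ (k, j) = 0")
      case False
      then have "l i - l k \<in> C" "l k - l j \<in> C"
        using suppD[OF assms(3), of i k] suppD[OF assms(4), of k j] ij that by simp_all
      moreover have "(l i - l k) + (l k - l j) = 0" unfolding True by simp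
      ultimately have "l i - l k = 0 \<and> l k - l j = 0" by (rule sum_zeroD)
      then have "l i = l k \<and> l k = l j" by (simp only: right_minus_eq)
      then show ?thesis by (rule if_P)
    qed simp
    from sum.cong[OF refl this] show ?thesis unfolding if_P[OF True] .
  next
    case False
    have "(if l i = l k \<and> l k = l j then A $$ (i, k) * B $$ (k, j) else 0) = 0" for k
    proof (rule if_not_P)
      show "\<not> (l i = l k \<and> l k = l j)" using False by (metis (no_types))
    qed
    then show ?thesis unfolding if_not_P[OF False] by (intro sum.neutral ballI)
  qed
  also have "\<dots> = part0 d l (A * B) $$ (i, j)"
    unfolding part0_index[OF ij] mult_index[OF assms(1,2) ij] ..
  finally show "part0 d l (A * B) $$ (i, j) = (part0 d l A * part0 d l B) $$ (i, j)" ..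
qed (auto simp: part0_def)

lemma supp_tens:
  assumes "square_family ds A" "\<And>s. s < length ds \<Longrightarrow> supp (ds ! s) (l s) C (A s)"
  shows "supp (prod_list ds) (wt ds l) C (tens ds A)"
  using assms
proof (induction ds arbitrary: A l)
  case (Cons d ds)
  let ?N = "prod_list ds" and ?B = "tens ds (\<lambda>s. A (Suc s))"
  have A: "A 0 \<in> carrier_mat d d" "square_family ds (\<lambda>s. A (Suc s))"
    using Cons.prems(1) by (auto simp: square_family_Cons)
  have s0: "supp d (l 0) C (A 0)" using Cons.prems(2)[of 0] by simp
  have s1: "supp ?N (wt ds (\<lambda>s. l (Suc s))) C ?B"
    using Cons.prems(2)[of "Suc s" for s] A by (intro Cons.IH) auto
  show ?case unfolding supp_def
  proof (intro allI impI)
    fix I J assume IJ: "I < prod_list (d # ds)" "J < prod_list (d # ds)" "tens (d # ds) A $$ (I, J) \<noteq> 0"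
    then have IJ': "I < d * ?N" "J < d * ?N" by auto
    have "A 0 $$ (I div ?N, J div ?N) \<noteq> 0" "?B $$ (I mod ?N, J mod ?N) \<noteq> 0"
      using IJ(3) unfolding tens_Cons kron_index[OF A(1) tens_carrier[OF A(2)] IJ'] by auto
    then have "l 0 (I div ?N) - l 0 (J div ?N) \<in> C"
      "wt ds (\<lambda>s. l (Suc s)) (I mod ?N) - wt ds (\<lambda>s. l (Suc s)) (J mod ?N) \<in> C"
      using s0 s1 kron_indices[OF IJ'(1)] kron_indices[OF IJ'(2)] by (auto simp: supp_def)
    from add[OF this] show "wt (d # ds) l I - wt (d # ds) l J \<in> C" by (simp add: algebra_simps)
  qed
qed (auto simp: supp_def tens_Nil zero)

lemma part0_tens:
  assumes "square_family ds A" "\<And>s. s < length ds \<Longrightarrow> supp (ds ! s) (l s) C (A s)"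
  shows "part0 (prod_list ds) (wt ds l) (tens ds A) = tens ds (\<lambda>s. part0 (ds ! s) (l s) (A s))"
  using assms
proof (induction ds arbitrary: A l)
  case (Cons d ds)
  let ?N = "prod_list ds" and ?B = "tens ds (\<lambda>s. A (Suc s))"
  let ?w = "wt ds (\<lambda>s. l (Suc s))"
  have A: "A 0 \<in> carrier_mat d d" "square_family ds (\<lambda>s. A (Suc s))"
    using Cons.prems(1) by (auto simp: square_family_Cons)
  have s0: "supp d (l 0) C (A 0)" using Cons.prems(2)[of 0] by simp
  have sS: "\<And>s. s < length ds \<Longrightarrow> supp (ds ! s) (l (Suc s)) C (A (Suc s))"
    using Cons.prems(2)[of "Suc s" for s] by auto
  have s1: "supp ?N ?w C ?B" using sS A by (intro supp_tens) auto
  have IH: "part0 ?N ?w ?B = tens ds (\<lambda>s. part0 (ds ! s) (l (Suc s)) (A (Suc s)))"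
    using sS A by (intro Cons.IH) auto
  have "part0 (prod_list (d # ds)) (wt (d # ds) l) (tens (d # ds) A) = kron (part0 d (l 0) (A 0)) (part0 ?N ?w ?B)"
  proof (rule eq_matI)
    fix I J assume "I < dim_row (kron (part0 d (l 0) (A 0)) (part0 ?N ?w ?B))"
      "J < dim_col (kron (part0 d (l 0) (A 0)) (part0 ?N ?w ?B))"
    then have IJ: "I < d * ?N" "J < d * ?N" by (auto simp: kron_def part0_def)
    note k = kron_indices[OF IJ(1)] kron_indices[OF IJ(2)]
    have "l 0 (I div ?N) = l 0 (J div ?N) \<and> ?w (I mod ?N) = ?w (J mod ?N)"
      if "A 0 $$ (I div ?N, J div ?N) * ?B $$ (I mod ?N, J mod ?N) \<noteq> 0"
        "wt (d # ds) l I = wt (d # ds) l J"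
    proof -
      have "l 0 (I div ?N) - l 0 (J div ?N) \<in> C" "?w (I mod ?N) - ?w (J mod ?N) \<in> C"
        using s0 s1 that(1) k by (auto simp: supp_def)
      from sum_zeroD[OF this] show ?thesis using that(2) by (simp add: algebra_simps)
    qed
    then show "part0 (prod_list (d # ds)) (wt (d # ds) l) (tens (d # ds) A) $$ (I, J)
        = kron (part0 d (l 0) (A 0)) (part0 ?N ?w ?B) $$ (I, J)"
      using IJ k unfolding kron_index[OF part0_carrier part0_carrier IJ]
      by (cases "A 0 $$ (I div ?N, J div ?N) * ?B $$ (I mod ?N, J mod ?N) = 0")
        (auto simp: part0_index tens_Cons kron_index[OF A(1) tens_carrier[OF A(2)] IJ])
  qed (auto simp: kron_def part0_def)
  then show ?case
    unfolding IH tens_Cons[of d ds "\<lambda>s. part0 ((d # ds) ! s) (l s) (A s)"]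
    by (simp only: nth_Cons_0 nth_Cons_Suc)
qed (auto simp: tens_Nil part0_def intro!: eq_matI)

end

text \<open>
  The derivative of the tensor product: the element of \<open>End(V)\<close> by which a family of endomorphisms of
  the factors acts infinitesimally.
\<close>

fun lie :: "nat list \<Rightarrow> (nat \<Rightarrow> complex mat) \<Rightarrow> complex mat" where
  "lie [] A = 0\<^sub>m 1 1"
| "lie (d # ds) A = kron (A 0) (1\<^sub>m (prod_list ds)) + kron (1\<^sub>m d) (lie ds (\<lambda>s. A (Suc s)))"

lemma lie_carrier [simp]:
  "square_family ds A \<Longrightarrow> lie ds A \<in> carrier_mat (prod_list ds) (prod_list ds)"
proof (induction ds arbitrary: A)
  case (Cons d ds)
  then have "kron (1\<^sub>m d) (lie ds (\<lambda>s. A (Suc s))) \<in> carrier_mat (d * prod_list ds) (d * prod_list ds)"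
    by (intro kron_carrier) (auto simp: square_family_Cons)
  then show ?case by simp
qed simp

lemma lie_cong: "(\<And>s. s < length ds \<Longrightarrow> A s = B s) \<Longrightarrow> lie ds A = lie ds B"
proof (induction ds arbitrary: A B)
  case (Cons d ds)
  have "lie ds (\<lambda>s. A (Suc s)) = lie ds (\<lambda>s. B (Suc s))" using Cons.prems by (intro Cons.IH) simp
  then show ?case using Cons.prems[of 0] by simp
qed auto

lemma lie_index_Cons:
  assumes "square_family (d # ds) A" "I < d * prod_list ds" "J < d * prod_list ds"
  shows "lie (d # ds) A $$ (I, J) =
    (if I mod prod_list ds = J mod prod_list ds then A 0 $$ (I div prod_list ds, J div prod_list ds) else 0) +
    (if I div prod_list ds = J div prod_list ds
     then lie ds (\<lambda>s. A (Suc s)) $$ (I mod prod_list ds, J mod prod_list ds) else 0)"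
proof -
  let ?N = "prod_list ds"
  have A: "A 0 \<in> carrier_mat d d" "square_family ds (\<lambda>s. A (Suc s))"
    using assms(1) by (auto simp: square_family_Cons)
  have c: "kron (1\<^sub>m d) (lie ds (\<lambda>s. A (Suc s))) \<in> carrier_mat (d * ?N) (d * ?N)"
    using A by (intro kron_carrier) auto
  show ?thesis
    using c assms(2,3) kron_indices[OF assms(2)] kron_indices[OF assms(3)]
    by (auto simp: kron_index[OF A(1) one_carrier_mat assms(2,3)]
        kron_index[OF one_carrier_mat lie_carrier[OF A(2)] assms(2,3)])
qed

lemma lie_linear:
  assumes "square_family ds A" "square_family ds B"
  shows "lie ds (\<lambda>s. c \<cdot>\<^sub>m A s + B s) = c \<cdot>\<^sub>m lie ds A + lie ds B"
  using assms
proof (induction ds arbitrary: A B)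
  case (Cons d ds)
  have sf: "square_family (d # ds) (\<lambda>s. c \<cdot>\<^sub>m A s + B s)" and cA: "square_family (d # ds) A"
    "square_family (d # ds) B" using Cons.prems by (auto simp: square_family_def)
  have cS: "lie ds (\<lambda>s. A (Suc s)) \<in> carrier_mat (prod_list ds) (prod_list ds)"
     "lie ds (\<lambda>s. B (Suc s)) \<in> carrier_mat (prod_list ds) (prod_list ds)"
     "A 0 \<in> carrier_mat d d" "B 0 \<in> carrier_mat d d"
    using cA by (auto simp: square_family_Cons)
  have IH: "lie ds (\<lambda>s. c \<cdot>\<^sub>m A (Suc s) + B (Suc s)) = c \<cdot>\<^sub>m lie ds (\<lambda>s. A (Suc s)) + lie ds (\<lambda>s. B (Suc s))"
    using Cons.prems by (intro Cons.IH) (auto simp: square_family_Cons)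
  show ?case
  proof (rule eq_matI)
    fix I J assume "I < dim_row (c \<cdot>\<^sub>m lie (d # ds) A + lie (d # ds) B)"
      "J < dim_col (c \<cdot>\<^sub>m lie (d # ds) A + lie (d # ds) B)"
    then have IJ: "I < d * prod_list ds" "J < d * prod_list ds"
      using lie_carrier[OF cA(2)] by (auto simp del: lie.simps)
    have c: "lie (d # ds) A \<in> carrier_mat (d * prod_list ds) (d * prod_list ds)"
      "lie (d # ds) B \<in> carrier_mat (d * prod_list ds) (d * prod_list ds)"
      using cA[THEN lie_carrier] by simp_all
    note k = kron_indices[OF IJ(1)] kron_indices[OF IJ(2)]
    have "(c \<cdot>\<^sub>m lie (d # ds) A + lie (d # ds) B) $$ (I, J) = c * lie (d # ds) A $$ (I, J) + lie (d # ds) B $$ (I, J)"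
      using IJ c by (simp del: lie.simps)
    then show "lie (d # ds) (\<lambda>s. c \<cdot>\<^sub>m A s + B s) $$ (I, J) = (c \<cdot>\<^sub>m lie (d # ds) A + lie (d # ds) B) $$ (I, J)"
      unfolding lie_index_Cons[OF sf IJ] lie_index_Cons[OF cA(1) IJ] lie_index_Cons[OF cA(2) IJ]
      using k cS by (auto simp: IH algebra_simps)
  qed (use lie_carrier[OF cA(1)] lie_carrier[OF cA(2)] lie_carrier[OF sf] in \<open>auto simp del: lie.simps\<close>)
qed (auto intro!: eq_matI)

text \<open>
  Each summand of \<open>lie ds A\<close> changes one tensor factor only, so the weights that occur are those of the
  members of the family.
\<close>

lemma lie_supp:
  assumes "square_family ds A" "\<And>s. s < length ds \<Longrightarrow> supp (ds ! s) (l s) C (A s)"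
  shows "supp (prod_list ds) (wt ds l) C (lie ds A)"
  using assms
proof (induction ds arbitrary: A l)
  case (Cons d ds)
  have s0: "supp d (l 0) C (A 0)" using Cons.prems(2)[of 0] by simp
  have s1: "supp (prod_list ds) (wt ds (\<lambda>s. l (Suc s))) C (lie ds (\<lambda>s. A (Suc s)))"
    using Cons.prems(2)[of "Suc s" for s] Cons.prems(1) by (intro Cons.IH) (auto simp: square_family_Cons)
  show ?case unfolding supp_def
  proof (intro allI impI)
    fix I J assume IJ: "I < prod_list (d # ds)" "J < prod_list (d # ds)" "lie (d # ds) A $$ (I, J) \<noteq> 0"
    then have IJ': "I < d * prod_list ds" "J < d * prod_list ds" by auto
    note k = kron_indices[OF IJ'(1)] kron_indices[OF IJ'(2)]
    let ?N = "prod_list ds" and ?L = "lie ds (\<lambda>s. A (Suc s))"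
    consider "I mod ?N = J mod ?N" "A 0 $$ (I div ?N, J div ?N) \<noteq> 0"
      | "I div ?N = J div ?N" "?L $$ (I mod ?N, J mod ?N) \<noteq> 0"
      using IJ(3) unfolding lie_index_Cons[OF Cons.prems(1) IJ']
      by (cases "A 0 $$ (I div ?N, J div ?N) = 0"; cases "?L $$ (I mod ?N, J mod ?N) = 0")
        (auto split: if_splits)
    then show "wt (d # ds) l I - wt (d # ds) l J \<in> C"
    proof cases
      case 1
      then show ?thesis using suppD[OF s0 k(1,3)] by simp
    next
      case 2
      then show ?thesis using suppD[OF s1 k(2,4)] by simp
    qed
  qed
qed (auto simp: supp_def)

lemma lie_diagm: "lie ds (\<lambda>s. diagm (ds ! s) (l s)) = diagm (prod_list ds) (wt ds l)"
proof (induction ds arbitrary: l)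
  case (Cons d ds)
  have sf: "square_family (d # ds) (\<lambda>s. diagm ((d # ds) ! s) (l s))" by (simp add: square_family_def)
  show ?case
  proof (rule eq_matI)
    fix I J assume "I < dim_row (diagm (prod_list (d # ds)) (wt (d # ds) l))"
      "J < dim_col (diagm (prod_list (d # ds)) (wt (d # ds) l))"
    then have IJ: "I < d * prod_list ds" "J < d * prod_list ds" by auto
    show "lie (d # ds) (\<lambda>s. diagm ((d # ds) ! s) (l s)) $$ (I, J) = diagm (prod_list (d # ds)) (wt (d # ds) l) $$ (I, J)"
      unfolding lie_index_Cons[OF sf IJ]
      using kron_indices[OF IJ(1)] kron_indices[OF IJ(2)] IJ
      by (auto simp: Cons diagm_index eq_iff_div_mod[of I J "prod_list ds"])
  qed (use lie_carrier[OF sf] in \<open>auto simp del: lie.simps\<close>)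
qed (auto simp: diagm_def intro!: eq_matI)

text \<open>
  The adjoint action of the group on its Lie algebra.
\<close>

lemma lie_conj:
  assumes "square_family ds A" "square_family ds G" "square_family ds H"
    "\<And>s. s < length ds \<Longrightarrow> G s * H s = 1\<^sub>m (ds ! s)"
  shows "tens ds G * lie ds A * tens ds H = lie ds (\<lambda>s. G s * A s * H s)"
  using assms
proof (induction ds arbitrary: A G H)
  case (Cons d ds)
  let ?N = "prod_list ds"
  have sf: "square_family ds (\<lambda>s. A (Suc s))" "square_family ds (\<lambda>s. G (Suc s))" "square_family ds (\<lambda>s. H (Suc s))"
    and c: "A 0 \<in> carrier_mat d d" "G 0 \<in> carrier_mat d d" "H 0 \<in> carrier_mat d d"
    using Cons.prems by (auto simp: square_family_Cons)
  have inv: "\<And>s. s < length ds \<Longrightarrow> G (Suc s) * H (Suc s) = 1\<^sub>m (ds ! s)" and inv0: "G 0 * H 0 = 1\<^sub>m d"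
    using Cons.prems(4)[of "Suc s" for s] Cons.prems(4)[of 0] by auto
  define L T T' where "L = lie ds (\<lambda>s. A (Suc s))" and "T = tens ds (\<lambda>s. G (Suc s))"
    and "T' = tens ds (\<lambda>s. H (Suc s))"
  have LT: "L \<in> carrier_mat ?N ?N" "T \<in> carrier_mat ?N ?N" "T' \<in> carrier_mat ?N ?N"
    unfolding L_def T_def T'_def using sf by auto
  have TT: "T * T' = 1\<^sub>m ?N" unfolding T_def T'_def using sf inv by (simp add: tens_mult tens_one)
  have IH: "T * L * T' = lie ds (\<lambda>s. G (Suc s) * A (Suc s) * H (Suc s))"
    unfolding L_def T_def T'_def using sf inv by (intro Cons.IH) auto
  have k: "kron X Y \<in> carrier_mat (d * ?N) (d * ?N)" if "X \<in> carrier_mat d d" "Y \<in> carrier_mat ?N ?N" for X Y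
    using that by (rule kron_carrier)
  have "kron (G 0) T * (kron (A 0) (1\<^sub>m ?N) + kron (1\<^sub>m d) L) * kron (H 0) T'
      = (kron (G 0 * A 0) T + kron (G 0) (T * L)) * kron (H 0) T'"
    using c LT by (simp add: mult_add_distrib_mat[of _ "d * ?N" "d * ?N" _ "d * ?N"] k kron_mult[of _ d _ ?N])
  also have "\<dots> = kron (G 0 * A 0 * H 0) (T * T') + kron (G 0 * H 0) (T * L * T')"
    using c LT by (simp add: add_mult_distrib_mat[of _ "d * ?N" "d * ?N" _ _ "d * ?N"] k kron_mult[of _ d _ ?N])
  finally show ?case unfolding TT IH inv0 by (simp add: tens_Cons L_def T_def T'_def)
qed (auto simp: tens_Nil intro!: eq_matI)

lemma adjoint_index:
  assumes "A \<in> carrier_mat d d" "i < d" "j < d"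
  shows "mat_adjoint A $$ (i, j) = cnj (A $$ (j, i))"
  using assms by (auto simp: mat_adjoint_def mat_of_rows_def)

lemma adjoint_dims [simp]: "dim_row (mat_adjoint A) = dim_col A" "dim_col (mat_adjoint A) = dim_row A"
  by (simp_all add: mat_adjoint_def)

lemma adjoint_carrier [simp]: "A \<in> carrier_mat d d \<Longrightarrow> mat_adjoint A \<in> carrier_mat d d"
  by (auto simp: mat_adjoint_def)

lemma adjoint_mult:
  fixes A B :: "complex mat"
  assumes "A \<in> carrier_mat d d" "B \<in> carrier_mat d d"
  shows "mat_adjoint (A * B) = mat_adjoint B * mat_adjoint A"
proof (rule eq_matI)
  fix i j assume "i < dim_row (mat_adjoint B * mat_adjoint A)" "j < dim_col (mat_adjoint B * mat_adjoint A)"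
  then have ij: "i < d" "j < d" using assms adjoint_carrier[of A d] adjoint_carrier[of B d] by auto
  have "mat_adjoint (A * B) $$ (i, j) = cnj (\<Sum>k<d. A $$ (j, k) * B $$ (k, i))"
    using assms ij by (simp add: adjoint_index[of _ d] mult_index[OF assms] del: index_mult_mat(1))
  also have "\<dots> = (mat_adjoint B * mat_adjoint A) $$ (i, j)"
    unfolding mult_index[OF adjoint_carrier[OF assms(2)] adjoint_carrier[OF assms(1)] ij]
    using assms ij by (simp add: adjoint_index[of _ d] mult.commute)
  finally show "mat_adjoint (A * B) $$ (i, j) = (mat_adjoint B * mat_adjoint A) $$ (i, j)" .
qed (use assms adjoint_carrier[of A d] adjoint_carrier[of B d] adjoint_carrier[of "A * B" d] in auto)

lemma adjoint_adjoint:
  fixes A :: "complex mat"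
  assumes "A \<in> carrier_mat d d" shows "mat_adjoint (mat_adjoint A) = A"
  using assms by (intro eq_matI)
    (auto simp: adjoint_index[OF adjoint_carrier[OF assms]] adjoint_index[OF assms])

lemma tens_adjoint:
  "square_family ds A \<Longrightarrow> mat_adjoint (tens ds A) = tens ds (\<lambda>s. mat_adjoint (A s))"
proof (induction ds arbitrary: A)
  case (Cons d ds)
  let ?N = "prod_list ds" and ?B = "tens ds (\<lambda>s. A (Suc s))"
  have A: "A 0 \<in> carrier_mat d d" and B: "?B \<in> carrier_mat ?N ?N"
    and IH: "mat_adjoint ?B = tens ds (\<lambda>s. mat_adjoint (A (Suc s)))"
    using Cons by (auto simp: square_family_Cons)
  note k = kron_carrier[OF A B] kron_carrier[OF adjoint_carrier[OF A] adjoint_carrier[OF B]]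
  have "mat_adjoint (kron (A 0) ?B) = kron (mat_adjoint (A 0)) (mat_adjoint ?B)"
  proof (rule eq_matI)
    fix I J assume "I < dim_row (kron (mat_adjoint (A 0)) (mat_adjoint ?B))"
      "J < dim_col (kron (mat_adjoint (A 0)) (mat_adjoint ?B))"
    then have IJ: "I < d * ?N" "J < d * ?N" using k by auto
    show "mat_adjoint (kron (A 0) ?B) $$ (I, J) = kron (mat_adjoint (A 0)) (mat_adjoint ?B) $$ (I, J)"
      using IJ kron_indices[OF IJ(1)] kron_indices[OF IJ(2)]
      by (simp add: adjoint_index[OF k(1)] kron_index[OF A B] kron_index[OF adjoint_carrier[OF A] adjoint_carrier[OF B]]
          adjoint_index[OF A] adjoint_index[OF B])
  qed (use k adjoint_carrier[OF k(1)] in auto)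
  then show ?case by (simp add: tens_Cons IH)
qed (auto simp: tens_Nil adjoint_index[OF one_carrier_mat] intro!: eq_matI)

text \<open>
  The residue of a matrix is taken entry by entry; as a relation it also says that there is one.
\<close>

definition mat_rel :: "(complex \<times> complex) set \<Rightarrow> nat \<Rightarrow> complex mat \<Rightarrow> complex mat \<Rightarrow> bool" where
  "mat_rel Q d A A' \<longleftrightarrow> A \<in> carrier_mat d d \<and> A' \<in> carrier_mat d d \<and>
     (\<forall>i < d. \<forall>j < d. (A $$ (i, j), A' $$ (i, j)) \<in> Q)"

context
  fixes Q assumes hom: "partial_hom Q"
begin

lemma mat_rel_mult: "mat_rel Q d A A' \<Longrightarrow> mat_rel Q d B B' \<Longrightarrow> mat_rel Q d (A * B) (A' * B')"
  by (auto simp: mat_rel_def mult_index[of _ d d _ d] simp del: index_mult_mat(1)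
      intro!: ph_sum[OF hom] ph_mult[OF hom])

lemma mat_rel_one: "mat_rel Q d (1\<^sub>m d) (1\<^sub>m d)"
  by (auto simp: mat_rel_def ph_zero[OF hom] ph_one[OF hom])

lemma mat_rel_unique: "mat_rel Q d A B \<Longrightarrow> mat_rel Q d A C \<Longrightarrow> B = C"
proof (rule eq_matI)
  fix i j assume "mat_rel Q d A B" "mat_rel Q d A C" "i < dim_row C" "j < dim_col C"
  then show "B $$ (i, j) = C $$ (i, j)"
    by (intro ph_unique[OF hom, of "A $$ (i, j)"]) (auto simp: mat_rel_def)
qed (auto simp: mat_rel_def)

lemma mat_rel_tens:
  "(\<And>s. s < length ds \<Longrightarrow> mat_rel Q (ds ! s) (A s) (A' s)) \<Longrightarrow> mat_rel Q (prod_list ds) (tens ds A) (tens ds A')"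
proof (induction ds arbitrary: A A')
  case (Cons d ds)
  let ?N = "prod_list ds"
  have 0: "mat_rel Q d (A 0) (A' 0)" using Cons.prems[of 0] by simp
  have 1: "mat_rel Q ?N (tens ds (\<lambda>s. A (Suc s))) (tens ds (\<lambda>s. A' (Suc s)))"
    using Cons.prems[of "Suc s" for s] by (intro Cons.IH) auto
  show ?case unfolding mat_rel_def
  proof (intro conjI allI impI)
    fix I J assume "I < prod_list (d # ds)" "J < prod_list (d # ds)"
    then have IJ: "I < d * ?N" "J < d * ?N" by auto
    show "(tens (d # ds) A $$ (I, J), tens (d # ds) A' $$ (I, J)) \<in> Q"
      using 0 1 kron_indices[OF IJ(1)] kron_indices[OF IJ(2)] IJ
      by (auto simp: mat_rel_def tens_Cons kron_index[of _ d _ ?N] intro!: ph_mult[OF hom])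
  qed (use 0 1 in \<open>auto simp: mat_rel_def tens_Cons intro!: kron_carrier\<close>)
qed (auto simp: tens_Nil mat_rel_def ph_one[OF hom])

end

lemma (in place) unimodular_residue:
  assumes "unimodular d a a'"
  obtains b b' where "mat_rel Q d a b" "mat_rel Q d a' b'" "b * b' = 1\<^sub>m d" "b' * b = 1\<^sub>m d"
    "b \<in> carrier_mat d d" "b' \<in> carrier_mat d d"
proof -
  have ex: "\<exists>b. mat_rel Q d a b" if "a \<in> carrier_mat d d" "integral_mat a" for a
  proof -
    have "\<forall>p. \<exists>y. fst p < d \<longrightarrow> snd p < d \<longrightarrow> (a $$ p, y) \<in> Q"
      using that by (fastforce simp: integral_mat_def)
    from choice[OF this] obtain f where "\<And>p. fst p < d \<longrightarrow> snd p < d \<longrightarrow> (a $$ p, f p) \<in> Q" by blast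
    then have "mat_rel Q d a (mat d d f)" using that by (auto simp: mat_rel_def)
    then show ?thesis ..
  qed
  obtain b b' where b: "mat_rel Q d a b" "mat_rel Q d a' b'"
    using ex[of a] ex[of a'] assms unfolding unimodular_def by blast
  have "b * b' = 1\<^sub>m d" "b' * b = 1\<^sub>m d"
    using mat_rel_unique[OF hom mat_rel_one[OF hom]] mat_rel_mult[OF hom b] mat_rel_mult[OF hom b(2,1)] assms
    unfolding unimodular_def by metis+
  then show thesis using that b by (auto simp: mat_rel_def)
qed

section \<open>Triangular, unitary and unipotent matrices\<close>

lemma inverse_lower_triangular:
  fixes p q :: "complex mat"
  assumes p: "p \<in> carrier_mat d d" and q: "q \<in> carrier_mat d d" and pq: "p * q = 1\<^sub>m d"
    and low: "\<And>i j. i < j \<Longrightarrow> j < d \<Longrightarrow> p $$ (i, j) = 0"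
  shows "i < j \<Longrightarrow> j < d \<Longrightarrow> q $$ (i, j) = 0"
proof (induction i arbitrary: j rule: less_induct)
  case (less i)
  have eq: "(\<Sum>l<d. p $$ (i, l) * q $$ (l, c)) = (if i = c then 1 else 0)" if "c < d" for c
    using mult_index[OF p q, of i c] less.prems that unfolding pq by simp
  have sum: "(\<Sum>l<d. p $$ (i, l) * q $$ (l, c)) = p $$ (i, i) * q $$ (i, c)" if c: "i \<le> c" "c < d" for c
  proof -
    have "(\<Sum>l<d. p $$ (i, l) * q $$ (l, c)) = (\<Sum>l\<in>{i}. p $$ (i, l) * q $$ (l, c))"
    proof (rule sum.mono_neutral_right)
      show "\<forall>l\<in>{..<d} - {i}. p $$ (i, l) * q $$ (l, c) = 0"
      proof
        fix l assume l: "l \<in> {..<d} - {i}"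
        show "p $$ (i, l) * q $$ (l, c) = 0"
        proof (cases "l < i")
          case True
          then show ?thesis using less.IH[of l c] c by simp
        next
          case False
          then show ?thesis using low[of i l] l by simp
        qed
      qed
    qed (use less.prems in auto)
    then show ?thesis by simp
  qed
  have "p $$ (i, i) * q $$ (i, i) = 1" using eq[of i] sum[of i] less.prems by simp
  moreover have "p $$ (i, i) * q $$ (i, j) = 0" using eq[of j] sum[of j] less.prems by simp
  ultimately show ?case by auto
qed

lemma inverse_upper_triangular:
  fixes p q :: "complex mat"
  assumes p: "p \<in> carrier_mat d d" and q: "q \<in> carrier_mat d d" and qp: "q * p = 1\<^sub>m d"
    and up: "\<And>i j. j < i \<Longrightarrow> i < d \<Longrightarrow> p $$ (i, j) = 0"
    and ij: "j < i" "i < d"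
  shows "q $$ (i, j) = 0"
proof -
  have "p\<^sup>T * q\<^sup>T = 1\<^sub>m d" using transpose_mult[OF q p] qp by simp
  then have "q\<^sup>T $$ (j, i) = 0"
    using p q up ij by (intro inverse_lower_triangular[of "p\<^sup>T" d "q\<^sup>T"]) auto
  then show ?thesis using q ij by simp
qed

text \<open>
  A vector \<open>q l\<close> of norm zero does no harm: the coefficient, a division by zero, is \<open>0\<close>, and \<open>q l\<close> is
  orthogonal to everything.
\<close>

lemma gram_schmidt_rows:
  fixes b :: "nat \<Rightarrow> nat \<Rightarrow> complex"
  shows "\<exists>q E. (\<forall>i<n. \<forall>c<d. b i c = (\<Sum>l\<le>i. E i l * q l c)) \<and>
    (\<forall>i<n. \<forall>j<n. i \<noteq> j \<longrightarrow> (\<Sum>c<d. q i c * cnj (q j c)) = (0 :: complex))"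
proof (induction n)
  case (Suc n)
  then obtain q E where b: "\<And>i c. i < n \<Longrightarrow> c < d \<Longrightarrow> b i c = (\<Sum>l\<le>i. E i l * q l c)"
    and orth: "\<And>i j. i < n \<Longrightarrow> j < n \<Longrightarrow> i \<noteq> j \<Longrightarrow> (\<Sum>c<d. q i c * cnj (q j c)) = 0" by blast
  define ip where "ip x y = (\<Sum>c<d. x c * cnj (y c))" for x y :: "nat \<Rightarrow> complex"
  define \<alpha> where "\<alpha> l = ip (b n) (q l) / ip (q l) (q l)" for l
  define v where "v c = b n c - (\<Sum>l<n. \<alpha> l * q l c)" for c
  have ip0: "ip (b n) (q l) = 0" if "ip (q l) (q l) = 0" for l
  proof -
    have "(\<Sum>c<d. (cmod (q l c))\<^sup>2) = 0"
      using that unfolding ip_def by (simp add: complex_norm_square[symmetric] flip: of_real_sum of_real_power)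
    then have "\<forall>c<d. q l c = 0" by (simp add: sum_nonneg_eq_0_iff)
    then show ?thesis by (simp add: ip_def)
  qed
  have v: "ip v (q j) = 0" if j: "j < n" for j
  proof -
    have "ip v (q j) = ip (b n) (q j) - (\<Sum>c<d. \<Sum>l<n. \<alpha> l * (q l c * cnj (q j c)))"
      by (simp add: ip_def v_def algebra_simps sum_subtractf sum_distrib_left sum_distrib_right)
    also have "(\<Sum>c<d. \<Sum>l<n. \<alpha> l * (q l c * cnj (q j c))) = (\<Sum>l<n. \<alpha> l * ip (q l) (q j))"
      by (subst sum.swap) (simp add: ip_def sum_distrib_left)
    also have "\<dots> = (\<Sum>l\<in>{j}. \<alpha> l * ip (q l) (q j))"
      using j orth by (intro sum.mono_neutral_right) (auto simp: ip_def)
    also have "\<dots> = ip (b n) (q j)" using ip0[of j] by (simp add: \<alpha>_def)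
    finally show ?thesis by simp
  qed
  have vs: "ip (q j) v = 0" if "j < n" for j
  proof -
    have "ip (q j) v = cnj (ip v (q j))" by (simp add: ip_def mult.commute)
    then show ?thesis using v[OF that] by simp
  qed
  define q' where "q' = q(n := v)"
  define E' where "E' = E(n := \<alpha>(n := 1))"
  have "b i c = (\<Sum>l\<le>i. E' i l * q' l c)" if "i < Suc n" "c < d" for i c
  proof (cases "i = n")
    case True
    have "(\<Sum>l\<le>n. E' n l * q' l c) = v c + (\<Sum>l<n. \<alpha> l * q l c)"
      by (simp add: lessThan_Suc_atMost[symmetric] E'_def q'_def)
    then show ?thesis using True by (simp add: v_def)
  next
    case False
    then show ?thesis using b[of i c] that by (auto simp: E'_def q'_def intro!: sum.cong)
  qed
  moreover have "(\<Sum>c<d. q' i c * cnj (q' j c)) = 0" if "i < Suc n" "j < Suc n" "i \<noteq> j" for i j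
    using that orth[of i j] v[of j] vs[of i] by (auto simp: q'_def ip_def less_Suc_eq)
  ultimately show ?case by blast
qed auto

text \<open>
  The Gram--Schmidt process applied to the rows of \<open>b\<close>.
\<close>

theorem lower_triangular_unitary:
  assumes b: "b \<in> carrier_mat d d" "b' \<in> carrier_mat d d" "b * b' = (1\<^sub>m d :: complex mat)"
  obtains p k where "p \<in> carrier_mat d d" "k \<in> carrier_mat d d" "b = p * k"
    "\<And>i j. i < j \<Longrightarrow> j < d \<Longrightarrow> p $$ (i, j) = 0"
    "k * mat_adjoint k = 1\<^sub>m d" "mat_adjoint k * k = 1\<^sub>m d"
proof -
  obtain q E where bq: "\<And>i c. i < d \<Longrightarrow> c < d \<Longrightarrow> b $$ (i, c) = (\<Sum>l\<le>i. E i l * q l c)"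
    and orth: "\<And>i j. i < d \<Longrightarrow> j < d \<Longrightarrow> i \<noteq> j \<Longrightarrow> (\<Sum>c<d. q i c * cnj (q j c)) = (0::complex)"
    using gram_schmidt_rows[of d d "\<lambda>i c. b $$ (i, c)"] by blast
  define Em where "Em = mat d d (\<lambda>(i, l). if l \<le> i then E i l else 0)"
  define qm where "qm = mat d d (\<lambda>(i, c). q i c)"
  have c: "Em \<in> carrier_mat d d" "qm \<in> carrier_mat d d" by (auto simp: Em_def qm_def)
  have beq: "b = Em * qm"
  proof (rule eq_matI)
    fix i j assume "i < dim_row (Em * qm)" "j < dim_col (Em * qm)"
    then have ij: "i < d" "j < d" using c by auto
    have "(\<Sum>l\<le>i. E i l * q l j) = (\<Sum>l<d. Em $$ (i, l) * qm $$ (l, j))"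
      using ij by (intro sum.mono_neutral_cong_left) (auto simp: Em_def qm_def)
    then show "b $$ (i, j) = (Em * qm) $$ (i, j)"
      using bq[OF ij] by (simp add: mult_index[OF c ij] del: index_mult_mat(1))
  qed (use b c in auto)
  \<comment> \<open>Dividing the orthogonal rows by their norms makes the second factor unitary.\<close>
  define \<nu> where "\<nu> i = sqrt (\<Sum>c<d. (cmod (q i c))\<^sup>2)" for i
  have \<nu>: "complex_of_real (\<nu> i) * of_real (\<nu> i) = (\<Sum>c<d. q i c * cnj (q i c))" for i
    unfolding \<nu>_def
    by (simp add: complex_norm_square[symmetric] sum_nonneg flip: of_real_mult of_real_sum of_real_power)
  have \<nu>0: "\<nu> i \<noteq> 0" if i: "i < d" for i
  proof
    assume "\<nu> i = 0"
    then have z: "\<forall>c<d. q i c = 0" unfolding \<nu>_def by (simp add: sum_nonneg_eq_0_iff)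
    have "Em * (qm * b') = 1\<^sub>m d" using b c unfolding beq by (simp add: square_mult_assoc[of _ d])
    then have "(qm * b') * Em = 1\<^sub>m d" using b c by (intro mat_mult_left_right_inverse[of Em d]) auto
    then have "qm * (b' * Em) = 1\<^sub>m d" using b c by (simp add: square_mult_assoc[of _ d])
    then have "(\<Sum>l<d. qm $$ (i, l) * (b' * Em) $$ (l, i)) = 1"
      using mult_index[OF c(2) square_mult_carrier[OF b(2) c(1)] i i] i by simp
    moreover have "(\<Sum>l<d. qm $$ (i, l) * (b' * Em) $$ (l, i)) = 0"
      using z i by (intro sum.neutral) (auto simp: qm_def)
    ultimately show False by simp
  qed
  define k where "k = diagm d (\<lambda>i. inverse (of_real (\<nu> i))) * qm"
  define p where "p = Em * diagm d (\<lambda>i. of_real (\<nu> i))"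
  have kc: "k \<in> carrier_mat d d" "p \<in> carrier_mat d d" using c by (auto simp: k_def p_def)
  have "p * k = Em * (diagm d (\<lambda>i. of_real (\<nu> i)) * diagm d (\<lambda>i. inverse (of_real (\<nu> i)))) * qm"
    unfolding p_def k_def using c by (simp add: square_mult_assoc[of _ d])
  also have "diagm d (\<lambda>i. of_real (\<nu> i)) * diagm d (\<lambda>i. inverse (of_real (\<nu> i))) = 1\<^sub>m d"
    unfolding diagm_mult using \<nu>0 by (intro diagm_one) simp
  finally have "b = p * k" using beq c by simp
  moreover have "p $$ (i, j) = 0" if "i < j" "j < d" for i j
  proof -
    have "i < d" using that by simp
    from mult_diagm_index[OF c(1) this that(2)] show ?thesis
      unfolding p_def using that by (simp add: Em_def)
  qed
  moreover have kk: "k * mat_adjoint k = 1\<^sub>m d"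
  proof (rule eq_matI)
    fix i j assume "i < dim_row (1\<^sub>m d :: complex mat)" "j < dim_col (1\<^sub>m d :: complex mat)"
    then have ij: "i < d" "j < d" by auto
    have kq: "k $$ (i, c) = inverse (of_real (\<nu> i)) * q i c" if "i < d" "c < d" for i c
      unfolding k_def diagm_mult_index[OF c(2) that] using that by (simp add: qm_def)
    have "(k * mat_adjoint k) $$ (i, j) = (\<Sum>c<d. k $$ (i, c) * cnj (k $$ (j, c)))"
      using ij kc by (simp add: mult_index[OF kc(1) adjoint_carrier[OF kc(1)] ij] adjoint_index[OF kc(1)]
          del: index_mult_mat(1))
    also have "\<dots> = inverse (of_real (\<nu> i)) * inverse (of_real (\<nu> j)) * (\<Sum>c<d. q i c * cnj (q j c))"
      using ij by (simp add: kq sum_distrib_left mult_ac)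
    also have "\<dots> = (if i = j then 1 else 0)"
    proof (cases "i = j")
      case True
      have "inverse (complex_of_real (\<nu> i)) * complex_of_real (\<nu> i) = 1" using \<nu>0[OF ij(1)] by simp
      then have "inverse (complex_of_real (\<nu> i)) * inverse (of_real (\<nu> i)) * (of_real (\<nu> i) * of_real (\<nu> i)) = 1"
        by (metis mult.commute mult.left_commute mult_1)
      then show ?thesis using True \<nu>[of i] by simp
    qed (use orth[OF ij] in simp)
    finally show "(k * mat_adjoint k) $$ (i, j) = 1\<^sub>m d $$ (i, j)" using ij by simp
  qed (use kc in auto)
  ultimately show thesis
    using that[of p k] kc mat_mult_left_right_inverse[OF kc(1) adjoint_carrier[OF kc(1)] kk] by blast
qed

lemma unitary_conj_normal:
  fixes U M :: "complex mat"
  assumes U: "U \<in> carrier_mat d d" "mat_adjoint U * U = 1\<^sub>m d" and M: "M \<in> carrier_mat d d"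
    and normal: "M * mat_adjoint M = mat_adjoint M * M"
  defines "H \<equiv> U * M * mat_adjoint U"
  shows "H * mat_adjoint H = mat_adjoint H * H"
proof -
  let ?U = "mat_adjoint U" and ?M = "mat_adjoint M"
  have c: "?U \<in> carrier_mat d d" "?M \<in> carrier_mat d d" using U M by auto
  have one: "X * (?U * (U * Y)) = X * Y" if "X \<in> carrier_mat d d" "Y \<in> carrier_mat d d" for X Y
    using that U c by (simp add: square_mult_assoc[of _ d, symmetric])
  have adj: "mat_adjoint H = U * (?M * ?U)"
    unfolding H_def using U M c by (simp add: adjoint_mult[of _ d] adjoint_adjoint[OF U(1)])
  have "H * mat_adjoint H = U * (M * ?M) * ?U"
    unfolding adj unfolding H_def using U(1) M c by (simp add: square_mult_assoc[of _ d] one)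
  also have "\<dots> = mat_adjoint H * H"
    unfolding normal adj unfolding H_def using U(1) M c by (simp add: square_mult_assoc[of _ d] one)
  finally show ?thesis .
qed

context cone
begin

text \<open>
  In a normal matrix each row has the same norm as the column with the same index.  Let \<open>S\<close> be the set
  of indices that are at most \<open>j\<close> in the order of the weights.  The rows in \<open>S\<close> have their support in
  \<open>S\<close>.  Summing the norms of the rows in \<open>S\<close> and of the columns in \<open>S\<close>, the square \<open>S \<times> S\<close> counts
  on both sides, so nothing is left for the entries in columns from \<open>S\<close> and rows outside.
\<close>

lemma normal_block_triangular:
  assumes H: "H \<in> carrier_mat d d" and normal: "H * mat_adjoint H = mat_adjoint H * H"
    and supp: "supp d l C H" and ij: "i < d" "j < d" "H $$ (i, j) \<noteq> 0"
  shows "l i = l j"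
proof -
  define S where "S = {k. k < d \<and> l j - l k \<in> C}"
  have S: "finite S" "S \<subseteq> {..<d}" "j \<in> S" using ij zero by (auto simp: S_def)
  have closed: "H $$ (k, k') = 0" if "k \<in> S" "k' \<in> {..<d} - S" for k k'
  proof (rule ccontr)
    assume "H $$ (k, k') \<noteq> 0"
    then have "l k - l k' \<in> C" using suppD[OF supp] that S by auto
    then have "l j - l k' \<in> C" using add[of "l j - l k" "l k - l k'"] that by (simp add: S_def)
    then show False using that by (simp add: S_def)
  qed
  have norms: "(\<Sum>k'<d. (cmod (H $$ (k, k')))\<^sup>2) = (\<Sum>k'<d. (cmod (H $$ (k', k)))\<^sup>2)" if k: "k < d" for k
  proof -
    have "(H * mat_adjoint H) $$ (k, k) = of_real (\<Sum>k'<d. (cmod (H $$ (k, k')))\<^sup>2)"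
      unfolding mult_index[OF H adjoint_carrier[OF H] k k]
      using k by (simp add: adjoint_index[OF H] complex_norm_square[unfolded of_real_power])
    moreover have "(mat_adjoint H * H) $$ (k, k) = of_real (\<Sum>k'<d. (cmod (H $$ (k', k)))\<^sup>2)"
      unfolding mult_index[OF adjoint_carrier[OF H] H k k]
      using k by (simp add: adjoint_index[OF H] complex_norm_square[unfolded of_real_power] mult.commute)
    ultimately show ?thesis using normal by (metis of_real_eq_iff)
  qed
  let ?f = "\<lambda>k k'. (cmod (H $$ (k, k')))\<^sup>2"
  have split: "{..<d} = S \<union> ({..<d} - S)" using S by auto
  have "(\<Sum>k\<in>S. \<Sum>k'<d. ?f k k') = (\<Sum>k\<in>S. \<Sum>k'\<in>S. ?f k k')"
    using S closed by (intro sum.cong refl sum.mono_neutral_right) auto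
  also have "\<dots> = (\<Sum>k\<in>S. \<Sum>k'\<in>S. ?f k' k)" by (rule sum.swap)
  finally have eq: "(\<Sum>k\<in>S. \<Sum>k'<d. ?f k k') = (\<Sum>k\<in>S. \<Sum>k'\<in>S. ?f k' k)" .
  have "(\<Sum>k\<in>S. \<Sum>k'<d. ?f k k') = (\<Sum>k\<in>S. \<Sum>k'<d. ?f k' k)"
    using S by (intro sum.cong[OF refl] norms) auto
  also have "\<dots> = (\<Sum>k\<in>S. (\<Sum>k'\<in>S. ?f k' k) + (\<Sum>k'\<in>{..<d} - S. ?f k' k))"
    using S by (intro sum.cong refl) (subst split, rule sum.union_disjoint, auto)
  finally have "(\<Sum>k\<in>S. \<Sum>k'\<in>{..<d} - S. ?f k' k) = 0" using eq by (simp add: sum.distrib)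
  then have "\<forall>k\<in>S. \<forall>k'\<in>{..<d} - S. ?f k' k = 0"
    using S by (simp add: sum_nonneg_eq_0_iff sum_nonneg)
  then have "i \<in> S" using S ij by auto
  then have "l j - l i \<in> C" by (simp add: S_def)
  moreover have "l i - l j \<in> C" using suppD[OF supp] ij by blast
  ultimately show ?thesis using pointed[of "l i - l j"] by simp
qed

text \<open>
  The coordinates of the eigenrow are found from left to right.  A coordinate of the same weight as \<open>i\<close>
  cannot be solved for, but there the equation holds by itself, because a sum of a nonnegative and
  a positive weight is not zero.
\<close>

lemma triangular_eigenrow:
  assumes diag: "\<And>j. j < d \<Longrightarrow> X $$ (j, j) = l j"
    and off: "\<And>k j. k < d \<Longrightarrow> j < d \<Longrightarrow> k \<noteq> j \<Longrightarrow> X $$ (k, j) \<noteq> 0 \<Longrightarrow> k < j \<and> l k \<noteq> l j \<and> l k - l j \<in> C"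
    and i: "i < d"
  shows "\<exists>f. \<forall>j<d. (l i = l j \<longrightarrow> f j = (if i = j then 1 else 0)) \<and> (f j \<noteq> 0 \<longrightarrow> l i - l j \<in> C) \<and>
    (\<Sum>k<d. f k * X $$ (k, j)) = l i * f j"
proof -
  have "\<exists>f. \<forall>j<n. (l i = l j \<longrightarrow> f j = (if i = j then 1 else 0)) \<and> (f j \<noteq> 0 \<longrightarrow> l i - l j \<in> C) \<and>
    (\<Sum>k<j. f k * X $$ (k, j)) = (l i - l j) * f j" if "n \<le> d" for n
    using that
  proof (induction n)
    case (Suc n)
    then obtain f where f: "\<And>j. j < n \<Longrightarrow> l i = l j \<Longrightarrow> f j = (if i = j then 1 else 0)"
      "\<And>j. j < n \<Longrightarrow> f j \<noteq> 0 \<Longrightarrow> l i - l j \<in> C"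
      "\<And>j. j < n \<Longrightarrow> (\<Sum>k<j. f k * X $$ (k, j)) = (l i - l j) * f j" by (auto simp: Suc_le_eq)
    define r where "r = (\<Sum>k<n. f k * X $$ (k, n))"
    have r: "l i - l n \<in> C \<and> l i \<noteq> l n" if r0: "r \<noteq> 0"
    proof -
      obtain k where k: "k < n" "f k * X $$ (k, n) \<noteq> 0"
        using r0 unfolding r_def by (elim sum.not_neutral_contains_not_neutral) (simp only: lessThan_iff)
      have 1: "l i - l k \<in> C" using f(2)[of k] k by simp
      have 2: "l k - l n \<in> C" "l k \<noteq> l n" using off[of k n] k Suc.prems by auto
      show ?thesis using add[OF 1 2(1)] sum_zeroD[OF 1 2(1)] 2(2) by auto
    qed
    define v where "v = (if l i = l n then (if i = n then 1 else 0) else r / (l i - l n))"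
    have "r = (l i - l n) * v" "v \<noteq> 0 \<longrightarrow> l i - l n \<in> C" "l i = l n \<longrightarrow> v = (if i = n then 1 else 0)"
      using r zero by (auto simp: v_def)
    then have "\<forall>j<Suc n. (l i = l j \<longrightarrow> (f(n := v)) j = (if i = j then 1 else 0)) \<and>
        ((f(n := v)) j \<noteq> 0 \<longrightarrow> l i - l j \<in> C) \<and>
        (\<Sum>k<j. (f(n := v)) k * X $$ (k, j)) = (l i - l j) * (f(n := v)) j"
      using f unfolding r_def by (auto simp: less_Suc_eq)
    then show ?case by blast
  qed auto
  then obtain f where f: "\<And>j. j < d \<Longrightarrow> l i = l j \<longrightarrow> f j = (if i = j then 1 else 0)"
    "\<And>j. j < d \<Longrightarrow> f j \<noteq> 0 \<longrightarrow> l i - l j \<in> C"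
    "\<And>j. j < d \<Longrightarrow> (\<Sum>k<j. f k * X $$ (k, j)) = (l i - l j) * f j" by blast
  have "(\<Sum>k<d. f k * X $$ (k, j)) = l i * f j" if j: "j < d" for j
  proof -
    have "(\<Sum>k<d. f k * X $$ (k, j)) = (\<Sum>k\<in>insert j {..<j}. f k * X $$ (k, j))"
    proof (rule sum.mono_neutral_right)
      show "\<forall>k\<in>{..<d} - insert j {..<j}. f k * X $$ (k, j) = 0"
        using off[of _ j] j by fastforce
    qed (use j in auto)
    also have "\<dots> = l i * f j" using f(3)[OF j] diag[OF j] by (simp add: algebra_simps)
    finally show ?thesis .
  qed
  then show ?thesis using f by blast
qed

text \<open>
  The eigenrows form \<open>u\<close>.  Indices are assumed to be sorted by weight, which makes \<open>u\<close> and \<open>X\<close> upper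
  triangular.
\<close>

theorem unipotent_diagonalisation:
  assumes X: "X \<in> carrier_mat d d"
    and diag: "\<And>j. j < d \<Longrightarrow> X $$ (j, j) = l j"
    and off: "\<And>k j. k < d \<Longrightarrow> j < d \<Longrightarrow> k \<noteq> j \<Longrightarrow> X $$ (k, j) \<noteq> 0 \<Longrightarrow> l k \<noteq> l j \<and> l k - l j \<in> C"
    and sorted: "\<And>i j. i \<le> j \<Longrightarrow> j < d \<Longrightarrow> l i - l j \<in> C"
  obtains u u' where "u \<in> carrier_mat d d" "u' \<in> carrier_mat d d" "u * u' = 1\<^sub>m d" "u' * u = 1\<^sub>m d"
    "supp d l C u" "supp d l C u'" "part0 d l u = 1\<^sub>m d" "part0 d l u' = 1\<^sub>m d"
    "u * X * u' = diagm d l"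
proof -
  have lt: "k < j" if "k < d" "j < d" "k \<noteq> j" "X $$ (k, j) \<noteq> 0" for k j
  proof (rule ccontr)
    assume "\<not> k < j"
    then have "l j - l k \<in> C" using sorted[of j k] that by simp
    then show False using off[OF that] pointed[of "l k - l j"] by simp
  qed
  have ex: "\<forall>i. \<exists>f. i < d \<longrightarrow> (\<forall>j<d. (l i = l j \<longrightarrow> f j = (if i = j then 1 else 0)) \<and>
      (f j \<noteq> 0 \<longrightarrow> l i - l j \<in> C) \<and> (\<Sum>k<d. f k * X $$ (k, j)) = l i * f j)"
  proof
    fix i
    show "\<exists>f. i < d \<longrightarrow> (\<forall>j<d. (l i = l j \<longrightarrow> f j = (if i = j then 1 else 0)) \<and>
      (f j \<noteq> 0 \<longrightarrow> l i - l j \<in> C) \<and> (\<Sum>k<d. f k * X $$ (k, j)) = l i * f j)"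
    proof (cases "i < d")
      case True
      from triangular_eigenrow[OF diag _ True] lt off show ?thesis by blast
    qed auto
  qed
  from choice[OF ex] obtain f where f:
    "\<And>i j. i < d \<Longrightarrow> j < d \<Longrightarrow> l i = l j \<Longrightarrow> f i j = (if i = j then 1 else 0)"
    "\<And>i j. i < d \<Longrightarrow> j < d \<Longrightarrow> f i j \<noteq> 0 \<Longrightarrow> l i - l j \<in> C"
    "\<And>i j. i < d \<Longrightarrow> j < d \<Longrightarrow> (\<Sum>k<d. f i k * X $$ (k, j)) = l i * f i j" by blast
  define u where "u = mat d d (\<lambda>(i, j). f i j)"
  have u: "u \<in> carrier_mat d d" by (simp add: u_def)
  have uX: "u * X = diagm d l * u"
  proof (rule eq_matI)
    fix i j assume "i < dim_row (diagm d l * u)" "j < dim_col (diagm d l * u)"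
    then have ij: "i < d" "j < d" by (auto simp: u_def)
    show "(u * X) $$ (i, j) = (diagm d l * u) $$ (i, j)"
      unfolding mult_index[OF u X ij] diagm_mult_index[OF u ij] using ij f(3)[OF ij] by (simp add: u_def)
  qed (use u X in auto)
  have up: "u $$ (i, j) = 0" if ij: "j < i" "i < d" for i j
  proof (rule ccontr)
    assume "u $$ (i, j) \<noteq> 0"
    then have nz: "f i j \<noteq> 0" using ij by (simp add: u_def)
    then have "l i - l j \<in> C" "l j - l i \<in> C" using f(2)[of i j] sorted[of j i] ij by auto
    then have "l i = l j" using pointed[of "l i - l j"] by simp
    then show False using f(1)[of i j] ij nz by auto
  qed
  have u1: "u $$ (i, i) = 1" if "i < d" for i using f(1)[of i i] that by (simp add: u_def)
  have "det u = prod_list (diag_mat u)"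
    using up u by (intro det_upper_triangular[of u d]) (auto simp: upper_triangular_def)
  also have "\<dots> = 1" using u u1 by (auto simp: diag_mat_def intro!: prod_list_neutral)
  finally have "det u \<noteq> 0" by simp
  from det_non_zero_imp_unit[OF u this, of "()"] obtain u' where u': "u' \<in> carrier_mat d d"
    "u' * u = 1\<^sub>m d" "u * u' = 1\<^sub>m d"
    unfolding Units_def ring_mat_def by auto
  have su: "supp d l C u" unfolding supp_def using f(2) by (auto simp: u_def)
  have su': "supp d l C u'" unfolding supp_def
  proof (intro allI impI)
    fix i j assume ij: "i < d" "j < d" "u' $$ (i, j) \<noteq> 0"
    then have "i \<le> j" using inverse_upper_triangular[OF u u'(1,2) up, of j i] by fastforce
    then show "l i - l j \<in> C" using sorted ij by blast
  qed
  have p: "part0 d l u = 1\<^sub>m d" using f(1) by (intro eq_matI) (auto simp: part0_def u_def)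
  have "part0 d l (u * u') = part0 d l u * part0 d l u'" by (rule part0_mult[OF u u'(1) su su'])
  then have p': "part0 d l u' = 1\<^sub>m d" using p u' left_mult_one_mat[OF part0_carrier, of d l u']
    by (simp add: part0_one)
  have "u * X * u' = diagm d l * (u * u')"
    unfolding uX using u u' by (simp add: square_mult_assoc[of _ d])
  then have "u * X * u' = diagm d l" using u' by simp
  then show thesis using that u u' su su' p p' by blast
qed

end

section \<open>Ranks of families of vectors and kernels of graded maps\<close>

text \<open>
  Independence of indexed vectors: a family in which a vector is repeated is dependent.
\<close>

definition indep :: "('v \<Rightarrow> 'w \<Rightarrow> complex) \<Rightarrow> 'v set \<Rightarrow> bool" where
  "indep c S \<longleftrightarrow> (\<forall>a. (\<forall>w. (\<Sum>v\<in>S. a v * c v w) = 0) \<longrightarrow> (\<forall>v\<in>S. a v = 0))"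

lemma indepD: "indep c S \<Longrightarrow> (\<And>w. (\<Sum>v\<in>S. a v * c v w) = 0) \<Longrightarrow> v \<in> S \<Longrightarrow> a v = 0"
  unfolding indep_def by blast

text \<open>
  More unknowns than equations; by elimination of one unknown with one equation.
\<close>

lemma homogeneous_system:
  fixes a :: "'v \<Rightarrow> 'u \<Rightarrow> complex"
  assumes "finite T" "finite S" "card T < card S"
  shows "\<exists>b. (\<exists>v\<in>S. b v \<noteq> 0) \<and> (\<forall>u\<in>T. (\<Sum>v\<in>S. b v * a v u) = 0)"
  using assms
proof (induction T arbitrary: S a rule: finite_induct)
  case empty
  then obtain v where "v \<in> S" by fastforce
  then show ?case by (intro exI[of _ "\<lambda>_. 1"]) auto
next
  case (insert u T)
  show ?case
  proof (cases "\<forall>v\<in>S. a v u = 0")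
    case True
    obtain b where "\<exists>v\<in>S. b v \<noteq> 0" "\<forall>u\<in>T. (\<Sum>v\<in>S. b v * a v u) = 0"
      using insert.IH[of S a] insert.prems insert.hyps by auto
    then show ?thesis using True by (intro exI[of _ b]) auto
  next
    case False
    then obtain v0 where v0: "v0 \<in> S" "a v0 u \<noteq> 0" by blast
    define S' where "S' = S - {v0}"
    have S': "finite S'" "card T < card S'" "S = insert v0 S'" "v0 \<notin> S'"
      using insert v0 by (auto simp: S'_def)
    \<comment> \<open>Equation \<open>u\<close> is solved for the unknown of \<open>v0\<close>, and this is substituted into the others.\<close>
    define a' where "a' v u' = a v u' - a v u / a v0 u * a v0 u'" for v u'
    obtain b where b: "\<exists>v\<in>S'. b v \<noteq> 0" "\<And>u'. u' \<in> T \<Longrightarrow> (\<Sum>v\<in>S'. b v * a' v u') = 0"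
      using insert.IH[of S' a'] S' by auto
    define \<beta> where "\<beta> = - (\<Sum>v\<in>S'. b v * (a v u / a v0 u))"
    define b' where "b' = b(v0 := \<beta>)"
    have sum: "(\<Sum>v\<in>S. b' v * a v u') = (\<Sum>v\<in>S'. b v * a' v u')" for u'
    proof -
      have "(\<Sum>v\<in>S. b' v * a v u') = \<beta> * a v0 u' + (\<Sum>v\<in>S'. b' v * a v u')"
        unfolding S'(3) using S' by (simp add: b'_def)
      also have "(\<Sum>v\<in>S'. b' v * a v u') = (\<Sum>v\<in>S'. b v * a v u')"
        using S'(4) by (intro sum.cong) (auto simp: b'_def)
      also have "\<beta> * a v0 u' + \<dots> = (\<Sum>v\<in>S'. b v * a' v u')"
        by (simp add: \<beta>_def a'_def algebra_simps sum_subtractf sum_distrib_left sum_distrib_right)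
      finally show ?thesis .
    qed
    have "(\<Sum>v\<in>S. b' v * a v u') = 0" if "u' \<in> insert u T" for u'
    proof (cases "u' = u")
      case True
      then show ?thesis using v0 by (simp add: sum a'_def)
    qed (use b(2) that in \<open>simp add: sum\<close>)
    moreover have "\<exists>v\<in>S. b' v \<noteq> 0" using b(1) S' by (auto simp: b'_def)
    ultimately show ?thesis by blast
  qed
qed

lemma indep_card_le:
  fixes c :: "'v \<Rightarrow> 'w \<Rightarrow> complex" and t :: "'u \<Rightarrow> 'w \<Rightarrow> complex"
  assumes "finite S" "finite T" and ind: "indep c S"
    and comb: "\<And>v w. v \<in> S \<Longrightarrow> c v w = (\<Sum>u\<in>T. a v u * t u w)"
  shows "card S \<le> card T"
proof (rule ccontr)
  assume "\<not> ?thesis"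
  then obtain b where b: "\<exists>v\<in>S. b v \<noteq> 0" "\<And>u. u \<in> T \<Longrightarrow> (\<Sum>v\<in>S. b v * a v u) = 0"
    using homogeneous_system[OF assms(2,1), of a] by auto
  have "(\<Sum>v\<in>S. b v * c v w) = 0" for w
  proof -
    have "(\<Sum>v\<in>S. b v * c v w) = (\<Sum>v\<in>S. \<Sum>u\<in>T. b v * a v u * t u w)"
      using comb by (intro sum.cong) (auto simp: sum_distrib_left mult.assoc)
    also have "\<dots> = (\<Sum>u\<in>T. (\<Sum>v\<in>S. b v * a v u) * t u w)"
      by (subst sum.swap) (simp add: sum_distrib_right)
    finally show ?thesis using b(2) by simp
  qed
  then show False using ind b(1) unfolding indep_def by blast
qed

lemma dependent_insert:
  assumes S: "finite S" "v \<notin> S" and ind: "indep c S" and dep: "\<not> indep c (insert v S)"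
  shows "\<exists>a. \<forall>w. c v w = (\<Sum>u\<in>S. a u * c u w)"
proof -
  obtain a where a: "\<And>w. (\<Sum>u\<in>insert v S. a u * c u w) = 0" and nz: "\<exists>u\<in>insert v S. a u \<noteq> 0"
    using dep unfolding indep_def by blast
  have av: "a v \<noteq> 0"
  proof
    assume "a v = 0"
    then have "\<And>w. (\<Sum>u\<in>S. a u * c u w) = 0" using a S by simp
    then have "\<forall>u\<in>S. a u = 0" using ind unfolding indep_def by blast
    then show False using nz \<open>a v = 0\<close> by blast
  qed
  have "c v w = (\<Sum>u\<in>S. (- a u / a v) * c u w)" for w
  proof -
    have "a v * c v w = - (\<Sum>u\<in>S. a u * c u w)" using a[of w] S by (simp add: add_eq_0_iff2)
    then have "c v w = - (\<Sum>u\<in>S. a u * c u w) / a v" using av by (simp add: field_simps)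
    then show ?thesis by (simp add: sum_divide_distrib sum_negf)
  qed
  then show ?thesis by (intro exI[of _ "\<lambda>u. - a u / a v"] allI)
qed

lemma in_span_self:
  fixes c :: "'v \<Rightarrow> 'w \<Rightarrow> complex"
  assumes "finite S" "v \<in> S"
  shows "\<exists>a. \<forall>w. c v w = (\<Sum>u\<in>S. a u * c u w)"
  using assms by (intro exI[of _ "\<lambda>u. if u = v then 1 else 0"])
    (simp add: if_distrib[where f = "\<lambda>x. x * _"] cong: if_cong)

lemma maximal_indep:
  assumes "finite V"
  obtains S where "S \<subseteq> V" "indep c S" "\<And>v. v \<in> V \<Longrightarrow> \<exists>a. \<forall>w. c v w = (\<Sum>u\<in>S. a u * c u w)"
proof -
  have "\<exists>S\<subseteq>V. indep c S \<and> (\<forall>v\<in>V. \<exists>a. \<forall>w. c v w = (\<Sum>u\<in>S. a u * c u w))"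
    using assms
  proof (induction V rule: finite_induct)
    case empty
    then show ?case by (auto simp: indep_def)
  next
    case (insert v V)
    then obtain S where S: "S \<subseteq> V" "indep c S" "\<forall>v\<in>V. \<exists>a. \<forall>w. c v w = (\<Sum>u\<in>S. a u * c u w)" by blast
    have fin: "finite S" "v \<notin> S" using S insert finite_subset by auto
    show ?case
    proof (cases "indep c (insert v S)")
      case True
      have "\<exists>a. \<forall>w. c v' w = (\<Sum>u\<in>insert v S. a u * c u w)" if "v' \<in> insert v V" for v'
      proof (cases "v' = v")
        case True
        then show ?thesis using fin by (intro in_span_self) auto
      next
        case False
        then have "v' \<in> V" using that by simp
        from bspec[OF S(3) this] obtain a where "\<forall>w. c v' w = (\<Sum>u\<in>S. a u * c u w)" by (rule exE)
        then have "\<forall>w. c v' w = (\<Sum>u\<in>insert v S. (a(v := 0)) u * c u w)"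
          using fin by (auto intro!: sum.cong)
        then show ?thesis by (rule exI[of _ "a(v := 0)"])
      qed
      then show ?thesis using True S by (intro exI[of _ "insert v S"]) auto
    next
      case False
      then show ?thesis using dependent_insert[OF fin S(2)] S by (intro exI[of _ S]) auto
    qed
  qed
  then show thesis using that by blast
qed

text \<open>
  Ranks are compared through independent sets of columns, since the spaces of functions that contain
  the columns may have infinite dimension.
\<close>

definition rank_le :: "'v set \<Rightarrow> ('v \<Rightarrow> 'w \<Rightarrow> complex) \<Rightarrow> ('v \<Rightarrow> 'w \<Rightarrow> complex) \<Rightarrow> bool" where
  "rank_le V c c' \<longleftrightarrow> (\<forall>S\<subseteq>V. indep c S \<longrightarrow> (\<exists>S'\<subseteq>V. indep c' S' \<and> card S \<le> card S'))"

lemma rank_le_trans: "rank_le V c c' \<Longrightarrow> rank_le V c' c'' \<Longrightarrow> rank_le V c c''"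
  unfolding rank_le_def by (meson le_trans)

context cone
begin

lemma least_degree:
  assumes "finite S" "S \<noteq> {}" "\<And>v v'. v \<in> S \<Longrightarrow> v' \<in> S \<Longrightarrow> d v - d v' \<in> C \<or> d v' - d v \<in> C"
  shows "\<exists>v\<in>S. \<forall>v'\<in>S. d v' - d v \<in> C"
  using assms
proof (induction S rule: finite_ne_induct)
  case (singleton x)
  then show ?case by (simp add: zero)
next
  case (insert x S)
  then obtain v where v: "v \<in> S" "\<And>v'. v' \<in> S \<Longrightarrow> d v' - d v \<in> C" by blast
  show ?case
  proof (cases "d x - d v \<in> C")
    case True
    then show ?thesis using v by (intro bexI[of _ v]) auto
  next
    case False
    then have *: "d v - d x \<in> C" using insert.prems[of x v] v by blast
    have "d v' - d x \<in> C" if "v' \<in> S" for v' using add[OF v(2)[OF that] *] by simp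
    then show ?thesis using zero by (intro bexI[of _ x]) auto
  qed
qed

text \<open>
  Let \<open>c\<close> be a linear map, given by its columns, that does not lower degrees, and \<open>c0\<close> its part of
  degree zero.  If a family of columns of \<open>c0\<close> is a basis of its image then the columns of \<open>c\<close> with
  the same indices are independent, since their leading terms are.  When the rank of \<open>c\<close> is not larger
  than that of \<open>c0\<close>, these columns span the image of \<open>c\<close>.  So the image under \<open>c\<close> of a
  homogeneous \<open>x\<close> in the kernel of \<open>c0\<close> is a combination of them, and comparing leading terms shows that only columns of
  degree above that of \<open>x\<close> take part.  Subtracting the combination corrects \<open>x\<close>.
\<close>

theorem kernel_lift:
  fixes c c0 :: "'v \<Rightarrow> 'w \<Rightarrow> complex"
  assumes fin: "finite V"
    and total: "\<And>v v'. v \<in> V \<Longrightarrow> v' \<in> V \<Longrightarrow> d v - d v' \<in> C \<or> d v' - d v \<in> C"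
    and raise: "\<And>v w. v \<in> V \<Longrightarrow> c v w \<noteq> 0 \<Longrightarrow> e w - d v \<in> C"
    and c0: "\<And>v w. v \<in> V \<Longrightarrow> c0 v w = (if e w = d v then c v w else 0)"
    and rank: "rank_le V c c0"
    and x: "\<And>v. v \<in> V \<Longrightarrow> x v \<noteq> 0 \<Longrightarrow> d v = \<gamma>"
    and ker: "\<And>w. (\<Sum>v\<in>V. x v * c0 v w) = 0"
    and \<gamma>: "\<And>v. v \<in> V \<Longrightarrow> \<gamma> - d v \<in> C \<or> d v - \<gamma> \<in> C"
  shows "\<exists>y. (\<forall>v\<in>V. y v \<noteq> 0 \<longrightarrow> d v \<noteq> \<gamma> \<and> d v - \<gamma> \<in> C) \<and> (\<forall>w. (\<Sum>v\<in>V. (x v + y v) * c v w) = 0)"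
proof -
  obtain S where S: "S \<subseteq> V" and ind0: "indep c0 S"
    and span0: "\<And>v. v \<in> V \<Longrightarrow> \<exists>a. \<forall>w. c0 v w = (\<Sum>u\<in>S. a u * c0 u w)"
    using maximal_indep[OF fin] by blast
  have finS: "finite S" using S fin finite_subset by blast
  \<comment> \<open>A combination of the columns of \<open>c\<close> in \<open>S\<close> has in the least degree that occurs the same
    component as the combination of the columns of \<open>c0\<close>.\<close>
  have lead: "e w = d u0 \<Longrightarrow> (\<Sum>u\<in>S. a u * c u w) = (\<Sum>u\<in>S. (if d u = d u0 then a u else 0) * c0 u w)"
    if least: "\<And>u. u \<in> S \<Longrightarrow> a u \<noteq> 0 \<Longrightarrow> d u - d u0 \<in> C" for a u0 w
  proof (rule sum.cong[OF refl])
    fix u assume w: "e w = d u0" and u: "u \<in> S"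
    show "a u * c u w = (if d u = d u0 then a u else 0) * c0 u w"
    proof (cases "d u = d u0")
      case True
      then show ?thesis using c0[of u w] u S w by auto
    next
      case False
      have "a u = 0 \<or> c u w = 0"
      proof (rule ccontr)
        assume "\<not> ?thesis"
        then have "d u - d u0 \<in> C" "e w - d u \<in> C" using least[OF u] raise[of u w] u S by auto
        then show False using False w pointed[of "d u - d u0"] by simp
      qed
      then show ?thesis using False by auto
    qed
  qed
  have c0z: "c0 u w = 0" if "u \<in> S" "e w \<noteq> d u" for u w using c0[of u w] that S by auto
  \<comment> \<open>A combination whose component of least degree vanishes has no term of that degree.\<close>
  have lead': "a u0 = 0" if least: "\<And>u. u \<in> S \<Longrightarrow> a u \<noteq> 0 \<Longrightarrow> d u - d u0 \<in> C" and u0: "u0 \<in> S"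
    and zero: "\<And>w. e w = d u0 \<Longrightarrow> (\<Sum>u\<in>S. a u * c u w) = 0" for a u0
  proof -
    have "(\<Sum>u\<in>S. (if d u = d u0 then a u else 0) * c0 u w) = 0" for w
    proof (cases "e w = d u0")
      case True
      then show ?thesis using lead[OF least True] zero[OF True] by simp
    next
      case False
      then show ?thesis using c0z by (intro sum.neutral) auto
    qed
    from indepD[OF ind0 this u0] show ?thesis by simp
  qed
  have leastex: "\<exists>u0\<in>S. a u0 \<noteq> 0 \<and> (\<forall>u\<in>S. a u \<noteq> 0 \<longrightarrow> d u - d u0 \<in> C)"
    if nz: "\<exists>u\<in>S. a u \<noteq> 0" for a :: "'v \<Rightarrow> complex"
  proof -
    let ?T = "{u\<in>S. a u \<noteq> 0}"
    have "\<exists>v\<in>?T. \<forall>v'\<in>?T. d v' - d v \<in> C"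
    proof (rule least_degree)
      show "finite ?T" using finS by simp
      show "?T \<noteq> {}" using nz by blast
      show "d v - d v' \<in> C \<or> d v' - d v \<in> C" if "v \<in> ?T" "v' \<in> ?T" for v v'
        by (rule total) (use that S in auto)
    qed
    then show ?thesis by blast
  qed
  have ind: "indep c S" unfolding indep_def
  proof (intro allI impI ballI, rule ccontr)
    fix a v assume z: "\<forall>w. (\<Sum>u\<in>S. a u * c u w) = 0" and v: "v \<in> S" "a v \<noteq> 0"
    obtain u0 where u0: "u0 \<in> S" "a u0 \<noteq> 0" "\<forall>u\<in>S. a u \<noteq> 0 \<longrightarrow> d u - d u0 \<in> C"
      using leastex[OF bexI[of "\<lambda>u. a u \<noteq> 0", OF v(2,1)]] by blast
    have "a u0 = 0"
      by (rule lead'[OF _ u0(1)]) (use u0(3) z in blast)+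
    then show False using u0(2) by contradiction
  qed
  have max: "card S' \<le> card S" if S': "S' \<subseteq> V" "indep c S'" for S'
  proof -
    obtain S'' where S'': "S'' \<subseteq> V" "indep c0 S''" "card S' \<le> card S''"
      using rank S' unfolding rank_le_def by blast
    have "\<forall>v\<in>S''. \<exists>a. \<forall>w. c0 v w = (\<Sum>u\<in>S. a u * c0 u w)" using span0 S'' by blast
    then obtain a where "\<forall>v\<in>S''. \<forall>w. c0 v w = (\<Sum>u\<in>S. a v u * c0 u w)" by (auto dest!: bchoice)
    then have "card S'' \<le> card S"
      using S'' fin finS by (intro indep_card_le[of S'' S c0 a c0]) (auto intro: finite_subset)
    then show ?thesis using S'' by simp
  qed
  have span: "\<exists>a. \<forall>w. c v w = (\<Sum>u\<in>S. a u * c u w)" if v: "v \<in> V" for v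
  proof (cases "v \<in> S")
    case True
    then show ?thesis by (intro in_span_self finS)
  next
    case False
    have "\<not> indep c (insert v S)"
      using max[of "insert v S"] v S False finS by auto
    then show ?thesis using dependent_insert[OF finS False ind] by blast
  qed
  then have "\<forall>v\<in>V. \<exists>a. \<forall>w. c v w = (\<Sum>u\<in>S. a u * c u w)" by blast
  then obtain b where b: "\<And>v w. v \<in> V \<Longrightarrow> c v w = (\<Sum>u\<in>S. b v u * c u w)" by (auto dest!: bchoice)
  define a where "a u = (\<Sum>v\<in>V. x v * b v u)" for u
  have xa: "(\<Sum>v\<in>V. x v * c v w) = (\<Sum>u\<in>S. a u * c u w)" for w
  proof -
    have "(\<Sum>v\<in>V. x v * c v w) = (\<Sum>v\<in>V. \<Sum>u\<in>S. x v * b v u * c u w)"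
      using b by (intro sum.cong) (auto simp: sum_distrib_left mult.assoc)
    also have "\<dots> = (\<Sum>u\<in>S. a u * c u w)"
      by (subst sum.swap) (simp add: sum_distrib_right a_def)
    finally show ?thesis .
  qed
  \<comment> \<open>The image of \<open>x\<close> under \<open>c\<close> has no component of degree \<open>\<gamma>\<close> or below.\<close>
  have high: "(\<Sum>v\<in>V. x v * c v w) = 0" if w: "\<gamma> - e w \<in> C" for w
  proof (cases "e w = \<gamma>")
    case True
    have "(\<Sum>v\<in>V. x v * c v w) = (\<Sum>v\<in>V. x v * c0 v w)"
    proof (rule sum.cong[OF refl])
      fix v assume "v \<in> V"
      then show "x v * c v w = x v * c0 v w" using x[of v] c0[of v w] True by (cases "x v = 0") auto
    qed
    then show ?thesis using ker by simp
  next
    case False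
    have "x v = 0 \<or> c v w = 0" if "v \<in> V" for v
      using x[OF that] raise[OF that, of w] w False pointed[of "\<gamma> - e w"] by auto
    then show ?thesis by (intro sum.neutral) auto
  qed
  have adeg: "d u \<noteq> \<gamma> \<and> d u - \<gamma> \<in> C" if u: "u \<in> S" "a u \<noteq> 0" for u
  proof -
    obtain u0 where u0: "u0 \<in> S" "a u0 \<noteq> 0" "\<forall>u\<in>S. a u \<noteq> 0 \<longrightarrow> d u - d u0 \<in> C"
      using leastex[OF bexI[of "\<lambda>u. a u \<noteq> 0", OF u(2,1)]] by blast
    have "\<gamma> - d u0 \<notin> C"
    proof
      assume g: "\<gamma> - d u0 \<in> C"
      have "a u0 = 0"
      proof (rule lead')
        show "(\<Sum>u\<in>S. a u * c u w) = 0" if "e w = d u0" for w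
          using high[of w] xa[of w] g that by simp
      qed (use u0 in auto)
      then show False using u0 by simp
    qed
    then have g: "d u0 - \<gamma> \<in> C" "d u0 \<noteq> \<gamma>" using \<gamma>[of u0] u0 S zero by auto
    have u1: "d u - d u0 \<in> C" using u0 u by blast
    from add[OF u1 g(1)] have "d u - \<gamma> \<in> C" by simp
    moreover have "d u \<noteq> \<gamma>" using sum_zeroD[OF u1 g(1)] g(2) by auto
    ultimately show ?thesis by blast
  qed
  define y where "y v = (if v \<in> S then - a v else 0)" for v
  have "(\<Sum>v\<in>V. (x v + y v) * c v w) = 0" for w
  proof -
    have "(\<Sum>v\<in>V. y v * c v w) = (\<Sum>v\<in>S. - a v * c v w)"
      using S fin by (intro sum.mono_neutral_cong_right) (auto simp: y_def)
    then show ?thesis using xa[of w] by (simp add: distrib_right sum.distrib sum_negf)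
  qed
  moreover have "\<forall>v\<in>V. y v \<noteq> 0 \<longrightarrow> d v \<noteq> \<gamma> \<and> d v - \<gamma> \<in> C"
    using adeg by (auto simp: y_def)
  ultimately show ?thesis by blast
qed

end

section \<open>The rank of the infinitesimal action\<close>

text \<open>
  Coordinates of the Lie algebra: \<open>(s, i, j)\<close> is entry \<open>(i, j)\<close> of the matrix of factor \<open>s\<close>.
\<close>

definition entries :: "nat list \<Rightarrow> (nat \<times> nat \<times> nat) set" where
  "entries ds = (SIGMA s:{..<length ds}. {..<ds ! s} \<times> {..<ds ! s})"

lemma finite_entries [simp]: "finite (entries ds)"
  by (simp add: entries_def)

lemma entries_iff: "(s, i, j) \<in> entries ds \<longleftrightarrow> s < length ds \<and> i < ds ! s \<and> j < ds ! s"
  by (auto simp: entries_def)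

definition fam :: "nat list \<Rightarrow> (nat \<times> nat \<times> nat \<Rightarrow> complex) \<Rightarrow> nat \<Rightarrow> complex mat" where
  "fam ds y s = mat (ds ! s) (ds ! s) (\<lambda>(i, j). y (s, i, j))"

lemma fam_square [simp]: "square_family ds (fam ds y)"
  by (simp add: square_family_def fam_def)

lemma fam_carrier [simp]: "fam ds y s \<in> carrier_mat (ds ! s) (ds ! s)"
  by (simp add: fam_def)

lemma fam_index: "i < ds ! s \<Longrightarrow> j < ds ! s \<Longrightarrow> fam ds y s $$ (i, j) = y (s, i, j)"
  by (simp add: fam_def)

lemma fam_of_entries:
  assumes "square_family ds A" "s < length ds"
  shows "fam ds (\<lambda>(s, i, j). A s $$ (i, j)) s = A s"
  using assms by (intro eq_matI) (auto simp: fam_def square_family_def)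

definition lie_unit :: "nat list \<Rightarrow> nat \<times> nat \<times> nat \<Rightarrow> complex mat" where
  "lie_unit ds v = lie ds (fam ds (\<lambda>u. if u = v then 1 else 0))"

lemma lie_unit_carrier [simp]: "lie_unit ds v \<in> carrier_mat (prod_list ds) (prod_list ds)"
  by (simp add: lie_unit_def)

lemma lie_zero: "I < prod_list ds \<Longrightarrow> J < prod_list ds \<Longrightarrow> lie ds (fam ds (\<lambda>_. 0)) $$ (I, J) = 0"
proof -
  assume IJ: "I < prod_list ds" "J < prod_list ds"
  have "lie ds (fam ds (\<lambda>_. 0)) = lie ds (\<lambda>s. 1 \<cdot>\<^sub>m fam ds (\<lambda>_. 0) s + fam ds (\<lambda>_. 0) s)"
    by (intro lie_cong eq_matI) (auto simp: fam_def)
  also have "\<dots> = 1 \<cdot>\<^sub>m lie ds (fam ds (\<lambda>_. 0)) + lie ds (fam ds (\<lambda>_. 0))" by (intro lie_linear) auto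
  finally have "lie ds (fam ds (\<lambda>_. 0)) $$ (I, J) = (1 \<cdot>\<^sub>m lie ds (fam ds (\<lambda>_. 0)) + lie ds (fam ds (\<lambda>_. 0))) $$ (I, J)"
    by simp
  moreover have "lie ds (fam ds (\<lambda>_. 0)) \<in> carrier_mat (prod_list ds) (prod_list ds)" by simp
  ultimately show ?thesis using IJ by auto
qed

lemma lie_expand:
  assumes IJ: "I < prod_list ds" "J < prod_list ds"
  shows "lie ds (fam ds y) $$ (I, J) = (\<Sum>v\<in>entries ds. y v * lie_unit ds v $$ (I, J))"
proof -
  have "lie ds (fam ds (\<lambda>v. if v \<in> S then y v else 0)) $$ (I, J) = (\<Sum>v\<in>S. y v * lie_unit ds v $$ (I, J))"
    if "finite S" for S
    using that
  proof (induction S rule: finite_induct)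
    case empty
    then show ?case using lie_zero[OF IJ] by simp
  next
    case (insert v S)
    let ?z = "\<lambda>v. if v \<in> S then y v else 0"
    have "lie ds (fam ds (\<lambda>u. if u \<in> insert v S then y u else 0))
        = lie ds (\<lambda>s. y v \<cdot>\<^sub>m fam ds (\<lambda>u. if u = v then 1 else 0) s + fam ds ?z s)"
      using insert by (intro lie_cong eq_matI) (auto simp: fam_def)
    also have "\<dots> = y v \<cdot>\<^sub>m lie_unit ds v + lie ds (fam ds ?z)"
      unfolding lie_unit_def by (intro lie_linear) auto
    finally have *: "lie ds (fam ds (\<lambda>u. if u \<in> insert v S then y u else 0)) = y v \<cdot>\<^sub>m lie_unit ds v + lie ds (fam ds ?z)" .
    have c: "lie ds (fam ds ?z) \<in> carrier_mat (prod_list ds) (prod_list ds)"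
      "lie_unit ds v \<in> carrier_mat (prod_list ds) (prod_list ds)" by simp_all
    have "lie ds (fam ds (\<lambda>u. if u \<in> insert v S then y u else 0)) $$ (I, J)
        = y v * lie_unit ds v $$ (I, J) + lie ds (fam ds ?z) $$ (I, J)"
      unfolding * using carrier_matD[OF c(1)] carrier_matD[OF c(2)] IJ by simp
    then show ?case using insert by simp
  qed
  from this[OF finite_entries, of ds]
  have "lie ds (fam ds (\<lambda>v. if v \<in> entries ds then y v else 0)) $$ (I, J)
    = (\<Sum>v\<in>entries ds. y v * lie_unit ds v $$ (I, J))" .
  moreover have "lie ds (fam ds (\<lambda>v. if v \<in> entries ds then y v else 0)) = lie ds (fam ds y)"
    by (intro lie_cong eq_matI) (auto simp: fam_def entries_iff)
  ultimately show ?thesis by simp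
qed

text \<open>
  The columns of the linear map \<open>\<xi> \<mapsto> [\<xi>, X]\<close> from the Lie algebra to tuples of matrices, in the bases
  of matrix units: column \<open>v\<close> is the image of the unit \<open>v\<close>, and its coordinate \<open>(k, I, J)\<close> is entry
  \<open>(I, J)\<close> of the matrix number \<open>k\<close>.
\<close>

definition commutator_col :: "nat list \<Rightarrow> complex mat list \<Rightarrow> nat \<times> nat \<times> nat \<Rightarrow> nat \<times> nat \<times> nat \<Rightarrow> complex" where
  "commutator_col ds X v = (\<lambda>(k, I, J). if k < length X \<and> I < prod_list ds \<and> J < prod_list ds
     then \<Sum>P<prod_list ds. lie_unit ds v $$ (I, P) * (X ! k) $$ (P, J) - (X ! k) $$ (I, P) * lie_unit ds v $$ (P, J)
     else 0)"

lemma mat_tuples_nth: "X \<in> mat_tuples N m \<Longrightarrow> k < m \<Longrightarrow> X ! k \<in> carrier_mat N N"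
  unfolding mat_tuples_def by (metis (mono_tags, lifting) mem_Collect_eq nth_mem subsetD)

lemma commutator_col_lie:
  assumes X: "X \<in> mat_tuples (prod_list ds) m" and k: "k < m" "I < prod_list ds" "J < prod_list ds"
  shows "(\<Sum>v\<in>entries ds. y v * commutator_col ds X v (k, I, J)) =
    (lie ds (fam ds y) * X ! k - X ! k * lie ds (fam ds y)) $$ (I, J)"
proof -
  let ?N = "prod_list ds" and ?L = "lie ds (fam ds y)"
  have c: "X ! k \<in> carrier_mat ?N ?N" "?L \<in> carrier_mat ?N ?N" and len: "length X = m"
    using mat_tuples_nth[OF X k(1)] X by (auto simp: mat_tuples_def)
  have "(\<Sum>v\<in>entries ds. y v * commutator_col ds X v (k, I, J))
      = (\<Sum>v\<in>entries ds. \<Sum>P<?N. y v * lie_unit ds v $$ (I, P) * (X ! k) $$ (P, J) -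
           (X ! k) $$ (I, P) * (y v * lie_unit ds v $$ (P, J)))"
    using k len by (simp add: commutator_col_def sum_distrib_left algebra_simps)
  also have "\<dots> = (\<Sum>P<?N. (\<Sum>v\<in>entries ds. y v * lie_unit ds v $$ (I, P)) * (X ! k) $$ (P, J) -
           (X ! k) $$ (I, P) * (\<Sum>v\<in>entries ds. y v * lie_unit ds v $$ (P, J)))"
    by (subst sum.swap) (simp add: sum_subtractf sum_distrib_left sum_distrib_right)
  also have "\<dots> = (\<Sum>P<?N. ?L $$ (I, P) * (X ! k) $$ (P, J) - (X ! k) $$ (I, P) * ?L $$ (P, J))"
    using k by (intro sum.cong) (auto simp: lie_expand)
  also have "\<dots> = (?L * X ! k) $$ (I, J) - (X ! k * ?L) $$ (I, J)"
    unfolding mult_index[OF c(2,1) k(2,3)] mult_index[OF c k(2,3)] by (simp add: sum_subtractf)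
  also have "\<dots> = (?L * X ! k - X ! k * ?L) $$ (I, J)"
    using carrier_matD[OF c(1)] carrier_matD[OF c(2)] k by simp
  finally show ?thesis .
qed

text \<open>
  Group elements are paired with their inverses, since conjugation needs both.
\<close>

definition inverse_families :: "nat list \<Rightarrow> (nat \<Rightarrow> complex mat) \<Rightarrow> (nat \<Rightarrow> complex mat) \<Rightarrow> bool" where
  "inverse_families ds g h \<longleftrightarrow> square_family ds g \<and> square_family ds h \<and>
     (\<forall>s < length ds. g s * h s = 1\<^sub>m (ds ! s) \<and> h s * g s = 1\<^sub>m (ds ! s))"

definition conj_tuple :: "nat list \<Rightarrow> (nat \<Rightarrow> complex mat) \<Rightarrow> (nat \<Rightarrow> complex mat) \<Rightarrow> complex mat list \<Rightarrow> complex mat list" where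
  "conj_tuple ds g h X = map (\<lambda>M. tens ds g * M * tens ds h) X"

lemma inverse_families_sym: "inverse_families ds g h \<Longrightarrow> inverse_families ds h g"
  by (auto simp: inverse_families_def)

lemma inverse_families_mult:
  assumes "inverse_families ds g h" "inverse_families ds g' h'"
  shows "inverse_families ds (\<lambda>s. g s * g' s) (\<lambda>s. h' s * h s)"
  using assms unfolding inverse_families_def
  by (auto simp: square_family_def intro!: mult_inverse_pair)

lemma inverse_families_unique:
  assumes "inverse_families ds g h" "inverse_families ds g h'" "s < length ds"
  shows "h' s = h s"
proof -
  have c: "g s \<in> carrier_mat (ds ! s) (ds ! s)" "h s \<in> carrier_mat (ds ! s) (ds ! s)"
    "h' s \<in> carrier_mat (ds ! s) (ds ! s)" "g s * h s = 1\<^sub>m (ds ! s)" "h' s * g s = 1\<^sub>m (ds ! s)"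
    using assms by (auto simp: inverse_families_def square_family_def)
  have "h' s = h' s * (g s * h s)" unfolding c(4) by (rule right_mult_one_mat[OF c(3), symmetric])
  also have "\<dots> = (h' s * g s) * h s" by (rule square_mult_assoc[OF c(3,1,2), symmetric])
  also have "\<dots> = h s" unfolding c(5) by (rule left_mult_one_mat[OF c(2)])
  finally show ?thesis .
qed

lemma inverse_families_cong:
  "inverse_families ds g h \<Longrightarrow> (\<And>s. s < length ds \<Longrightarrow> g s = g' s) \<Longrightarrow> inverse_families ds g' h"
  by (simp add: inverse_families_def square_family_def)

lemma tens_inverse:
  assumes "inverse_families ds g h"
  shows "tens ds g * tens ds h = 1\<^sub>m (prod_list ds)" "tens ds h * tens ds g = 1\<^sub>m (prod_list ds)"
    "tens ds g \<in> carrier_mat (prod_list ds) (prod_list ds)" "tens ds h \<in> carrier_mat (prod_list ds) (prod_list ds)"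
  using assms by (auto simp: inverse_families_def tens_mult tens_one)

lemma conj_tuple_closed:
  assumes "inverse_families ds g h" "X \<in> mat_tuples (prod_list ds) m"
  shows "conj_tuple ds g h X \<in> mat_tuples (prod_list ds) m"
  using assms tens_inverse[OF assms(1)] unfolding mat_tuples_def conj_tuple_def
  by (auto intro!: square_mult_carrier)

lemma conj_tuple_nth:
  "k < length X \<Longrightarrow> conj_tuple ds g h X ! k = tens ds g * X ! k * tens ds h"
  by (simp add: conj_tuple_def)

lemma conj_tuple_conj:
  assumes gh: "inverse_families ds g h" and gh': "inverse_families ds g' h'" and X: "X \<in> mat_tuples (prod_list ds) m"
  shows "conj_tuple ds g h (conj_tuple ds g' h' X) = conj_tuple ds (\<lambda>s. g s * g' s) (\<lambda>s. h' s * h s) X"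
proof -
  have sf: "square_family ds g" "square_family ds h" "square_family ds g'" "square_family ds h'"
    using gh gh' by (auto simp: inverse_families_def)
  have "tens ds g * (tens ds g' * M * tens ds h') * tens ds h
      = tens ds (\<lambda>s. g s * g' s) * M * tens ds (\<lambda>s. h' s * h s)" if "M \<in> set X" for M
  proof -
    have "M \<in> carrier_mat (prod_list ds) (prod_list ds)" using that X by (auto simp: mat_tuples_def)
    then show ?thesis
      unfolding tens_mult[OF sf(1,3), symmetric] tens_mult[OF sf(4,2), symmetric]
      using sf by (simp add: square_mult_assoc[of _ "prod_list ds"])
  qed
  then show ?thesis by (simp add: conj_tuple_def)
qed

lemma conj_tuple_inverse:
  assumes gh: "inverse_families ds g h" and X: "X \<in> mat_tuples (prod_list ds) m"
  shows "conj_tuple ds h g (conj_tuple ds g h X) = X"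
proof -
  have "tens ds h * (tens ds g * M * tens ds h) * tens ds g = M" if "M \<in> set X" for M
  proof -
    have M: "M \<in> carrier_mat (prod_list ds) (prod_list ds)" using that X by (auto simp: mat_tuples_def)
    note t = tens_inverse[OF gh]
    have "tens ds h * (tens ds g * M * tens ds h) * tens ds g = (tens ds h * tens ds g) * M * (tens ds h * tens ds g)"
      using M t(3,4) by (simp add: square_mult_assoc[of _ "prod_list ds"])
    then show ?thesis using M by (simp add: t)
  qed
  then show ?thesis by (simp add: conj_tuple_def map_idI)
qed

text \<open>
  Conjugation by \<open>g\<close> carries the columns for \<open>Y\<close> to combinations of columns for the conjugate.  With
  the inverse of \<open>g\<close> it follows that the rank is constant on orbits.
\<close>

lemma rank_conj_le:
  assumes gh: "inverse_families ds g h" and Y: "Y \<in> mat_tuples (prod_list ds) m"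
  shows "rank_le (entries ds) (commutator_col ds (conj_tuple ds g h Y)) (commutator_col ds Y)"
  unfolding rank_le_def
proof (intro allI impI)
  let ?N = "prod_list ds" and ?X = "conj_tuple ds g h Y"
  let ?G = "tens ds g" and ?H = "tens ds h"
  fix S assume S: "S \<subseteq> entries ds" "indep (commutator_col ds ?X) S"
  obtain T where T: "T \<subseteq> entries ds" "indep (commutator_col ds Y) T"
    and span: "\<And>v. v \<in> entries ds \<Longrightarrow> \<exists>a. \<forall>w. commutator_col ds Y v w = (\<Sum>u\<in>T. a u * commutator_col ds Y u w)"
    using maximal_indep[OF finite_entries[of ds], of "commutator_col ds Y"] by blast
  have fin: "finite S" "finite T" using S T finite_subset finite_entries by blast+
  from span have "\<forall>v\<in>entries ds. \<exists>a. \<forall>w. commutator_col ds Y v w = (\<Sum>u\<in>T. a u * commutator_col ds Y u w)" by blast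
  then obtain b where b: "\<And>v w. v \<in> entries ds \<Longrightarrow> commutator_col ds Y v w = (\<Sum>u\<in>T. b v u * commutator_col ds Y u w)"
    by (auto dest!: bchoice)
  define t where "t u = (\<lambda>(k, I, J). if k < m \<and> I < ?N \<and> J < ?N
    then \<Sum>P<?N. \<Sum>R<?N. ?G $$ (I, P) * commutator_col ds Y u (k, P, R) * ?H $$ (R, J) else 0)" for u
  note tG = tens_inverse[OF gh]
  have Xm: "?X \<in> mat_tuples ?N m" by (rule conj_tuple_closed[OF gh Y])
  have len: "length ?X = m" "length Y = m" using Xm Y by (auto simp: mat_tuples_def)
  define a where "a v = (\<lambda>(s, i, j). (h s * fam ds (\<lambda>u. if u = v then 1 else 0) s * g s) $$ (i, j))" for v
  define c where "c v u = (\<Sum>v'\<in>entries ds. a v v' * b v' u)" for v u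
  have "commutator_col ds ?X v w = (\<Sum>u\<in>T. c v u * t u w)" if v: "v \<in> S" for v w
  proof -
    obtain k I J where w: "w = (k, I, J)" by (cases w) auto
    show ?thesis
    proof (cases "k < m \<and> I < ?N \<and> J < ?N")
      case False
      then show ?thesis using len by (auto simp: w commutator_col_def t_def)
    next
      case True
      then have kIJ: "k < m" "I < ?N" "J < ?N" by auto
      let ?D = "lie_unit ds v" and ?Y = "Y ! k" and ?L = "lie ds (fam ds (a v))"
      have Yk: "?Y \<in> carrier_mat ?N ?N" by (rule mat_tuples_nth[OF Y kIJ(1)])
      have v': "v \<in> entries ds" using v S by blast
      have sf: "square_family ds g" "square_family ds h" using gh by (auto simp: inverse_families_def)
      have "?L = lie ds (\<lambda>s. h s * fam ds (\<lambda>u. if u = v then 1 else 0) s * g s)"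
        unfolding a_def using sf by (intro lie_cong fam_of_entries) (auto simp: square_family_def)
      also have "\<dots> = ?H * ?D * ?G"
        unfolding lie_unit_def using gh
        by (intro lie_conj[symmetric]) (auto simp: inverse_families_def)
      finally have L: "?L = ?H * ?D * ?G" .
      have Lc: "?L \<in> carrier_mat ?N ?N" by simp
      have "?D = (?G * ?H) * ?D * (?G * ?H)"
        unfolding tG(1) by (simp add: left_mult_one_mat[of _ ?N ?N] right_mult_one_mat[of _ ?N ?N])
      then have D: "?D = ?G * ?L * ?H" unfolding L using tG(3,4)
        by (simp add: square_mult_assoc[of _ ?N])
      have HG: "A * (?H * (?G * B)) = A * B" if "A \<in> carrier_mat ?N ?N" "B \<in> carrier_mat ?N ?N" for A B
        using that tG by (simp add: square_mult_assoc[of _ ?N, symmetric])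
      define Z where "Z = ?L * ?Y - ?Y * ?L"
      have Zc: "Z \<in> carrier_mat ?N ?N" unfolding Z_def by (intro minus_carrier_mat square_mult_carrier Lc Yk)
      have "?D * (?G * ?Y * ?H) - (?G * ?Y * ?H) * ?D = ?G * Z * ?H"
      proof -
        have "?D * (?G * ?Y * ?H) = ?G * (?L * ?Y) * ?H"
          unfolding D using tG(3,4) Lc Yk by (simp add: square_mult_assoc[of _ ?N] HG)
        moreover have "(?G * ?Y * ?H) * ?D = ?G * (?Y * ?L) * ?H"
          unfolding D using tG(3,4) Lc Yk by (simp add: square_mult_assoc[of _ ?N] HG)
        moreover have "?G * Z * ?H = ?G * (?L * ?Y) * ?H - ?G * (?Y * ?L) * ?H"
          unfolding Z_def using tG(3,4) Lc Yk
          by (simp add: mult_minus_distrib_mat[of _ ?N ?N _ ?N] minus_mult_distrib_mat[of _ ?N ?N _ _ ?N])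
        ultimately show ?thesis by simp
      qed
      moreover have "commutator_col ds ?X v (k, I, J) = (?D * (?X ! k) - (?X ! k) * ?D) $$ (I, J)"
      proof -
        have "commutator_col ds ?X v (k, I, J)
            = (\<Sum>u\<in>entries ds. (if u = v then 1 else 0) * commutator_col ds ?X u (k, I, J))"
          using v' by (simp add: if_distrib[where f = "\<lambda>x. x * _"] cong: if_cong)
        then show ?thesis unfolding commutator_col_lie[OF Xm kIJ] lie_unit_def by simp
      qed
      moreover have "?X ! k = ?G * ?Y * ?H" using kIJ len by (simp add: conj_tuple_nth)
      ultimately have "commutator_col ds ?X v (k, I, J) = (?G * Z * ?H) $$ (I, J)" by simp
      also have "\<dots> = (\<Sum>R<?N. (\<Sum>P<?N. ?G $$ (I, P) * Z $$ (P, R)) * ?H $$ (R, J))"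
        unfolding mult_index[OF square_mult_carrier[OF tG(3) Zc] tG(4) kIJ(2,3)]
        using mult_index[OF tG(3) Zc kIJ(2)] by (intro sum.cong refl) simp
      also have "\<dots> = (\<Sum>P<?N. \<Sum>R<?N. ?G $$ (I, P) * Z $$ (P, R) * ?H $$ (R, J))"
        unfolding sum_distrib_right by (rule sum.swap)
      also have "\<dots> = (\<Sum>P<?N. \<Sum>R<?N. \<Sum>u\<in>T. c v u * (?G $$ (I, P) * commutator_col ds Y u (k, P, R) * ?H $$ (R, J)))"
      proof (intro sum.cong refl)
        fix P R assume "P \<in> {..<?N}" "R \<in> {..<?N}"
        then have PR: "P < ?N" "R < ?N" by auto
        have "Z $$ (P, R) = (\<Sum>v'\<in>entries ds. a v v' * commutator_col ds Y v' (k, P, R))"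
          unfolding Z_def by (rule commutator_col_lie[OF Y kIJ(1) PR, symmetric])
        also have "\<dots> = (\<Sum>v'\<in>entries ds. \<Sum>u\<in>T. a v v' * b v' u * commutator_col ds Y u (k, P, R))"
          using b by (intro sum.cong) (auto simp: sum_distrib_left mult.assoc)
        also have "\<dots> = (\<Sum>u\<in>T. c v u * commutator_col ds Y u (k, P, R))"
          by (subst sum.swap) (simp add: c_def sum_distrib_right)
        finally show "?G $$ (I, P) * Z $$ (P, R) * ?H $$ (R, J)
          = (\<Sum>u\<in>T. c v u * (?G $$ (I, P) * commutator_col ds Y u (k, P, R) * ?H $$ (R, J)))"
          by (simp add: sum_distrib_left sum_distrib_right mult_ac)
      qed
      also have "\<dots> = (\<Sum>P<?N. \<Sum>u\<in>T. \<Sum>R<?N. c v u * (?G $$ (I, P) * commutator_col ds Y u (k, P, R) * ?H $$ (R, J)))"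
        by (intro sum.cong refl sum.swap)
      also have "\<dots> = (\<Sum>u\<in>T. \<Sum>P<?N. \<Sum>R<?N. c v u * (?G $$ (I, P) * commutator_col ds Y u (k, P, R) * ?H $$ (R, J)))"
        by (rule sum.swap)
      also have "\<dots> = (\<Sum>u\<in>T. c v u * t u (k, I, J))"
        using True by (simp add: t_def sum_distrib_left)
      finally show ?thesis unfolding w .
    qed
  qed
  from indep_card_le[OF fin S(2) this] T
  show "\<exists>S'\<subseteq>entries ds. indep (commutator_col ds Y) S' \<and> card S \<le> card S'" by blast
qed

text \<open>
  Closure under sums and products is all that determinants, matrix products and tensor products need.
  The lemmas serve three algebras of functions: the polynomials on tuples of matrices, and on
  the group the polynomials and the polynomials divided by powers of the determinants.
\<close>

definition function_algebra :: "('x \<Rightarrow> complex) set \<Rightarrow> bool" where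
  "function_algebra F \<longleftrightarrow> (\<forall>c. (\<lambda>_. c) \<in> F) \<and>
     (\<forall>p\<in>F. \<forall>q\<in>F. (\<lambda>x. p x + q x) \<in> F \<and> (\<lambda>x. p x * q x) \<in> F)"

context
  fixes F :: "('x \<Rightarrow> complex) set"
  assumes alg: "function_algebra F"
begin

lemma fa_const: "(\<lambda>_. c) \<in> F"
  and fa_add: "p \<in> F \<Longrightarrow> q \<in> F \<Longrightarrow> (\<lambda>x. p x + q x) \<in> F"
  and fa_mult: "p \<in> F \<Longrightarrow> q \<in> F \<Longrightarrow> (\<lambda>x. p x * q x) \<in> F"
  using alg by (simp_all add: function_algebra_def)

lemma fa_sum: "(\<And>i. i \<in> S \<Longrightarrow> f i \<in> F) \<Longrightarrow> (\<lambda>x. \<Sum>i\<in>S. f i x) \<in> F"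
  by (induction S rule: infinite_finite_induct) (auto intro: fa_const fa_add)

lemma fa_prod: "(\<And>i. i \<in> S \<Longrightarrow> f i \<in> F) \<Longrightarrow> (\<lambda>x. \<Prod>i\<in>S. f i x) \<in> F"
  by (induction S rule: infinite_finite_induct) (auto intro: fa_const fa_mult)

lemma fa_diff: "p \<in> F \<Longrightarrow> q \<in> F \<Longrightarrow> (\<lambda>x. p x - q x) \<in> F"
  using fa_add[of p "\<lambda>x. -1 * q x"] fa_mult[OF fa_const, of q "-1"] by simp

lemma fa_det:
  assumes A: "\<And>x. A x \<in> carrier_mat q q"
    and F: "\<And>i j. i < q \<Longrightarrow> j < q \<Longrightarrow> (\<lambda>x. A x $$ (i, j)) \<in> F"
  shows "(\<lambda>x. det (A x)) \<in> F"
  unfolding det_def'[OF A]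
proof (intro fa_sum fa_mult fa_const fa_prod)
  fix p i assume "p \<in> {p. p permutes {0..<q}}" "i \<in> {0..<q}"
  then have "i < q" "p i < q" using permutes_in_image[of p "{0..<q}" i] by auto
  then show "(\<lambda>x. A x $$ (i, p i)) \<in> F" by (rule F)
qed

lemma fa_mat_mult:
  assumes c: "\<And>x. A x \<in> carrier_mat d d" "\<And>x. B x \<in> carrier_mat d d"
    and F: "\<And>i j. i < d \<Longrightarrow> j < d \<Longrightarrow> (\<lambda>x. A x $$ (i, j)) \<in> F"
      "\<And>i j. i < d \<Longrightarrow> j < d \<Longrightarrow> (\<lambda>x. B x $$ (i, j)) \<in> F"
    and ij: "i < d" "j < d"
  shows "(\<lambda>x. (A x * B x) $$ (i, j)) \<in> F"
  unfolding mult_index[OF c ij] using F ij by (intro fa_sum fa_mult) auto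

lemma fa_tens:
  assumes "\<And>x. square_family ds (A x)"
    and "\<And>s i j. s < length ds \<Longrightarrow> i < ds ! s \<Longrightarrow> j < ds ! s \<Longrightarrow> (\<lambda>x. A x s $$ (i, j)) \<in> F"
    and "I < prod_list ds" "J < prod_list ds"
  shows "(\<lambda>x. tens ds (A x) $$ (I, J)) \<in> F"
  using assms
proof (induction ds arbitrary: A I J)
  case (Cons d ds)
  have IJ: "I < d * prod_list ds" "J < d * prod_list ds" using Cons.prems by auto
  note k = kron_indices[OF IJ(1)] kron_indices[OF IJ(2)]
  have A: "\<And>x. A x 0 \<in> carrier_mat d d" "\<And>x. square_family ds (\<lambda>s. A x (Suc s))"
    using Cons.prems(1) by (auto simp: square_family_Cons)
  show ?case
    unfolding tens_Cons kron_index[OF A(1) tens_carrier[OF A(2)] IJ]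
  proof (rule fa_mult)
    show "(\<lambda>x. A x 0 $$ (I div prod_list ds, J div prod_list ds)) \<in> F"
      using Cons.prems(2)[of 0] k by simp
    show "(\<lambda>x. tens ds (\<lambda>s. A x (Suc s)) $$ (I mod prod_list ds, J mod prod_list ds)) \<in> F"
      using Cons.prems(2)[of "Suc s" for s] k A(2) by (intro Cons.IH) auto
  qed
qed (auto simp: tens_Nil intro: fa_const)

end

lemma function_algebra_poly_funs: "function_algebra (poly_funs N m)"
  by (auto simp: function_algebra_def intro: poly_funs.intros)

definition in_zariski_closure :: "nat \<Rightarrow> nat \<Rightarrow> complex mat list set \<Rightarrow> complex mat list \<Rightarrow> bool" where
  "in_zariski_closure N m S X \<longleftrightarrow> (\<forall>p\<in>poly_funs N m. (\<forall>Y\<in>S. p Y = 0) \<longrightarrow> p X = 0)"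

lemma in_zariski_closureD:
  "in_zariski_closure N m S X \<Longrightarrow> p \<in> poly_funs N m \<Longrightarrow> (\<And>Y. Y \<in> S \<Longrightarrow> p Y = 0) \<Longrightarrow> p X = 0"
  unfolding in_zariski_closure_def by blast

text \<open>
  Fix columns that are independent at \<open>X\<close> and take their inner products with the columns at a variable
  point \<open>Y\<close>.  The determinant is a polynomial in \<open>Y\<close>, because conjugation is applied to the constants
  at \<open>X\<close> only.  At \<open>Y = X\<close> it is a Gram determinant and not zero, so it is not zero somewhere
  on the orbit.
\<close>

lemma rank_semicontinuous:
  assumes X: "X \<in> mat_tuples (prod_list ds) m" and Orb: "Orb \<subseteq> mat_tuples (prod_list ds) m"
    and closure: "in_zariski_closure (prod_list ds) m Orb X"
    and S: "S \<subseteq> entries ds" "indep (commutator_col ds X) S"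
  shows "\<exists>Y\<in>Orb. indep (commutator_col ds Y) S"
proof -
  let ?N = "prod_list ds"
  define W where "W = {..<m} \<times> {..<?N} \<times> {..<?N}"
  have fin: "finite S" "finite W" using finite_subset[OF S(1)] by (simp_all add: W_def)
  obtain e where e: "bij_betw e {0..<card S} S" using ex_bij_betw_nat_finite[OF fin(1)] by blast
  define q where "q = card S"
  have e': "bij_betw e {0..<q} S" using e q_def by simp
  have col0: "commutator_col ds Y v w = 0" if "w \<notin> W" "length Y = m" for Y v w
    using that by (cases w) (auto simp: commutator_col_def W_def)
  define G where "G Y = mat q q (\<lambda>(i, j). \<Sum>w\<in>W. cnj (commutator_col ds X (e i) w) * commutator_col ds Y (e j) w)" for Y
  have comb: "(\<Sum>v\<in>S. a v * f v) = (\<Sum>j<q. a (e j) * f (e j))" for a f :: "_ \<Rightarrow> complex"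
    using sum.reindex_bij_betw[OF e', of "\<lambda>v. a v * f v"] by (simp add: atLeast0LessThan)
  have GX: "det (G X) \<noteq> 0"
  proof
    assume "det (G X) = 0"
    then obtain x where x: "x \<in> carrier_vec q" "x \<noteq> 0\<^sub>v q" "G X *\<^sub>v x = 0\<^sub>v q"
      using det_0_iff_vec_prod_zero[of "G X" q] by (auto simp: G_def)
    define z where "z w = (\<Sum>j<q. x $ j * commutator_col ds X (e j) w)" for w
    have Gx: "(\<Sum>w\<in>W. cnj (commutator_col ds X (e i) w) * z w) = 0" if i: "i < q" for i
    proof -
      have "0 = (G X *\<^sub>v x) $ i" using x i by simp
      also have "\<dots> = (\<Sum>j<q. (\<Sum>w\<in>W. cnj (commutator_col ds X (e i) w) * commutator_col ds X (e j) w) * x $ j)"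
        using i x(1) by (auto simp: G_def scalar_prod_def atLeast0LessThan intro!: sum.cong)
      also have "\<dots> = (\<Sum>w\<in>W. cnj (commutator_col ds X (e i) w) * z w)"
        unfolding sum_distrib_right z_def sum_distrib_left by (subst sum.swap) (simp add: mult_ac)
      finally show ?thesis by simp
    qed
    have "(\<Sum>w\<in>W. cnj (z w) * z w) = (\<Sum>i<q. cnj (x $ i) * (\<Sum>w\<in>W. cnj (commutator_col ds X (e i) w) * z w))"
    proof -
      have "cnj (z w) = (\<Sum>i<q. cnj (x $ i) * cnj (commutator_col ds X (e i) w))" for w
        by (simp add: z_def)
      then have "(\<Sum>w\<in>W. cnj (z w) * z w)
          = (\<Sum>w\<in>W. \<Sum>i<q. cnj (x $ i) * (cnj (commutator_col ds X (e i) w) * z w))"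
        by (simp only: sum_distrib_right mult.assoc)
      also have "\<dots> = (\<Sum>i<q. \<Sum>w\<in>W. cnj (x $ i) * (cnj (commutator_col ds X (e i) w) * z w))"
        by (rule sum.swap)
      finally show ?thesis by (simp only: sum_distrib_left)
    qed
    also have "\<dots> = 0" using Gx by simp
    finally have "complex_of_real (\<Sum>w\<in>W. (cmod (z w))\<^sup>2) = 0"
      by (simp add: complex_norm_square[unfolded of_real_power] mult.commute)
    then have "(\<Sum>w\<in>W. (cmod (z w))\<^sup>2) = 0" by (simp only: of_real_eq_0_iff)
    then have zW: "\<forall>w\<in>W. z w = 0" using fin by (simp add: sum_nonneg_eq_0_iff)
    \<comment> \<open>A kernel vector of the Gram matrix is a relation, since the combination is orthogonal to itself.\<close>
    have z0: "z w = 0" for w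
      using zW col0[of w X] X by (cases "w \<in> W") (auto simp: z_def mat_tuples_def)
    define a where "a v = x $ (inv_into {0..<q} e v)" for v
    have ae: "a (e j) = x $ j" if "j < q" for j
      unfolding a_def using e' that by (simp add: bij_betw_inv_into_left)
    have "(\<Sum>v\<in>S. a v * commutator_col ds X v w) = 0" for w
      using z0[of w] ae unfolding comb z_def by simp
    from indepD[OF S(2) this] have "\<forall>v\<in>S. a v = 0" by blast
    then have "\<forall>j<q. x $ j = 0" using ae e' by (metis atLeast0LessThan bij_betwE lessThan_iff)
    then show False using x by (auto simp: vec_eq_iff)
  qed
  define p where "p Y = det (mat q q (\<lambda>(i, j). \<Sum>w\<in>W. cnj (commutator_col ds X (e i) w) *
    (case w of (k, I, J) \<Rightarrow> \<Sum>P<?N. lie_unit ds (e j) $$ (I, P) * (Y ! k) $$ (P, J) -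
      (Y ! k) $$ (I, P) * lie_unit ds (e j) $$ (P, J))))" for Y
  have pG: "p Y = det (G Y)" if "Y \<in> mat_tuples ?N m" for Y
  proof -
    have "commutator_col ds Y v w = (case w of (k, I, J) \<Rightarrow> \<Sum>P<?N. lie_unit ds v $$ (I, P) * (Y ! k) $$ (P, J) -
      (Y ! k) $$ (I, P) * lie_unit ds v $$ (P, J))" if "w \<in> W" for v w
      using that \<open>Y \<in> _\<close> by (auto simp: commutator_col_def W_def mat_tuples_def)
    then show ?thesis unfolding p_def G_def by (intro arg_cong[where f = det] cong_mat refl) simp
  qed
  have "p \<in> poly_funs ?N m"
    unfolding p_def
  proof (rule fa_det[OF function_algebra_poly_funs])
    fix i j assume ij: "i < q" "j < q"
    have t: "(\<lambda>Y. case w of (k, I, J) \<Rightarrow> \<Sum>P<?N. lie_unit ds (e j) $$ (I, P) * (Y ! k) $$ (P, J) -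
      (Y ! k) $$ (I, P) * lie_unit ds (e j) $$ (P, J)) \<in> poly_funs ?N m" if wW: "w \<in> W" for w
    proof -
      obtain k I J where w: "w = (k, I, J)" "k < m" "I < ?N" "J < ?N" using wW by (auto simp: W_def)
      then show ?thesis
        unfolding w(1) prod.case
        by (intro fa_sum[OF function_algebra_poly_funs] fa_diff[OF function_algebra_poly_funs]
            poly_funs.mult poly_funs.const poly_funs.coord) auto
    qed
    show "(\<lambda>Y. mat q q (\<lambda>(i, j). \<Sum>w\<in>W. cnj (commutator_col ds X (e i) w) *
        (case w of (k, I, J) \<Rightarrow> \<Sum>P<?N. lie_unit ds (e j) $$ (I, P) * (Y ! k) $$ (P, J) -
          (Y ! k) $$ (I, P) * lie_unit ds (e j) $$ (P, J))) $$ (i, j)) \<in> poly_funs ?N m"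
      unfolding index_mat(1)[OF ij] prod.case[of _ i j]
      by (intro fa_sum[OF function_algebra_poly_funs] poly_funs.mult poly_funs.const t)
  qed simp
  then obtain Y where Y: "Y \<in> Orb" "p Y \<noteq> 0"
    using in_zariski_closureD[OF closure, of p] pG[OF X] GX by auto
  then have dG: "det (G Y) \<noteq> 0" using pG Orb by auto
  have "indep (commutator_col ds Y) S" unfolding indep_def
  proof (intro allI impI)
    fix a assume a: "\<forall>w. (\<Sum>v\<in>S. a v * commutator_col ds Y v w) = 0"
    define x where "x = vec q (\<lambda>j. a (e j))"
    have "G Y *\<^sub>v x = 0\<^sub>v q"
    proof (rule eq_vecI)
      fix i assume "i < dim_vec (0\<^sub>v q :: complex vec)"
      then have i: "i < q" by simp
      have "(G Y *\<^sub>v x) $ i = (\<Sum>j<q. (\<Sum>w\<in>W. cnj (commutator_col ds X (e i) w) * commutator_col ds Y (e j) w) * a (e j))"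
        using i by (auto simp: G_def x_def scalar_prod_def atLeast0LessThan intro!: sum.cong)
      also have "\<dots> = (\<Sum>w\<in>W. cnj (commutator_col ds X (e i) w) * (\<Sum>j<q. a (e j) * commutator_col ds Y (e j) w))"
        unfolding sum_distrib_right sum_distrib_left by (subst sum.swap) (simp add: mult_ac)
      also have "\<dots> = 0"
        using a unfolding comb by (simp only: mult_zero_right sum.neutral_const)
      finally show "(G Y *\<^sub>v x) $ i = 0\<^sub>v q $ i" using i by simp
    qed (auto simp: G_def)
    then have "x = 0\<^sub>v q"
    proof -
      have "G Y \<in> carrier_mat q q" "x \<in> carrier_vec q" by (simp_all add: G_def x_def)
      then show ?thesis using \<open>G Y *\<^sub>v x = 0\<^sub>v q\<close> dG det_0_iff_vec_prod_zero[of "G Y" q] by blast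
    qed
    then have "a (e j) = 0" if "j < q" for j using that by (metis index_vec index_zero_vec(1) x_def)
    then show "\<forall>v\<in>S. a v = 0" using e' by (metis atLeast0LessThan bij_betw_imp_surj_on imageE lessThan_iff)
  qed
  then show ?thesis using Y by blast
qed

section \<open>A place at a point of the closure of an orbit\<close>

text \<open>
  Functions of the coordinates in \<open>I\<close> that are polynomial in each coordinate when the others are
  fixed.  This is weaker in form than being a polynomial, and enough to choose coordinates one by one.
\<close>

definition separately_poly :: "'i set \<Rightarrow> (('i \<Rightarrow> complex) \<Rightarrow> complex) set" where
  "separately_poly I = {f. (\<forall>v i. \<exists>q. \<forall>t. f (v(i := t)) = poly q t) \<and>
     (\<forall>v v'. (\<forall>i\<in>I. v i = v' i) \<longrightarrow> f v = f v')}"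

lemma function_algebra_separately_poly: "function_algebra (separately_poly I)"
proof -
  have "(\<lambda>_. c) \<in> separately_poly I" for c
    by (auto simp: separately_poly_def intro!: exI[of _ "[:c:]"])
  moreover have "(\<lambda>x. p x + q x) \<in> separately_poly I" "(\<lambda>x. p x * q x) \<in> separately_poly I"
    if p: "p \<in> separately_poly I" and q: "q \<in> separately_poly I" for p q
  proof -
    have *: "\<exists>r. \<forall>t. p (v(i := t)) + q (v(i := t)) = poly r t" "\<exists>r. \<forall>t. p (v(i := t)) * q (v(i := t)) = poly r t" for v i
    proof -
      obtain r r' where "\<forall>t. p (v(i := t)) = poly r t" "\<forall>t. q (v(i := t)) = poly r' t"
        using p q unfolding separately_poly_def by blast
      then show "\<exists>r. \<forall>t. p (v(i := t)) + q (v(i := t)) = poly r t" "\<exists>r. \<forall>t. p (v(i := t)) * q (v(i := t)) = poly r t"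
        by (intro exI[of _ "r + r'"] exI[of _ "r * r'"]; simp)+
    qed
    have "p v = p v'" "q v = q v'" if "\<forall>i\<in>I. v i = v' i" for v v'
      using p q that unfolding separately_poly_def by blast+
    then have "p v + q v = p v' + q v' \<and> p v * q v = p v' * q v'" if "\<forall>i\<in>I. v i = v' i" for v v'
      using that by metis
    then show "(\<lambda>x. p x + q x) \<in> separately_poly I" "(\<lambda>x. p x * q x) \<in> separately_poly I"
      using * unfolding separately_poly_def by auto
  qed
  ultimately show ?thesis by (simp add: function_algebra_def)
qed

lemma separately_poly_coord: "i \<in> I \<Longrightarrow> (\<lambda>v. v i) \<in> separately_poly I"
proof -
  assume "i \<in> I"
  moreover have "\<exists>q. \<forall>t. (v(j := t)) i = poly q t" for v :: "_ \<Rightarrow> complex" and j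
  proof (cases "i = j")
    case True
    then show ?thesis by (intro exI[of _ "[:0, 1:]"]) simp
  next
    case False
    then show ?thesis by (intro exI[of _ "[:v i:]"]) simp
  qed
  ultimately show ?thesis by (auto simp: separately_poly_def simp del: fun_upd_apply)
qed

lemma uncountable_complex: "\<not> countable (UNIV :: complex set)"
proof
  assume "countable (UNIV :: complex set)"
  then have "countable (range (of_real :: real \<Rightarrow> complex))" by (rule countable_subset[rotated]) simp
  then have "countable (UNIV :: real set)" by (rule countable_image_inj_on) (simp add: inj_on_def)
  then show False using uncountable_UNIV_real by blast
qed

text \<open>
  The coordinates are chosen one after the other.  Each of the countably many functions excludes finitely
  many values of the next coordinate, and \<open>\<complex>\<close> is uncountable.
\<close>

theorem generic_point:
  assumes I: "finite I" and F: "countable F" "F \<subseteq> separately_poly I" and nz: "\<And>f. f \<in> F \<Longrightarrow> \<exists>v. f v \<noteq> 0"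
  shows "\<exists>v. \<forall>f\<in>F. f v \<noteq> 0"
proof -
  have "\<exists>w. \<forall>f\<in>F. \<exists>v. (\<forall>i\<in>J. v i = w i) \<and> f v \<noteq> 0" if "finite J" for J
    using that
  proof (induction J rule: finite_induct)
    case empty
    then show ?case using nz by auto
  next
    case (insert i J)
    then obtain w where w: "\<forall>f\<in>F. \<exists>v. (\<forall>i\<in>J. v i = w i) \<and> f v \<noteq> 0" by blast
    from bchoice[OF w] obtain V where V: "\<And>f j. f \<in> F \<Longrightarrow> j \<in> J \<Longrightarrow> V f j = w j" "\<And>f. f \<in> F \<Longrightarrow> f (V f) \<noteq> 0" by blast
    have "\<forall>f\<in>F. \<exists>q. \<forall>t. f ((V f)(i := t)) = poly q t" using F(2) unfolding separately_poly_def by blast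
    from bchoice[OF this] obtain q where q: "\<And>f t. f \<in> F \<Longrightarrow> f ((V f)(i := t)) = poly (q f) t" by blast
    have "q f \<noteq> 0" if "f \<in> F" for f
    proof
      assume "q f = 0"
      then have "f ((V f)(i := V f i)) = 0" using q[OF that, of "V f i"] by simp
      then show False using V(2)[OF that] by simp
    qed
    then have "countable {t. poly (q f) t = 0}" if "f \<in> F" for f
      using that by (intro countable_finite poly_roots_finite)
    then have "countable (\<Union>f\<in>F. {t. poly (q f) t = 0})"
      using F(1) by (rule countable_UN[rotated])
    then obtain t where t: "t \<notin> (\<Union>f\<in>F. {t. poly (q f) t = 0})"
      using uncountable_complex by (metis UNIV_eq_I)
    have "\<exists>v. (\<forall>j\<in>insert i J. v j = (w(i := t)) j) \<and> f v \<noteq> 0" if f: "f \<in> F" for f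
      using V(1)[OF f] t q[OF f, of t] f insert(2) by (intro exI[of _ "(V f)(i := t)"]) auto
    then show ?case by blast
  qed
  from this[OF I] obtain w where w: "\<And>f. f \<in> F \<Longrightarrow> \<exists>v. (\<forall>i\<in>I. v i = w i) \<and> f v \<noteq> 0" by blast
  have "f w \<noteq> 0" if f: "f \<in> F" for f
  proof -
    obtain v where "\<forall>i\<in>I. v i = w i" "f v \<noteq> 0" using w[OF f] by blast
    moreover have "f \<in> separately_poly I" using f F by blast
    ultimately have "f v = f w" unfolding separately_poly_def by blast
    then show ?thesis using \<open>f v \<noteq> 0\<close> by simp
  qed
  then show ?thesis by blast
qed

text \<open>
  The localisation of the polynomial functions at \<open>\<Delta>\<close>, as functions on the set where \<open>\<Delta>\<close> does not
  vanish.
\<close>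

definition with_denominator :: "'i set \<Rightarrow> (('i \<Rightarrow> complex) \<Rightarrow> complex) \<Rightarrow> (('i \<Rightarrow> complex) \<Rightarrow> complex) set" where
  "with_denominator I \<Delta> = {f. \<exists>p\<in>separately_poly I. \<exists>e. \<forall>v. \<Delta> v \<noteq> 0 \<longrightarrow> f v * \<Delta> v ^ e = p v}"

lemma with_denominatorI:
  "p \<in> separately_poly I \<Longrightarrow> (\<And>v. \<Delta> v \<noteq> 0 \<Longrightarrow> f v * \<Delta> v ^ e = p v) \<Longrightarrow> f \<in> with_denominator I \<Delta>"
  unfolding with_denominator_def by blast

lemma function_algebra_with_denominator:
  assumes \<Delta>: "\<Delta> \<in> separately_poly I"
  shows "function_algebra (with_denominator I \<Delta>)"
proof -
  note alg = function_algebra_separately_poly[of I]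
  have pow: "(\<lambda>v. \<Delta> v ^ e) \<in> separately_poly I" for e
    by (induction e) (auto intro: fa_const[OF alg] fa_mult[OF alg] \<Delta>)
  have "(\<lambda>_. c) \<in> with_denominator I \<Delta>" for c
    by (rule with_denominatorI[of "\<lambda>_. c" _ _ _ 0]) (auto intro: fa_const[OF alg])
  moreover have "(\<lambda>x. f x + g x) \<in> with_denominator I \<Delta>" "(\<lambda>x. f x * g x) \<in> with_denominator I \<Delta>"
    if f: "f \<in> with_denominator I \<Delta>" and g: "g \<in> with_denominator I \<Delta>" for f g
  proof -
    obtain p e where p: "p \<in> separately_poly I" "\<And>v. \<Delta> v \<noteq> 0 \<Longrightarrow> f v * \<Delta> v ^ e = p v"
      using f unfolding with_denominator_def by blast
    obtain q e' where q: "q \<in> separately_poly I" "\<And>v. \<Delta> v \<noteq> 0 \<Longrightarrow> g v * \<Delta> v ^ e' = q v"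
      using g unfolding with_denominator_def by blast
    show "(\<lambda>x. f x + g x) \<in> with_denominator I \<Delta>"
    proof (rule with_denominatorI[of "\<lambda>v. p v * \<Delta> v ^ e' + q v * \<Delta> v ^ e" _ _ _ "e + e'"])
      show "(\<lambda>v. p v * \<Delta> v ^ e' + q v * \<Delta> v ^ e) \<in> separately_poly I"
        by (intro fa_add[OF alg] fa_mult[OF alg] pow p q)
      show "(f v + g v) * \<Delta> v ^ (e + e') = p v * \<Delta> v ^ e' + q v * \<Delta> v ^ e" if "\<Delta> v \<noteq> 0" for v
        unfolding p(2)[OF that, symmetric] q(2)[OF that, symmetric] by (simp add: power_add algebra_simps)
    qed
    show "(\<lambda>x. f x * g x) \<in> with_denominator I \<Delta>"
    proof (rule with_denominatorI[of "\<lambda>v. p v * q v" _ _ _ "e + e'"])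
      show "(\<lambda>v. p v * q v) \<in> separately_poly I" by (intro fa_mult[OF alg] p q)
      show "(f v * g v) * \<Delta> v ^ (e + e') = p v * q v" if "\<Delta> v \<noteq> 0" for v
        unfolding p(2)[OF that, symmetric] q(2)[OF that, symmetric] by (simp add: power_add algebra_simps)
    qed
  qed
  ultimately show ?thesis by (simp add: function_algebra_def)
qed

definition det_prod :: "nat list \<Rightarrow> (nat \<times> nat \<times> nat \<Rightarrow> complex) \<Rightarrow> complex" where
  "det_prod ds v = (\<Prod>s<length ds. det (fam ds v s))"

definition inverse_fam :: "nat list \<Rightarrow> (nat \<times> nat \<times> nat \<Rightarrow> complex) \<Rightarrow> nat \<Rightarrow> complex mat" where
  "inverse_fam ds v s = inverse (det (fam ds v s)) \<cdot>\<^sub>m adj_mat (fam ds v s)"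

lemma inverse_fam_square [simp]: "square_family ds (inverse_fam ds v)"
  using adj_mat(1)[OF fam_carrier] by (simp add: square_family_def inverse_fam_def)

lemma inverse_families_fam:
  assumes "det_prod ds v \<noteq> 0"
  shows "inverse_families ds (fam ds v) (inverse_fam ds v)"
proof -
  have "fam ds v s * inverse_fam ds v s = 1\<^sub>m (ds ! s) \<and> inverse_fam ds v s * fam ds v s = 1\<^sub>m (ds ! s)"
    if "s < length ds" for s
  proof -
    have d: "det (fam ds v s) \<noteq> 0" using assms that by (simp add: det_prod_def)
    note a = adj_mat[OF fam_carrier[of ds v s]]
    have "inverse (det (fam ds v s)) \<cdot>\<^sub>m (det (fam ds v s) \<cdot>\<^sub>m 1\<^sub>m (ds ! s)) = (1\<^sub>m (ds ! s) :: complex mat)"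
      using d by (intro eq_matI) auto
    then show ?thesis
      unfolding inverse_fam_def using a
      by (simp add: mult_smult_distrib[OF fam_carrier a(1)] mult_smult_assoc_mat[OF a(1) fam_carrier])
  qed
  then show ?thesis by (simp add: inverse_families_def)
qed

lemma fam_entry_poly:
  "s < length ds \<Longrightarrow> i < ds ! s \<Longrightarrow> j < ds ! s \<Longrightarrow> (\<lambda>v. fam ds v s $$ (i, j)) \<in> separately_poly (entries ds)"
  by (simp add: fam_index entries_iff separately_poly_coord)

lemma det_fam_poly: "s < length ds \<Longrightarrow> (\<lambda>v. det (fam ds v s)) \<in> separately_poly (entries ds)"
  by (rule fa_det[OF function_algebra_separately_poly fam_carrier]) (rule fam_entry_poly)

lemma det_prod_poly: "det_prod ds \<in> separately_poly (entries ds)"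
  unfolding det_prod_def[abs_def] by (rule fa_prod[OF function_algebra_separately_poly]) (simp add: det_fam_poly)

lemma inverse_fam_entry:
  assumes s: "s < length ds" and ij: "i < ds ! s" "j < ds ! s"
  shows "(\<lambda>v. inverse_fam ds v s $$ (i, j)) \<in> with_denominator (entries ds) (det_prod ds)"
proof (rule with_denominatorI[where e = 1])
  note alg = function_algebra_separately_poly[of "entries ds"]
  let ?p = "\<lambda>v. (-1) ^ (j + i) * det (mat_delete (fam ds v s) j i) * (\<Prod>s'\<in>{..<length ds} - {s}. det (fam ds v s'))"
  have "(\<lambda>v. det (mat_delete (fam ds v s) j i)) \<in> separately_poly (entries ds)"
  proof (rule fa_det[OF alg])
    show "mat_delete (fam ds v s) j i \<in> carrier_mat (ds ! s - 1) (ds ! s - 1)" for v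
      by (rule mat_delete_carrier) simp
    show "(\<lambda>v. mat_delete (fam ds v s) j i $$ (i', j')) \<in> separately_poly (entries ds)"
      if "i' < ds ! s - 1" "j' < ds ! s - 1" for i' j'
    proof -
      have "(\<lambda>v. mat_delete (fam ds v s) j i $$ (i', j'))
          = (\<lambda>v. fam ds v s $$ (if i' < j then i' else Suc i', if j' < i then j' else Suc j'))"
        using that by (auto simp: mat_delete_def fam_def)
      then show ?thesis using that s by (auto intro!: fam_entry_poly)
    qed
  qed
  then show "?p \<in> separately_poly (entries ds)"
    by (intro fa_mult[OF alg] fa_const[OF alg] fa_prod[OF alg] det_fam_poly) auto
  show "inverse_fam ds v s $$ (i, j) * det_prod ds v ^ 1 = ?p v" if "det_prod ds v \<noteq> 0" for v
  proof -
    have "det_prod ds v = det (fam ds v s) * (\<Prod>s'\<in>{..<length ds} - {s}. det (fam ds v s'))"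
      unfolding det_prod_def using s by (subst prod.remove[of _ s]) auto
    moreover have "det (fam ds v s) \<noteq> 0" using that s by (simp add: det_prod_def)
    moreover have "inverse_fam ds v s $$ (i, j) = inverse (det (fam ds v s)) * ((-1) ^ (j + i) * det (mat_delete (fam ds v s) j i))"
      using ij carrier_matD[OF fam_carrier[of ds v s]] by (simp add: inverse_fam_def adj_mat_def cofactor_def)
    ultimately show ?thesis by simp
  qed
qed

text \<open>
  Integral polynomials in the entries of a variable tuple and of the tuple \<open>M\<close>, as a countable set of
  expressions.  Negation is multiplication with \<open>Minus_one\<close>, and \<open>0\<close> and \<open>1\<close> are sums and products.
\<close>

datatype coord_expr = X_entry nat nat nat | M_entry nat nat nat | Minus_one
  | Plus coord_expr coord_expr | Times coord_expr coord_expr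

instance coord_expr :: countable
  by countable_datatype

fun eval_expr :: "nat \<Rightarrow> nat \<Rightarrow> complex mat list \<Rightarrow> coord_expr \<Rightarrow> complex mat list \<Rightarrow> complex" where
  "eval_expr N m Ms (X_entry k i j) X = (if k < m \<and> i < N \<and> j < N then (X ! k) $$ (i, j) else 0)"
| "eval_expr N m Ms (M_entry k i j) X = (Ms ! k) $$ (i, j)"
| "eval_expr N m Ms Minus_one X = -1"
| "eval_expr N m Ms (Plus a b) X = eval_expr N m Ms a X + eval_expr N m Ms b X"
| "eval_expr N m Ms (Times a b) X = eval_expr N m Ms a X * eval_expr N m Ms b X"

lemma eval_expr_poly: "eval_expr N m Ms a \<in> poly_funs N m"
proof (induction a)
  case (X_entry k i j)
  show ?case
  proof (cases "k < m \<and> i < N \<and> j < N")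
    case True
    then show ?thesis by (simp add: eval_expr.simps[abs_def] poly_funs.coord)
  next
    case False
    then have "eval_expr N m Ms (X_entry k i j) = (\<lambda>_. 0)" by (intro ext) auto
    then show ?thesis by (simp add: poly_funs.const)
  qed
qed (simp_all add: eval_expr.simps[abs_def] poly_funs.intros)

definition conj_orbit :: "nat list \<Rightarrow> complex mat list \<Rightarrow> complex mat list set" where
  "conj_orbit ds Ms = {conj_tuple ds g h Ms | g h. inverse_families ds g h}"

text \<open>
  The graph of the homomorphism consists of the pairs of values of the expressions at \<open>g M\<close> and
  at \<open>X\<close>.  It is single-valued because an expression that vanishes at \<open>g M\<close>, for the generic \<open>g\<close>,
  vanishes on the orbit and therefore at \<open>X\<close>.
\<close>

theorem place_of_closure_point:
  assumes Ms: "Ms \<in> mat_tuples (prod_list ds) m"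
    and closure: "in_zariski_closure (prod_list ds) m (conj_orbit ds Ms) X"
    and X: "X \<in> mat_tuples (prod_list ds) m"
  obtains g h Q where "inverse_families ds g h" "place Q"
    "\<And>k. k < m \<Longrightarrow> mat_rel Q (prod_list ds) (conj_tuple ds g h Ms ! k) (X ! k)"
    "\<And>k. k < m \<Longrightarrow> mat_rel Q (prod_list ds) (Ms ! k) (Ms ! k)"
proof -
  let ?N = "prod_list ds" and ?\<Delta> = "det_prod ds"
  define Y where "Y v = conj_tuple ds (fam ds v) (inverse_fam ds v) Ms" for v
  define ev where "ev = eval_expr ?N m Ms"
  note alg = function_algebra_with_denominator[OF det_prod_poly[of ds]]
  have poly: "f \<in> with_denominator (entries ds) ?\<Delta>" if "f \<in> separately_poly (entries ds)" for f
    using that by (rule with_denominatorI[where e = 0]) simp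
  have len: "length Ms = m" "length X = m" using Ms X by (auto simp: mat_tuples_def)
  have evY: "(\<lambda>v. ev a (Y v)) \<in> with_denominator (entries ds) ?\<Delta>" for a
  proof (induction a)
    case (X_entry k i j)
    show ?case
    proof (cases "k < m \<and> i < ?N \<and> j < ?N")
      case True
      note Mk = mat_tuples_nth[OF Ms, of k]
      have "(\<lambda>v. (tens ds (fam ds v) * Ms ! k * tens ds (inverse_fam ds v)) $$ (i, j)) \<in> with_denominator (entries ds) ?\<Delta>"
      proof (intro fa_mat_mult[OF alg, of _ ?N])
        show "(\<lambda>v. tens ds (fam ds v) $$ (I, J)) \<in> with_denominator (entries ds) ?\<Delta>" if "I < ?N" "J < ?N" for I J
          using that by (intro fa_tens[OF alg] poly fam_entry_poly) auto
        show "(\<lambda>v. tens ds (inverse_fam ds v) $$ (I, J)) \<in> with_denominator (entries ds) ?\<Delta>" if "I < ?N" "J < ?N" for I J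
          using that by (intro fa_tens[OF alg] inverse_fam_entry) auto
      qed (use True Mk in \<open>auto intro: fa_const[OF alg]\<close>)
      then show ?thesis using True len by (simp add: ev_def Y_def conj_tuple_nth)
    next
      case False
      then show ?thesis using fa_const[OF alg, of 0] by (auto simp: ev_def)
    qed
  next
    case (Plus a b)
    then show ?case using fa_add[OF alg] by (simp add: ev_def)
  next
    case (Times a b)
    then show ?case using fa_mult[OF alg] by (simp add: ev_def)
  qed (use fa_const[OF alg] in \<open>simp_all add: ev_def\<close>)
  then have "\<forall>a. \<exists>p. p \<in> separately_poly (entries ds) \<and> (\<exists>e. \<forall>v. ?\<Delta> v \<noteq> 0 \<longrightarrow> ev a (Y v) * ?\<Delta> v ^ e = p v)"
    unfolding with_denominator_def by blast
  from choice[OF this] obtain p where p: "\<And>a. p a \<in> separately_poly (entries ds)"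
    and pe: "\<And>a. \<exists>e. \<forall>v. ?\<Delta> v \<noteq> 0 \<longrightarrow> ev a (Y v) * ?\<Delta> v ^ e = p a v" by blast
  have p0: "p a v = 0 \<longleftrightarrow> ev a (Y v) = 0" if "?\<Delta> v \<noteq> 0" for a v
    using pe[of a] that by (metis mult_eq_0_iff power_not_zero)
  define good where "good = {a. \<exists>v. ?\<Delta> v \<noteq> 0 \<and> ev a (Y v) \<noteq> 0}"
  define F where "F = insert ?\<Delta> ((\<lambda>a v. p a v * ?\<Delta> v) ` good)"
  have "\<exists>v. \<forall>f\<in>F. f v \<noteq> 0"
  proof (rule generic_point[OF finite_entries])
    show "countable F" unfolding F_def by simp
    show "F \<subseteq> separately_poly (entries ds)"
      unfolding F_def using p det_prod_poly fa_mult[OF function_algebra_separately_poly] by blast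
    fix f assume "f \<in> F"
    then consider "f = ?\<Delta>" | a where "a \<in> good" "f = (\<lambda>v. p a v * ?\<Delta> v)" unfolding F_def by blast
    then show "\<exists>v. f v \<noteq> 0"
    proof cases
      case 1
      have "fam ds (\<lambda>(s, i, j). if i = j then 1 else 0) s = 1\<^sub>m (ds ! s)" for s
        by (rule eq_matI) (auto simp: fam_def)
      then have "?\<Delta> (\<lambda>(s, i, j). if i = j then 1 else 0) = 1" by (simp add: det_prod_def)
      then show ?thesis using 1 by (metis zero_neq_one)
    next
      case (2 a)
      then show ?thesis unfolding good_def using p0 by auto
    qed
  qed
  then obtain v where v: "\<And>f. f \<in> F \<Longrightarrow> f v \<noteq> 0" by blast
  have \<Delta>v: "?\<Delta> v \<noteq> 0" using v by (simp add: F_def)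
  have generic: "ev a (Y v) \<noteq> 0" if "a \<in> good" for a
    using v[of "\<lambda>v. p a v * ?\<Delta> v"] that p0[OF \<Delta>v] by (auto simp: F_def)
  define Q0 where "Q0 = range (\<lambda>a. (ev a (Y v), ev a X))"
  have Q0I: "(ev a (Y v), ev a X) \<in> Q0" for a by (auto simp: Q0_def)
  have "partial_hom Q0"
  proof (rule partial_homI)
    show "(1, 1) \<in> Q0" using Q0I[of "Times Minus_one Minus_one"] by (simp add: ev_def)
  next
    fix x y assume "(x, y) \<in> Q0"
    then obtain a where "x = ev a (Y v)" "y = ev a X" by (auto simp: Q0_def)
    then show "(- x, - y) \<in> Q0" using Q0I[of "Times Minus_one a"] by (simp add: ev_def)
  next
    fix x y x' y' assume "(x, y) \<in> Q0" "(x', y') \<in> Q0"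
    then obtain a b where "x = ev a (Y v)" "y = ev a X" "x' = ev b (Y v)" "y' = ev b X" by (auto simp: Q0_def)
    then show "(x + x', y + y') \<in> Q0" "(x * x', y * y') \<in> Q0"
      using Q0I[of "Plus a b"] Q0I[of "Times a b"] by (simp_all add: ev_def)
  next
    fix y assume "(0, y) \<in> Q0"
    then obtain a where a: "ev a (Y v) = 0" "y = ev a X" by (auto simp: Q0_def)
    then have bad: "a \<notin> good" using generic by blast
    have "ev a X = 0"
    proof (rule in_zariski_closureD[OF closure])
      show "ev a \<in> poly_funs ?N m" unfolding ev_def by (rule eval_expr_poly)
      fix Z assume "Z \<in> conj_orbit ds Ms"
      then obtain g h where Z: "Z = conj_tuple ds g h Ms" and gh: "inverse_families ds g h"
        by (auto simp: conj_orbit_def)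
      define u where "u = (\<lambda>(s, i, j). g s $$ (i, j))"
      have gu: "fam ds u s = g s" if "s < length ds" for s
        unfolding u_def using gh that by (intro fam_of_entries) (auto simp: inverse_families_def)
      have c: "g s \<in> carrier_mat (ds ! s) (ds ! s)" "h s \<in> carrier_mat (ds ! s) (ds ! s)"
        "g s * h s = 1\<^sub>m (ds ! s)" "h s * g s = 1\<^sub>m (ds ! s)" if "s < length ds" for s
        using gh that by (auto simp: inverse_families_def square_family_def)
      have "det (g s) \<noteq> 0" if "s < length ds" for s
      proof
        assume "det (g s) = 0"
        then have "det (g s * h s) = 0" using det_mult[OF c(1,2)[OF that]] by simp
        then show False using c(3)[OF that] by simp
      qed
      then have \<Delta>u: "?\<Delta> u \<noteq> 0" using gu by (simp add: det_prod_def)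
      have hu: "inverse_fam ds u s = h s" if "s < length ds" for s
        using inverse_families_unique[OF gh inverse_families_cong[OF inverse_families_fam[OF \<Delta>u] gu] that] .
      have "Y u = Z" unfolding Y_def Z conj_tuple_def
        using gu hu tens_cong[of ds "fam ds u" g] tens_cong[of ds "inverse_fam ds u" h] by simp
      then show "ev a Z = 0" using bad \<Delta>u unfolding good_def by blast
    qed
    then show "y = 0" using a by simp
  qed
  then obtain Q where Q: "place Q" "Q0 \<subseteq> Q" by (rule place_extension)
  note inv = inverse_families_fam[OF \<Delta>v]
  have Ym: "Y v \<in> mat_tuples ?N m" unfolding Y_def by (rule conj_tuple_closed[OF inv Ms])
  show thesis
  proof (rule that[OF inv Q(1)])
    fix k assume k: "k < m"
    show "mat_rel Q ?N (conj_tuple ds (fam ds v) (inverse_fam ds v) Ms ! k) (X ! k)"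
      unfolding mat_rel_def Y_def[symmetric]
    proof (intro conjI allI impI)
      show "(Y v ! k $$ (i, j), X ! k $$ (i, j)) \<in> Q" if "i < ?N" "j < ?N" for i j
        using subsetD[OF Q(2) Q0I[of "X_entry k i j"]] k that by (simp add: ev_def)
    qed (rule mat_tuples_nth[OF Ym k] mat_tuples_nth[OF X k])+
    show "mat_rel Q ?N (Ms ! k) (Ms ! k)"
      unfolding mat_rel_def
    proof (intro conjI allI impI)
      show "(Ms ! k $$ (i, j), Ms ! k $$ (i, j)) \<in> Q" for i j
        using subsetD[OF Q(2) Q0I[of "M_entry k i j"]] by (simp add: ev_def)
    qed (rule mat_tuples_nth[OF Ms k])+
  qed
qed

section \<open>Degeneration to weight zero\<close>

lemma conj_tuple_cong:
  "(\<And>s. s < length ds \<Longrightarrow> g s = g' s) \<Longrightarrow> (\<And>s. s < length ds \<Longrightarrow> h s = h' s) \<Longrightarrow>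
    conj_tuple ds g h X = conj_tuple ds g' h' X"
  unfolding conj_tuple_def using tens_cong[of ds g g'] tens_cong[of ds h h'] by simp

lemma conj_orbit_closed:
  assumes "inverse_families ds g h" "Ms \<in> mat_tuples (prod_list ds) m" "Y \<in> conj_orbit ds Ms"
  shows "conj_tuple ds g h Y \<in> conj_orbit ds Ms"
  using assms conj_tuple_conj[OF assms(1) _ assms(2)] inverse_families_mult[OF assms(1)]
  unfolding conj_orbit_def by fastforce

lemma conj_orbit_tuples:
  assumes "Ms \<in> mat_tuples (prod_list ds) m"
  shows "conj_orbit ds Ms \<subseteq> mat_tuples (prod_list ds) m"
  using conj_tuple_closed[OF _ assms] unfolding conj_orbit_def by blast

lemma wt_uminus: "wt ds (\<lambda>s i. - l s i) I = - wt ds l I"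
  by (induction ds arbitrary: l I) simp_all

lemma supp_conj_tuple:
  assumes "cone C" "inverse_families ds g h" "X \<in> mat_tuples (prod_list ds) m" "k < m"
    "supp (prod_list ds) w C (tens ds g)" "supp (prod_list ds) w C (tens ds h)" "supp (prod_list ds) w C (X ! k)"
  shows "supp (prod_list ds) w C (conj_tuple ds g h X ! k)"
    and "part0 (prod_list ds) w (conj_tuple ds g h X ! k)
      = part0 (prod_list ds) w (tens ds g) * part0 (prod_list ds) w (X ! k) * part0 (prod_list ds) w (tens ds h)"
proof -
  interpret cone C by fact
  note t = tens_inverse(3,4)[OF assms(2)] and Xk = mat_tuples_nth[OF assms(3,4)]
  have "conj_tuple ds g h X ! k = tens ds g * X ! k * tens ds h"
    using assms(3,4) by (intro conj_tuple_nth) (simp add: mat_tuples_def)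
  then show "supp (prod_list ds) w C (conj_tuple ds g h X ! k)"
    "part0 (prod_list ds) w (conj_tuple ds g h X ! k)
      = part0 (prod_list ds) w (tens ds g) * part0 (prod_list ds) w (X ! k) * part0 (prod_list ds) w (tens ds h)"
    using t Xk assms(5-7) by (simp_all add: supp_mult part0_mult square_mult_assoc[of _ "prod_list ds"])
qed

lemma cone_uminus: "cone C \<Longrightarrow> cone (uminus ` C)"
proof -
  assume "cone C"
  then interpret cone C .
  show ?thesis
  proof
    show "0 \<in> uminus ` C" using zero by force
    show "c + c' \<in> uminus ` C" if "c \<in> uminus ` C" "c' \<in> uminus ` C" for c c'
    proof -
      obtain x y where "x \<in> C" "y \<in> C" "c = - x" "c' = - y" using \<open>c \<in> _\<close> \<open>c' \<in> _\<close> by blast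
      then show ?thesis using add[of x y] by (intro image_eqI[of _ _ "x + y"]) simp_all
    qed
    show "c = 0" if "c \<in> uminus ` C" "- c \<in> uminus ` C" for c
      using that pointed by auto
  qed
qed

text \<open>
  Let \<open>b = p k\<close> with \<open>p\<close> lower triangular and \<open>k\<close> unitary.  The weights are sorted, so \<open>p\<close> and
  its inverse have nonnegative weights, and with \<open>b M\<close> so has \<open>k M\<close>.  As \<open>k M\<close> is normal it has
  weight zero.  The part of weight zero of \<open>b M\<close> is therefore the conjugate of \<open>k M\<close> by the part of
  weight zero of \<open>p\<close>, which is again invertible.
\<close>

lemma normal_block_diagonal_in_orbit:
  fixes l :: "nat \<Rightarrow> nat \<Rightarrow> complex"
  assumes "cone C" and Ms: "Ms \<in> mat_tuples (prod_list ds) m"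
    and normal: "\<And>k. k < m \<Longrightarrow> Ms ! k * mat_adjoint (Ms ! k) = mat_adjoint (Ms ! k) * Ms ! k"
    and b: "inverse_families ds b b'"
    and sorted: "\<And>s i j. s < length ds \<Longrightarrow> i \<le> j \<Longrightarrow> j < ds ! s \<Longrightarrow> l s j - l s i \<in> C"
    and supp: "\<And>k. k < m \<Longrightarrow> supp (prod_list ds) (wt ds l) C (conj_tuple ds b b' Ms ! k)"
  shows "map (part0 (prod_list ds) (wt ds l)) (conj_tuple ds b b' Ms) \<in> conj_orbit ds Ms"
proof -
  interpret cone C by fact
  let ?N = "prod_list ds" and ?\<Lambda> = "wt ds l"
  define P where "P s p k \<longleftrightarrow> p \<in> carrier_mat (ds ! s) (ds ! s) \<and> k \<in> carrier_mat (ds ! s) (ds ! s) \<and>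
    b s = p * k \<and> (\<forall>i j. i < j \<longrightarrow> j < ds ! s \<longrightarrow> p $$ (i, j) = 0) \<and>
    k * mat_adjoint k = 1\<^sub>m (ds ! s) \<and> mat_adjoint k * k = 1\<^sub>m (ds ! s)" for s p k
  have "\<exists>p k. P s p k" if "s < length ds" for s
  proof -
    have "b s \<in> carrier_mat (ds ! s) (ds ! s)" "b' s \<in> carrier_mat (ds ! s) (ds ! s)" "b s * b' s = 1\<^sub>m (ds ! s)"
      using b that by (auto simp: inverse_families_def square_family_def)
    then obtain p k where "P s p k" unfolding P_def by (rule lower_triangular_unitary) blast
    then show ?thesis by blast
  qed
  from choose_families[of "length ds" P, OF this] obtain p k where pk: "\<forall>s<length ds. P s (p s) (k s)" by blast
  define k' where "k' s = mat_adjoint (k s)" for s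
  define p' where "p' s = k s * b' s" for s
  have pk': "p s \<in> carrier_mat (ds ! s) (ds ! s)" "k s \<in> carrier_mat (ds ! s) (ds ! s)" "b s = p s * k s"
    "\<And>i j. i < j \<Longrightarrow> j < ds ! s \<Longrightarrow> p s $$ (i, j) = 0" "k s * k' s = 1\<^sub>m (ds ! s)" "k' s * k s = 1\<^sub>m (ds ! s)"
    if "s < length ds" for s
    using pk that unfolding P_def k'_def by simp_all
  have bc: "b' s \<in> carrier_mat (ds ! s) (ds ! s)" "b s * b' s = 1\<^sub>m (ds ! s)" "b' s * b s = 1\<^sub>m (ds ! s)"
    if "s < length ds" for s using b that by (auto simp: inverse_families_def square_family_def)
  have p': "p' s \<in> carrier_mat (ds ! s) (ds ! s)" "p s * p' s = 1\<^sub>m (ds ! s)" "p' s * p s = 1\<^sub>m (ds ! s)"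
    if s: "s < length ds" for s
  proof -
    show c: "p' s \<in> carrier_mat (ds ! s) (ds ! s)" using pk'[OF s] bc[OF s] by (simp add: p'_def)
    have "p s * p' s = (p s * k s) * b' s"
      unfolding p'_def using pk'(1,2)[OF s] bc(1)[OF s] by (simp add: square_mult_assoc[of _ "ds ! s"])
    then show "p s * p' s = 1\<^sub>m (ds ! s)" using pk'(3)[OF s] bc(2)[OF s] by simp
    then show "p' s * p s = 1\<^sub>m (ds ! s)" using mat_mult_left_right_inverse[OF pk'(1)[OF s] c] by simp
  qed
  have invp: "inverse_families ds p p'" and invk: "inverse_families ds k k'"
    using p' pk' by (auto simp: inverse_families_def square_family_def k'_def)
  have sp: "supp (ds ! s) (l s) C (p s)" "supp (ds ! s) (l s) C (p' s)" if s: "s < length ds" for s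
  proof -
    have low: "p s $$ (i, j) = 0" "p' s $$ (i, j) = 0" if "i < j" "j < ds ! s" for i j
      using pk'(4)[OF s] inverse_lower_triangular[OF pk'(1)[OF s] p'(1,2)[OF s]] that by auto
    show "supp (ds ! s) (l s) C (p s)" "supp (ds ! s) (l s) C (p' s)"
      unfolding supp_def using low sorted[OF s] by (metis not_le_imp_less)+
  qed
  have sf: "square_family ds p" "square_family ds p'" using invp by (auto simp: inverse_families_def)
  have sT: "supp ?N ?\<Lambda> C (tens ds p)" "supp ?N ?\<Lambda> C (tens ds p')"
    using sp sf by (auto intro: supp_tens)
  define H where "H = conj_tuple ds k k' Ms"
  define M where "M = conj_tuple ds b b' Ms"
  have Hm: "H \<in> mat_tuples ?N m" unfolding H_def by (rule conj_tuple_closed[OF invk Ms])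
  have Mm: "M \<in> mat_tuples ?N m" unfolding M_def by (rule conj_tuple_closed[OF b Ms])
  \<comment> \<open>The triangular factor is removed from the other side: \<open>k = p' b\<close>.\<close>
  have HM: "H = conj_tuple ds p' p M"
  proof -
    have "conj_tuple ds p' p M = conj_tuple ds (\<lambda>s. p' s * b s) (\<lambda>s. b' s * p s) Ms"
      unfolding M_def by (rule conj_tuple_conj[OF inverse_families_sym[OF invp] b Ms])
    also have "\<dots> = H" unfolding H_def
    proof (rule conj_tuple_cong)
      fix s assume s: "s < length ds"
      have "p' s * b s = (p' s * p s) * k s"
        unfolding pk'(3)[OF s] using pk'(1,2)[OF s] p'(1)[OF s] by (simp add: square_mult_assoc[of _ "ds ! s"])
      then show 1: "p' s * b s = k s" using p'(3)[OF s] pk'(2)[OF s] by simp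
      have k'c: "k' s \<in> carrier_mat (ds ! s) (ds ! s)" using pk'(2)[OF s] by (simp add: k'_def)
      have "b' s * p s = b' s * p s * (k s * k' s)" using pk'[OF s] bc(1)[OF s] by simp
      also have "\<dots> = b' s * (p s * k s) * k' s"
        using pk'(1,2)[OF s] bc(1)[OF s] k'c by (simp add: square_mult_assoc[of _ "ds ! s"])
      finally show "b' s * p s = k' s" using pk'(3)[OF s] bc(3)[OF s] k'c by simp
    qed
    finally show ?thesis ..
  qed
  have H0: "part0 ?N ?\<Lambda> (H ! r) = H ! r" if r: "r < m" for r
  proof -
    have Hr: "H ! r \<in> carrier_mat ?N ?N" by (rule mat_tuples_nth[OF Hm r])
    have sH: "supp ?N ?\<Lambda> C (H ! r)"
      unfolding HM using supp[OF r] Mm sT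
      by (intro supp_conj_tuple(1)[OF \<open>cone C\<close> inverse_families_sym[OF invp] Mm r]) (auto simp: M_def)
    have sk: "square_family ds k" using invk by (simp add: inverse_families_def)
    have adj: "tens ds k' = mat_adjoint (tens ds k)"
      unfolding tens_adjoint[OF sk] k'_def ..
    have "H ! r = tens ds k * Ms ! r * mat_adjoint (tens ds k)"
      unfolding H_def adj[symmetric] using Ms r by (intro conj_tuple_nth) (simp add: mat_tuples_def)
    then have "H ! r * mat_adjoint (H ! r) = mat_adjoint (H ! r) * H ! r"
      using unitary_conj_normal[OF tens_inverse(3)[OF invk] _ mat_tuples_nth[OF Ms r] normal[OF r]]
        tens_inverse(2)[OF invk] unfolding adj by simp
    from normal_block_triangular[OF Hr this sH] show ?thesis
      using Hr by (intro eq_matI) (auto simp: part0_index)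
  qed
  define p0 where "p0 s = part0 (ds ! s) (l s) (p s)" for s
  define p0' where "p0' s = part0 (ds ! s) (l s) (p' s)" for s
  have inv0: "inverse_families ds p0 p0'"
    unfolding inverse_families_def
  proof (intro conjI allI impI)
    show "square_family ds p0" "square_family ds p0'" unfolding p0_def p0'_def by (rule square_family_part0)+
    fix s assume s: "s < length ds"
    show "p0 s * p0' s = 1\<^sub>m (ds ! s)" "p0' s * p0 s = 1\<^sub>m (ds ! s)"
      unfolding p0_def p0'_def part0_mult[OF pk'(1)[OF s] p'(1)[OF s] sp[OF s], symmetric]
        part0_mult[OF p'(1)[OF s] pk'(1)[OF s] sp(2,1)[OF s], symmetric] p'(2,3)[OF s] part0_one
      by (rule refl)+
  qed
  have pt: "part0 ?N ?\<Lambda> (tens ds p) = tens ds p0" "part0 ?N ?\<Lambda> (tens ds p') = tens ds p0'"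
    unfolding p0_def[abs_def] p0'_def[abs_def] using sf sp by (simp_all add: part0_tens)
  have "map (part0 ?N ?\<Lambda>) M = conj_tuple ds p0 p0' H"
  proof (rule nth_equalityI)
    have len: "length M = m" "length H = m" using Mm Hm by (auto simp: mat_tuples_def)
    then show "length (map (part0 ?N ?\<Lambda>) M) = length (conj_tuple ds p0 p0' H)" by (simp add: conj_tuple_def)
    fix r assume "r < length (map (part0 ?N ?\<Lambda>) M)"
    then have r: "r < m" using len by simp
    have MH: "M = conj_tuple ds p p' H" unfolding HM by (rule conj_tuple_inverse[OF inverse_families_sym[OF invp] Mm, symmetric])
    have sH: "supp ?N ?\<Lambda> C (H ! r)"
      unfolding HM using supp[OF r] Mm sT
      by (intro supp_conj_tuple(1)[OF \<open>cone C\<close> inverse_families_sym[OF invp] Mm r]) (auto simp: M_def)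
    have "part0 ?N ?\<Lambda> (M ! r) = part0 ?N ?\<Lambda> (tens ds p) * part0 ?N ?\<Lambda> (H ! r) * part0 ?N ?\<Lambda> (tens ds p')"
      unfolding MH by (rule supp_conj_tuple(2)[OF \<open>cone C\<close> invp Hm r sT sH])
    also have "\<dots> = tens ds p0 * H ! r * tens ds p0'"
      unfolding H0[OF r] pt ..
    finally show "map (part0 ?N ?\<Lambda>) M ! r = conj_tuple ds p0 p0' H ! r"
      using r len by (simp add: conj_tuple_nth)
  qed
  moreover have "H \<in> conj_orbit ds Ms" unfolding H_def conj_orbit_def using invk by blast
  ultimately show ?thesis
    using conj_orbit_closed[OF inv0 Ms] unfolding M_def by simp
qed

text \<open>
  \<open>kernel_lift\<close> applies to the map \<open>\<xi> \<mapsto> [\<xi>, X]\<close>, with the diagonal family \<open>l\<close> as the element of degree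
  zero: it commutes with the part of \<open>X\<close> of weight zero.  The lift \<open>\<xi>\<close> commutes with \<open>X\<close>, and after
  conjugation with the unipotent \<open>u\<close> it is diagonal.  What commutes with the diagonal matrix of the
  weights has weight zero.
\<close>

lemma conj_to_part0:
  fixes l :: "nat \<Rightarrow> nat \<Rightarrow> complex"
  assumes "cone C" and X: "X \<in> mat_tuples (prod_list ds) m"
    and W: "\<And>v w. v \<in> W \<Longrightarrow> w \<in> W \<Longrightarrow> v - w \<in> W" "\<And>w. w \<in> W \<Longrightarrow> w \<in> C \<or> - w \<in> C" "\<And>s i. l s i \<in> W"
    and sorted: "\<And>s i j. s < length ds \<Longrightarrow> i \<le> j \<Longrightarrow> j < ds ! s \<Longrightarrow> l s i - l s j \<in> C"
    and supp: "\<And>k. k < m \<Longrightarrow> supp (prod_list ds) (wt ds l) C (X ! k)"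
    and rank: "rank_le (entries ds) (commutator_col ds X)
      (commutator_col ds (map (part0 (prod_list ds) (wt ds l)) X))"
  obtains u u' where "inverse_families ds u u'"
    "conj_tuple ds u u' X = map (part0 (prod_list ds) (wt ds l)) X"
proof -
  interpret cone C by fact
  let ?N = "prod_list ds" and ?\<Lambda> = "wt ds l"
  define X0 where "X0 = map (part0 ?N ?\<Lambda>) X"
  have len: "length X = m" using X by (simp add: mat_tuples_def)
  have X0m: "X0 \<in> mat_tuples ?N m" unfolding X0_def mat_tuples_def using len by auto
  have X0k: "X0 ! k = part0 ?N ?\<Lambda> (X ! k)" if "k < m" for k using that len by (simp add: X0_def)
  define d where "d = (\<lambda>(s, i, j). l s i - l s j)"
  define e where "e = (\<lambda>(k::nat, I, J). ?\<Lambda> I - ?\<Lambda> J)"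
  define x where "x = (\<lambda>(s, i, j). if i = j then l s i else 0)"
  have dW: "d v \<in> W" for v using W by (cases v) (auto simp: d_def)
  have unit: "?\<Lambda> I - ?\<Lambda> J = d v" if "v \<in> entries ds" "I < ?N" "J < ?N" "lie_unit ds v $$ (I, J) \<noteq> 0" for v I J
  proof -
    obtain s i j where v: "v = (s, i, j)" by (cases v)
    have "supp ?N ?\<Lambda> {d v} (lie_unit ds v)"
      unfolding lie_unit_def by (rule lie_supp) (auto simp: supp_def fam_index v d_def split: if_splits)
    from suppD[OF this that(2-4)] show ?thesis by simp
  qed
  have terms: "e w - d v \<in> C" if v: "v \<in> entries ds" and nz: "commutator_col ds X v w \<noteq> 0" for v w
  proof -
    obtain k I J where w: "w = (k, I, J)" by (cases w)
    have r: "k < m" "I < ?N" "J < ?N" and s: "(\<Sum>P<?N. lie_unit ds v $$ (I, P) * (X ! k) $$ (P, J) - (X ! k) $$ (I, P) * lie_unit ds v $$ (P, J)) \<noteq> 0"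
      using nz len by (auto simp: w commutator_col_def split: if_splits)
    obtain P where P: "P < ?N" "lie_unit ds v $$ (I, P) * (X ! k) $$ (P, J) - (X ! k) $$ (I, P) * lie_unit ds v $$ (P, J) \<noteq> 0"
      using s by (elim sum.not_neutral_contains_not_neutral) (simp only: lessThan_iff)
    then consider "lie_unit ds v $$ (I, P) \<noteq> 0" "(X ! k) $$ (P, J) \<noteq> 0" | "lie_unit ds v $$ (P, J) \<noteq> 0" "(X ! k) $$ (I, P) \<noteq> 0"
      by fastforce
    then show ?thesis
    proof cases
      case 1
      then have "?\<Lambda> P - ?\<Lambda> J \<in> C" "?\<Lambda> I - ?\<Lambda> P = d v"
        using suppD[OF supp[OF r(1)] P(1) r(3)] unit[OF v r(2) P(1)] by auto
      then show ?thesis by (simp add: w e_def algebra_simps)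
    next
      case 2
      then have "?\<Lambda> I - ?\<Lambda> P \<in> C" "?\<Lambda> P - ?\<Lambda> J = d v"
        using suppD[OF supp[OF r(1)] r(2) P(1)] unit[OF v P(1) r(3)] by auto
      then show ?thesis by (simp add: w e_def algebra_simps)
    qed
  qed
  have col0: "commutator_col ds X0 v w = (if e w = d v then commutator_col ds X v w else 0)" if v: "v \<in> entries ds" for v w
  proof -
    obtain k I J where w: "w = (k, I, J)" by (cases w)
    show ?thesis
    proof (cases "k < m \<and> I < ?N \<and> J < ?N")
      case True
      have 1: "lie_unit ds v $$ (I, P) * (X0 ! k) $$ (P, J)
          = (if e w = d v then lie_unit ds v $$ (I, P) * (X ! k) $$ (P, J) else 0)" if P: "P < ?N" for P
      proof (cases "lie_unit ds v $$ (I, P) = 0")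
        case False
        then have "d v = ?\<Lambda> I - ?\<Lambda> P" using unit[OF v _ P] True by simp
        then have "e w = d v \<longleftrightarrow> ?\<Lambda> P = ?\<Lambda> J" by (auto simp: w e_def algebra_simps)
        then show ?thesis using True P by (simp add: X0k part0_index)
      qed auto
      have 2: "(X0 ! k) $$ (I, P) * lie_unit ds v $$ (P, J)
          = (if e w = d v then (X ! k) $$ (I, P) * lie_unit ds v $$ (P, J) else 0)" if P: "P < ?N" for P
      proof (cases "lie_unit ds v $$ (P, J) = 0")
        case False
        then have "d v = ?\<Lambda> P - ?\<Lambda> J" using unit[OF v P] True by simp
        then have "e w = d v \<longleftrightarrow> ?\<Lambda> I = ?\<Lambda> P" by (auto simp: w e_def algebra_simps)
        then show ?thesis using True P by (simp add: X0k part0_index)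
      qed auto
      have "commutator_col ds X0 v w = (\<Sum>P<?N. lie_unit ds v $$ (I, P) * (X0 ! k) $$ (P, J) - (X0 ! k) $$ (I, P) * lie_unit ds v $$ (P, J))"
        using True X0m by (simp add: w commutator_col_def mat_tuples_def)
      also have "\<dots> = (\<Sum>P<?N. if e w = d v then lie_unit ds v $$ (I, P) * (X ! k) $$ (P, J) - (X ! k) $$ (I, P) * lie_unit ds v $$ (P, J) else 0)"
        by (intro sum.cong refl) (simp only: lessThan_iff 1 2, simp)
      also have "\<dots> = (if e w = d v then commutator_col ds X v w else 0)"
        using True len by (simp add: w commutator_col_def)
      finally show ?thesis .
    next
      case False
      then show ?thesis using len X0m by (auto simp: w commutator_col_def mat_tuples_def)
    qed
  qed
  have lx: "lie ds (fam ds x) = diagm ?N ?\<Lambda>"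
    unfolding lie_diagm[symmetric] by (intro lie_cong eq_matI) (auto simp: fam_def x_def diagm_def)
  have ker: "(\<Sum>v\<in>entries ds. x v * commutator_col ds X0 v w) = 0" for w
  proof -
    obtain k I J where w: "w = (k, I, J)" by (cases w)
    show ?thesis
    proof (cases "k < m \<and> I < ?N \<and> J < ?N")
      case True
      then have r: "k < m" "I < ?N" "J < ?N" by auto
      have c: "X0 ! k \<in> carrier_mat ?N ?N" by (rule mat_tuples_nth[OF X0m r(1)])
      have "(\<Sum>v\<in>entries ds. x v * commutator_col ds X0 v w) = (diagm ?N ?\<Lambda> * X0 ! k) $$ (I, J) - (X0 ! k * diagm ?N ?\<Lambda>) $$ (I, J)"
        unfolding w commutator_col_lie[OF X0m r] lx using r carrier_matD[OF c] by simp
      also have "\<dots> = 0"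
        unfolding diagm_mult_index[OF c r(2,3)] mult_diagm_index[OF c r(2,3)]
        unfolding X0k[OF r(1)] part0_index[OF r(2,3)] by simp
      finally show ?thesis .
    next
      case False
      then show ?thesis using X0m by (intro sum.neutral) (auto simp: w commutator_col_def mat_tuples_def)
    qed
  qed
  have 0: "0 \<in> W" using W(1)[OF W(3) W(3), of 0 0 0 0] by simp
  obtain y where y: "\<And>v. v \<in> entries ds \<Longrightarrow> y v \<noteq> 0 \<Longrightarrow> d v \<noteq> 0 \<and> d v - 0 \<in> C"
    and yk: "\<And>w. (\<Sum>v\<in>entries ds. (x v + y v) * commutator_col ds X v w) = 0"
  proof -
    have "\<exists>y. (\<forall>v\<in>entries ds. y v \<noteq> 0 \<longrightarrow> d v \<noteq> 0 \<and> d v - 0 \<in> C) \<and>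
        (\<forall>w. (\<Sum>v\<in>entries ds. (x v + y v) * commutator_col ds X v w) = 0)"
    proof (rule kernel_lift[where d = d and e = e, OF finite_entries _ terms col0 rank[folded X0_def] _ ker])
      show "d v - d v' \<in> C \<or> d v' - d v \<in> C" for v v'
        using W(2)[OF W(1)[OF dW dW], of v v'] by simp
      show "d v = 0" if "x v \<noteq> 0" for v using that by (cases v) (auto simp: x_def d_def split: if_splits)
      show "0 - d v \<in> C \<or> d v - 0 \<in> C" for v using W(2)[OF dW[of v]] by auto
    qed
    then show thesis using that by blast
  qed
  define \<xi> where "\<xi> = fam ds (\<lambda>v. x v + y v)"
  have comm: "lie ds \<xi> * X ! k = X ! k * lie ds \<xi>" if k: "k < m" for k
  proof (rule eq_matI)
    have c: "X ! k \<in> carrier_mat ?N ?N" "lie ds \<xi> \<in> carrier_mat ?N ?N"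
      using mat_tuples_nth[OF X k] by (auto simp: \<xi>_def)
    show "dim_row (lie ds \<xi> * X ! k) = dim_row (X ! k * lie ds \<xi>)" "dim_col (lie ds \<xi> * X ! k) = dim_col (X ! k * lie ds \<xi>)"
      using c by auto
    fix I J assume "I < dim_row (X ! k * lie ds \<xi>)" "J < dim_col (X ! k * lie ds \<xi>)"
    then have IJ: "I < ?N" "J < ?N" using c by auto
    have "(lie ds \<xi> * X ! k - X ! k * lie ds \<xi>) $$ (I, J) = 0"
      using yk[of "(k, I, J)"] unfolding commutator_col_lie[OF X k IJ] \<xi>_def .
    then show "(lie ds \<xi> * X ! k) $$ (I, J) = (X ! k * lie ds \<xi>) $$ (I, J)"
      using IJ carrier_matD[OF c(1)] carrier_matD[OF c(2)] by simp
  qed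
  define P where "P s u u' \<longleftrightarrow> u \<in> carrier_mat (ds ! s) (ds ! s) \<and> u' \<in> carrier_mat (ds ! s) (ds ! s) \<and>
    u * u' = 1\<^sub>m (ds ! s) \<and> u' * u = 1\<^sub>m (ds ! s) \<and> supp (ds ! s) (l s) C u \<and> supp (ds ! s) (l s) C u' \<and>
    part0 (ds ! s) (l s) u = 1\<^sub>m (ds ! s) \<and> part0 (ds ! s) (l s) u' = 1\<^sub>m (ds ! s) \<and>
    u * \<xi> s * u' = diagm (ds ! s) (l s)" for s u u'
  have "\<exists>u u'. P s u u'" if s: "s < length ds" for s
  proof -
    have "\<xi> s \<in> carrier_mat (ds ! s) (ds ! s)" by (simp add: \<xi>_def)
    moreover have "\<xi> s $$ (j, j) = l s j" if "j < ds ! s" for j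
      using y[of "(s, j, j)"] s that by (auto simp: \<xi>_def fam_index x_def d_def entries_iff)
    moreover have "l s k \<noteq> l s j \<and> l s k - l s j \<in> C" if "k < ds ! s" "j < ds ! s" "k \<noteq> j" "\<xi> s $$ (k, j) \<noteq> 0" for k j
      using y[of "(s, k, j)"] s that by (auto simp: \<xi>_def fam_index x_def d_def entries_iff)
    ultimately obtain u u' where "P s u u'"
      using sorted[OF s] by (rule unipotent_diagonalisation) (assumption+, rule that, simp add: P_def)
    then show ?thesis by blast
  qed
  from choose_families[of "length ds" P, OF this] obtain u u' where "\<forall>s<length ds. P s (u s) (u' s)" by blast
  note uu' = this[unfolded P_def, rule_format]
  have inv: "inverse_families ds u u'" using uu' by (auto simp: inverse_families_def square_family_def)
  have sf: "square_family ds u" "square_family ds u'" using inv by (auto simp: inverse_families_def)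
  have sT: "supp ?N ?\<Lambda> C (tens ds u)" "supp ?N ?\<Lambda> C (tens ds u')"
    using uu' sf by (auto intro!: supp_tens)
  have pT: "part0 ?N ?\<Lambda> (tens ds u) = 1\<^sub>m ?N" "part0 ?N ?\<Lambda> (tens ds u') = 1\<^sub>m ?N"
    using uu' part0_tens[OF sf(1), of l] part0_tens[OF sf(2), of l] by (simp_all add: tens_one)
  define Y where "Y = conj_tuple ds u u' X"
  have Ym: "Y \<in> mat_tuples ?N m" unfolding Y_def by (rule conj_tuple_closed[OF inv X])
  have Yk: "Y ! k = X0 ! k" if k: "k < m" for k
  proof -
    let ?T = "tens ds u" and ?T' = "tens ds u'" and ?L = "lie ds \<xi>"
    note t = tens_inverse[OF inv]
    have c: "X ! k \<in> carrier_mat ?N ?N" "Y ! k \<in> carrier_mat ?N ?N" "?L \<in> carrier_mat ?N ?N"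
      using mat_tuples_nth[OF X k] mat_tuples_nth[OF Ym k] by (auto simp: \<xi>_def)
    have Y: "Y ! k = ?T * X ! k * ?T'" unfolding Y_def using k len by (simp add: conj_tuple_nth)
    have "?T * ?L * ?T' = lie ds (\<lambda>s. u s * \<xi> s * u' s)"
      using sf inv by (intro lie_conj) (auto simp: \<xi>_def inverse_families_def)
    also have "\<dots> = lie ds (\<lambda>s. diagm (ds ! s) (l s))" using uu' by (intro lie_cong) auto
    finally have TL: "diagm ?N ?\<Lambda> = ?T * ?L * ?T'" by (simp add: lie_diagm)
    have HG: "A * (?T' * (?T * B)) = A * B" if "A \<in> carrier_mat ?N ?N" "B \<in> carrier_mat ?N ?N" for A B
      using that t by (simp add: square_mult_assoc[of _ ?N, symmetric])
    have "diagm ?N ?\<Lambda> * Y ! k = ?T * (?L * X ! k) * ?T'"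
      unfolding TL Y using c t(3,4) by (simp add: square_mult_assoc[of _ ?N] HG)
    also have "\<dots> = Y ! k * diagm ?N ?\<Lambda>"
      unfolding comm[OF k] unfolding TL Y using c t(3,4) by (simp add: square_mult_assoc[of _ ?N] HG)
    finally have com: "diagm ?N ?\<Lambda> * Y ! k = Y ! k * diagm ?N ?\<Lambda>" .
    have "(Y ! k) $$ (I, J) = 0" if IJ: "I < ?N" "J < ?N" "?\<Lambda> I \<noteq> ?\<Lambda> J" for I J
    proof -
      have "?\<Lambda> I * (Y ! k) $$ (I, J) = (Y ! k) $$ (I, J) * ?\<Lambda> J"
        unfolding diagm_mult_index[OF c(2) IJ(1,2), symmetric] mult_diagm_index[OF c(2) IJ(1,2), symmetric] com ..
      then show ?thesis using IJ(3) by (simp add: mult.commute)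
    qed
    then have "Y ! k = part0 ?N ?\<Lambda> (Y ! k)" using c by (intro eq_matI) (auto simp: part0_index)
    also have "\<dots> = 1\<^sub>m ?N * part0 ?N ?\<Lambda> (X ! k) * 1\<^sub>m ?N"
      unfolding Y_def supp_conj_tuple(2)[OF \<open>cone C\<close> inv X k sT supp[OF k]] pT ..
    also have "\<dots> = X0 ! k" using X0k[OF k]
      by (simp add: left_mult_one_mat[OF part0_carrier] right_mult_one_mat[OF part0_carrier])
    finally show ?thesis .
  qed
  have "Y = X0"
    using Yk Ym X0m by (intro nth_equalityI) (auto simp: mat_tuples_def)
  then show thesis using that[OF inv] unfolding Y_def X0_def by simp
qed

section \<open>Closed orbits\<close>

text \<open>
  The group \<open>W\<close> of weights is totally ordered with \<open>C\<close> as its set of nonnegative elements, and the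
  weights of each factor are in increasing order.
\<close>

definition weight_cone :: "nat list \<Rightarrow> (nat \<Rightarrow> nat \<Rightarrow> complex) \<Rightarrow> complex set \<Rightarrow> complex set \<Rightarrow> bool" where
  "weight_cone ds l W C \<longleftrightarrow> cone C \<and> (\<forall>v\<in>W. \<forall>w\<in>W. v - w \<in> W) \<and> (\<forall>w\<in>W. w \<in> C \<or> - w \<in> C) \<and>
     (\<forall>s i. l s i \<in> W) \<and> (\<forall>s<length ds. \<forall>j<ds ! s. \<forall>i\<le>j. l s j - l s i \<in> C)"

context place
begin

text \<open>
  Entry \<open>(I, J)\<close> of the conjugate by \<open>t\<close> is \<open>exp w\<close> times an entry \<open>y\<close> of \<open>b M\<close>, with \<open>w\<close> the
  weight of \<open>(I, J)\<close>.  If \<open>exp w\<close> is not in the valuation ring then \<open>y\<close> is its inverse times an element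
  of the ring, and the residue of \<open>y\<close> is zero.  If the inverse of \<open>exp w\<close> is not in the ring then \<open>exp w\<close> has
  residue zero and \<open>X\<close> has no entry there.  For \<open>w = 0\<close> both residues are equal.
\<close>

lemma weights_of_residue:
  fixes Ms X :: "complex mat list"
  assumes Ms: "Ms \<in> mat_tuples (prod_list ds) m" and X: "X \<in> mat_tuples (prod_list ds) m"
    and gh: "inverse_families ds g h"
    and res: "\<forall>k<m. mat_rel Q (prod_list ds) (conj_tuple ds g h Ms ! k) (X ! k)"
    and fixed: "\<forall>k<m. mat_rel Q (prod_list ds) (Ms ! k) (Ms ! k)"
  shows "\<exists>a a' b b' l W C. inverse_families ds a a' \<and> inverse_families ds b b' \<and> weight_cone ds l W C \<and>
    (\<forall>k<m. supp (prod_list ds) (wt ds l) C (conj_tuple ds b b' Ms ! k)) \<and>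
    (\<forall>k<m. supp (prod_list ds) (wt ds l) (uminus ` C) (conj_tuple ds a' a X ! k)) \<and>
    map (part0 (prod_list ds) (wt ds l)) (conj_tuple ds a' a X)
      = map (part0 (prod_list ds) (wt ds l)) (conj_tuple ds b b' Ms)"
proof -
  let ?N = "prod_list ds"
  obtain W where W: "0 \<in> W" "\<And>v w. v \<in> W \<Longrightarrow> w \<in> W \<Longrightarrow> v + w \<in> W" "\<And>w. w \<in> W \<Longrightarrow> - w \<in> W"
    and Wsplit: "\<And>s. \<exists>w\<in>W. integral (exp (s - w)) \<and> integral (exp (w - s))"
    and Wunit: "\<And>w. w \<in> W \<Longrightarrow> integral (exp w) \<Longrightarrow> integral (exp (- w)) \<Longrightarrow> w = 0"
    using logarithms_of_values by blast
  have Wdiff: "v - w \<in> W" if "v \<in> W" "w \<in> W" for v w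
    using W(2)[OF that(1) W(3)[OF that(2)]] by simp
  define C where "C = {w \<in> W. integral (exp w)}"
  have cone: "cone C"
    by standard (use W Wunit in \<open>auto simp: C_def exp_add\<close>)
  have total: "w \<in> C \<or> - w \<in> C" if "w \<in> W" for w
    using integral_or[of "exp w"] W(3)[OF that] that by (auto simp: C_def exp_minus)
  define P where "P s a a' b b' l \<longleftrightarrow> unimodular (ds ! s) a a' \<and> unimodular (ds ! s) b b' \<and>
    g s = a * diagm (ds ! s) (\<lambda>i. exp (l i)) * b \<and>
    (\<forall>i j. i \<le> j \<longrightarrow> j < ds ! s \<longrightarrow> integral (exp (l j - l i)))" for s a a' b b' l
  have "\<forall>s. \<exists>a a' b b' l. (\<forall>i. l i \<in> W) \<and> (s < length ds \<longrightarrow> P s a a' b b' l)"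
  proof
    fix s
    show "\<exists>a a' b b' l. (\<forall>i. l i \<in> W) \<and> (s < length ds \<longrightarrow> P s a a' b b' l)"
    proof (cases "s < length ds")
      case True
      then have c: "g s \<in> carrier_mat (ds ! s) (ds ! s)" "h s \<in> carrier_mat (ds ! s) (ds ! s)" "g s * h s = 1\<^sub>m (ds ! s)"
        using gh by (auto simp: inverse_families_def square_family_def)
      obtain a a' b b' l where "unimodular (ds ! s) a a'" "unimodular (ds ! s) b b'"
        "g s = a * diagm (ds ! s) (\<lambda>i. exp (l i)) * b" "\<And>i. l i \<in> W"
        "\<And>i j. i \<le> j \<Longrightarrow> j < ds ! s \<Longrightarrow> integral (exp (l j - l i))"
        using cartan_decomposition[OF c Wsplit] by blast
      then have "(\<forall>i. l i \<in> W) \<and> (s < length ds \<longrightarrow> P s a a' b b' l)" unfolding P_def by blast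
      then show ?thesis by (intro exI)
    next
      case False
      then show ?thesis using W(1) by (intro exI[of _ "\<lambda>_. 0"] exI) simp
    qed
  qed
  from choice[OF this] obtain a where "\<forall>s. \<exists>a' b b' l. (\<forall>i. l i \<in> W) \<and> (s < length ds \<longrightarrow> P s (a s) a' b b' l)" ..
  from choice[OF this] obtain a' where "\<forall>s. \<exists>b b' l. (\<forall>i. l i \<in> W) \<and> (s < length ds \<longrightarrow> P s (a s) (a' s) b b' l)" ..
  from choice[OF this] obtain b where "\<forall>s. \<exists>b' l. (\<forall>i. l i \<in> W) \<and> (s < length ds \<longrightarrow> P s (a s) (a' s) (b s) b' l)" ..
  from choice[OF this] obtain b' where "\<forall>s. \<exists>l. (\<forall>i. l i \<in> W) \<and> (s < length ds \<longrightarrow> P s (a s) (a' s) (b s) (b' s) l)" ..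
  from choice[OF this] obtain l where lP: "\<forall>s. (\<forall>i. l s i \<in> W) \<and> (s < length ds \<longrightarrow> P s (a s) (a' s) (b s) (b' s) (l s))" ..
  have lW: "l s i \<in> W" for s i using lP by blast
  have Ps: "unimodular (ds ! s) (a s) (a' s)" "unimodular (ds ! s) (b s) (b' s)"
    "g s = a s * diagm (ds ! s) (\<lambda>i. exp (l s i)) * b s"
    "\<And>i j. i \<le> j \<Longrightarrow> j < ds ! s \<Longrightarrow> integral (exp (l s j - l s i))" if "s < length ds" for s
    using lP that unfolding P_def by blast+
  have residues: "\<exists>r r'. \<forall>s<length ds. mat_rel Q (ds ! s) (f s) (r s) \<and> mat_rel Q (ds ! s) (f' s) (r' s) \<and>
      r s * r' s = 1\<^sub>m (ds ! s) \<and> r' s * r s = 1\<^sub>m (ds ! s)"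
    if un: "\<And>s. s < length ds \<Longrightarrow> unimodular (ds ! s) (f s) (f' s)" for f f'
    by (rule choose_families) (rule unimodular_residue[OF un], blast+)
  obtain r r' where r: "\<And>s. s < length ds \<Longrightarrow> mat_rel Q (ds ! s) (a s) (r s) \<and> mat_rel Q (ds ! s) (a' s) (r' s) \<and>
      r s * r' s = 1\<^sub>m (ds ! s) \<and> r' s * r s = 1\<^sub>m (ds ! s)"
    using residues[of a a'] Ps(1) by blast
  obtain q q' where q: "\<And>s. s < length ds \<Longrightarrow> mat_rel Q (ds ! s) (b s) (q s) \<and> mat_rel Q (ds ! s) (b' s) (q' s) \<and>
      q s * q' s = 1\<^sub>m (ds ! s) \<and> q' s * q s = 1\<^sub>m (ds ! s)"
    using residues[of b b'] Ps(2) by blast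
  have inv: "inverse_families ds r r'" "inverse_families ds q q'" "inverse_families ds a a'" "inverse_families ds b b'"
    using r q Ps(1,2) by (auto simp: inverse_families_def square_family_def mat_rel_def unimodular_def)
  define t where "t s = diagm (ds ! s) (\<lambda>i. exp (l s i))" for s
  define t' where "t' s = diagm (ds ! s) (\<lambda>i. exp (- l s i))" for s
  have invt: "inverse_families ds t t'"
    by (auto simp: inverse_families_def square_family_def t_def t'_def diagm_mult exp_minus intro!: diagm_one)
  define M where "M = conj_tuple ds q q' Ms"
  define Y where "Y = conj_tuple ds b b' Ms"
  define Z where "Z = conj_tuple ds t t' Y"
  define X' where "X' = conj_tuple ds r' r X"
  have Ym: "Y \<in> mat_tuples ?N m" and Mm: "M \<in> mat_tuples ?N m" and X'm: "X' \<in> mat_tuples ?N m"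
    unfolding Y_def M_def X'_def
    using conj_tuple_closed[OF inv(4) Ms] conj_tuple_closed[OF inv(2) Ms]
      conj_tuple_closed[OF inverse_families_sym[OF inv(1)] X] by auto
  have Zm: "Z \<in> mat_tuples ?N m" unfolding Z_def by (rule conj_tuple_closed[OF invt Ym])
  note len = Ms[unfolded mat_tuples_def] X[unfolded mat_tuples_def] Ym[unfolded mat_tuples_def]
    Mm[unfolded mat_tuples_def] X'm[unfolded mat_tuples_def] Zm[unfolded mat_tuples_def]
  \<comment> \<open>The decomposition \<open>g = a t b\<close> on the level of tuples.\<close>
  have gZ: "conj_tuple ds g h Ms = conj_tuple ds a a' Z"
  proof -
    let ?G = "\<lambda>s. (a s * t s) * b s" and ?H = "\<lambda>s. b' s * (t' s * a' s)"
    have at: "inverse_families ds (\<lambda>s. a s * t s) (\<lambda>s. t' s * a' s)" by (rule inverse_families_mult[OF inv(3) invt])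
    have "conj_tuple ds a a' Z = conj_tuple ds ?G ?H Ms"
      unfolding Z_def Y_def conj_tuple_conj[OF inv(3) invt Ym[unfolded Y_def]] by (rule conj_tuple_conj[OF at inv(4) Ms])
    also have "\<dots> = conj_tuple ds g h Ms"
    proof (rule conj_tuple_cong)
      have GH: "inverse_families ds ?G ?H" by (rule inverse_families_mult[OF at inv(4)])
      show gs: "?G s = g s" if "s < length ds" for s using Ps(3)[OF that] by (simp add: t_def)
      show "?H s = h s" if "s < length ds" for s
        by (rule inverse_families_unique[OF gh inverse_families_cong[OF GH gs] that])
    qed
    finally show ?thesis ..
  qed
  have relZ: "mat_rel Q ?N (Z ! k) (X' ! k)" if k: "k < m" for k
  proof -
    have "Z = conj_tuple ds a' a (conj_tuple ds g h Ms)"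
      unfolding gZ by (rule conj_tuple_inverse[OF inv(3) Zm, symmetric])
    then have "Z ! k = tens ds a' * conj_tuple ds g h Ms ! k * tens ds a"
      using k len by (simp add: conj_tuple_def)
    moreover have "X' ! k = tens ds r' * X ! k * tens ds r"
      unfolding X'_def using k len by (simp add: conj_tuple_nth)
    ultimately show ?thesis
      using res[rule_format, OF k] mat_rel_tens[OF hom, of ds a r] mat_rel_tens[OF hom, of ds a' r'] r
      by (auto intro!: mat_rel_mult[OF hom])
  qed
  have relY: "mat_rel Q ?N (Y ! k) (M ! k)" if k: "k < m" for k
  proof -
    have "Y ! k = tens ds b * Ms ! k * tens ds b'" "M ! k = tens ds q * Ms ! k * tens ds q'"
      unfolding Y_def M_def using k len by (simp_all add: conj_tuple_nth)
    then show ?thesis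
      using fixed[rule_format, OF k] mat_rel_tens[OF hom, of ds b q] mat_rel_tens[OF hom, of ds b' q'] q
      by (auto intro!: mat_rel_mult[OF hom])
  qed
  let ?\<Lambda> = "wt ds l"
  have \<Lambda>W: "?\<Lambda> I - ?\<Lambda> J \<in> W" for I J
    by (rule Wdiff[OF wt_mem[OF W(1,2) lW] wt_mem[OF W(1,2) lW]])
  have ZY: "(Z ! k) $$ (I, J) = exp (?\<Lambda> I - ?\<Lambda> J) * (Y ! k) $$ (I, J)" if k: "k < m" "I < ?N" "J < ?N" for k I J
  proof -
    have c: "Y ! k \<in> carrier_mat ?N ?N" by (rule mat_tuples_nth[OF Ym k(1)])
    have "tens ds t = diagm ?N (\<lambda>I. exp (?\<Lambda> I))" unfolding t_def[abs_def] by (rule tens_diagm)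
    moreover have "tens ds t' = diagm ?N (\<lambda>I. exp (- ?\<Lambda> I))"
      unfolding t'_def[abs_def] tens_diagm[of ds "\<lambda>s i. - l s i"] wt_uminus ..
    ultimately have "Z ! k = diagm ?N (\<lambda>I. exp (?\<Lambda> I)) * Y ! k * diagm ?N (\<lambda>I. exp (- ?\<Lambda> I))"
      unfolding Z_def using k len by (simp add: conj_tuple_nth)
    also have "\<dots> $$ (I, J) = exp (?\<Lambda> I) * (Y ! k) $$ (I, J) * exp (- ?\<Lambda> J)"
      unfolding mult_diagm_index[OF square_mult_carrier[OF diagm_carrier c] k(2,3)] diagm_mult_index[OF c k(2,3)] ..
    finally show ?thesis by (simp add: exp_diff exp_minus field_simps)
  qed
  have pair: "(exp (?\<Lambda> I - ?\<Lambda> J) * (Y ! k) $$ (I, J), (X' ! k) $$ (I, J)) \<in> Q" "((Y ! k) $$ (I, J), (M ! k) $$ (I, J)) \<in> Q"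
    if "k < m" "I < ?N" "J < ?N" for k I J
    using relZ[of k] relY[of k] ZY[of k I J, symmetric] that by (simp_all add: mat_rel_def)
  have suppM: "supp ?N ?\<Lambda> C (M ! k)" if k: "k < m" for k
    unfolding supp_def
  proof (intro allI impI, rule ccontr)
    fix I J assume IJ: "I < ?N" "J < ?N" and nz: "(M ! k) $$ (I, J) \<noteq> 0" and "?\<Lambda> I - ?\<Lambda> J \<notin> C"
    then have "\<not> integral (exp (?\<Lambda> I - ?\<Lambda> J))" using \<Lambda>W by (simp add: C_def)
    then have "(inverse (exp (?\<Lambda> I - ?\<Lambda> J)), 0) \<in> Q" using val by blast
    from ph_mult[OF hom this pair(1)[OF k IJ]] have "((Y ! k) $$ (I, J), 0) \<in> Q"
      by (simp flip: mult.assoc)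
    then show False using ph_unique[OF hom pair(2)[OF k IJ]] nz by blast
  qed
  have suppX: "supp ?N ?\<Lambda> (uminus ` C) (X' ! k)" if k: "k < m" for k
    unfolding supp_def
  proof (intro allI impI, rule ccontr)
    fix I J assume IJ: "I < ?N" "J < ?N" and nz: "(X' ! k) $$ (I, J) \<noteq> 0" and no: "?\<Lambda> I - ?\<Lambda> J \<notin> uminus ` C"
    have "?\<Lambda> J - ?\<Lambda> I \<notin> C"
    proof
      assume "?\<Lambda> J - ?\<Lambda> I \<in> C"
      then have "- (?\<Lambda> J - ?\<Lambda> I) \<in> uminus ` C" by (rule imageI)
      then show False using no by simp
    qed
    then have "\<not> integral (exp (?\<Lambda> J - ?\<Lambda> I))" using \<Lambda>W by (simp add: C_def)
    then have "(inverse (exp (?\<Lambda> J - ?\<Lambda> I)), 0) \<in> Q" using val by blast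
    moreover have "inverse (exp (?\<Lambda> J - ?\<Lambda> I)) = exp (?\<Lambda> I - ?\<Lambda> J)" by (simp flip: exp_minus)
    ultimately have "(exp (?\<Lambda> I - ?\<Lambda> J) * (Y ! k) $$ (I, J), 0) \<in> Q"
      using ph_mult[OF hom _ pair(2)[OF k IJ], of "exp (?\<Lambda> I - ?\<Lambda> J)" 0] by simp
    then show False using ph_unique[OF hom pair(1)[OF k IJ]] nz by blast
  qed
  have "part0 ?N ?\<Lambda> (X' ! k) = part0 ?N ?\<Lambda> (M ! k)" if k: "k < m" for k
  proof (rule eq_matI)
    fix I J assume "I < dim_row (part0 ?N ?\<Lambda> (M ! k))" "J < dim_col (part0 ?N ?\<Lambda> (M ! k))"
    then have IJ: "I < ?N" "J < ?N" by auto
    have "(X' ! k) $$ (I, J) = (M ! k) $$ (I, J)" if "?\<Lambda> I = ?\<Lambda> J"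
      using pair[OF k IJ] that ph_unique[OF hom] by simp
    then show "part0 ?N ?\<Lambda> (X' ! k) $$ (I, J) = part0 ?N ?\<Lambda> (M ! k) $$ (I, J)"
      using IJ by (simp add: part0_index)
  qed simp_all
  then have p0: "map (part0 ?N ?\<Lambda>) X' = map (part0 ?N ?\<Lambda>) M"
    using len by (intro nth_equalityI) auto
  have sorted: "l s j - l s i \<in> C" if "s < length ds" "i \<le> j" "j < ds ! s" for s i j
    using Ps(4)[OF that(1)] that Wdiff[OF lW lW] by (simp add: C_def)
  have "weight_cone ds l W C"
    unfolding weight_cone_def using cone Wdiff total lW sorted by simp
  then show ?thesis using inv(1,2) suppM suppX p0 unfolding M_def X'_def
    by (intro exI[of _ r] exI[of _ r'] exI[of _ q] exI[of _ q'] exI[of _ l] exI[of _ W] exI[of _ C]) simp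
qed

end

text \<open>
  The rank at the closure point \<open>X\<close> is at most the rank at \<open>Ms\<close>, which is the rank at any other point of
  the orbit, in particular at the part of weight zero.
\<close>

lemma closure_point_in_orbit:
  assumes Ms: "Ms \<in> mat_tuples (prod_list ds) m"
    and normal: "\<And>k. k < m \<Longrightarrow> Ms ! k * mat_adjoint (Ms ! k) = mat_adjoint (Ms ! k) * Ms ! k"
    and X: "X \<in> mat_tuples (prod_list ds) m"
    and closure: "in_zariski_closure (prod_list ds) m (conj_orbit ds Ms) X"
  shows "X \<in> conj_orbit ds Ms"
proof -
  let ?N = "prod_list ds" and ?c = "commutator_col ds"
  obtain g h Q where gh: "inverse_families ds g h" and Q: "place Q"
    and res: "\<forall>k<m. mat_rel Q ?N (conj_tuple ds g h Ms ! k) (X ! k)"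
    and fixed: "\<forall>k<m. mat_rel Q ?N (Ms ! k) (Ms ! k)"
    using place_of_closure_point[OF Ms closure X] by blast
  from place.weights_of_residue[OF Q Ms X gh res fixed]
  obtain a a' b b' l W C where a: "inverse_families ds a a'" and b: "inverse_families ds b b'"
    and wc: "weight_cone ds l W C"
    and sM: "\<forall>k<m. supp ?N (wt ds l) C (conj_tuple ds b b' Ms ! k)"
    and sX: "\<forall>k<m. supp ?N (wt ds l) (uminus ` C) (conj_tuple ds a' a X ! k)"
    and part0: "map (part0 ?N (wt ds l)) (conj_tuple ds a' a X) = map (part0 ?N (wt ds l)) (conj_tuple ds b b' Ms)"
    by (elim exE conjE) (rule that)
  have C: "cone C"
    and W: "\<And>v w. v \<in> W \<Longrightarrow> w \<in> W \<Longrightarrow> v - w \<in> W" "\<And>w. w \<in> W \<Longrightarrow> w \<in> C \<or> - w \<in> C" "\<And>s i. l s i \<in> W"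
    and sorted: "\<And>s i j. s < length ds \<Longrightarrow> i \<le> j \<Longrightarrow> j < ds ! s \<Longrightarrow> l s j - l s i \<in> C"
    using wc unfolding weight_cone_def by simp_all
  note suppM = sM[rule_format] and suppX = sX[rule_format]
  define X' where "X' = conj_tuple ds a' a X"
  define X0 where "X0 = map (part0 ?N (wt ds l)) X'"
  have X'm: "X' \<in> mat_tuples ?N m" unfolding X'_def by (rule conj_tuple_closed[OF inverse_families_sym[OF a] X])
  have X0: "X0 \<in> conj_orbit ds Ms"
    unfolding X0_def X'_def part0 by (rule normal_block_diagonal_in_orbit[OF C Ms normal b sorted suppM])
  then obtain e f where ef: "inverse_families ds e f" "X0 = conj_tuple ds e f Ms" unfolding conj_orbit_def by blast
  have X0m: "X0 \<in> mat_tuples ?N m" using X0 conj_orbit_tuples[OF Ms] by blast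
  have r1: "rank_le (entries ds) (?c X') (?c X)"
    unfolding X'_def by (rule rank_conj_le[OF inverse_families_sym[OF a] X])
  have r2: "rank_le (entries ds) (?c X) (?c Ms)"
    unfolding rank_le_def
  proof (intro allI impI)
    fix S assume S: "S \<subseteq> entries ds" "indep (?c X) S"
    obtain Y where Y: "Y \<in> conj_orbit ds Ms" "indep (?c Y) S"
      using rank_semicontinuous[OF X conj_orbit_tuples[OF Ms] closure S] by blast
    then obtain g' h' where "inverse_families ds g' h'" "Y = conj_tuple ds g' h' Ms" unfolding conj_orbit_def by blast
    then have "rank_le (entries ds) (?c Y) (?c Ms)" using rank_conj_le[OF _ Ms] by blast
    then show "\<exists>S'\<subseteq>entries ds. indep (?c Ms) S' \<and> card S \<le> card S'" using S(1) Y(2) unfolding rank_le_def by blast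
  qed
  have r3: "rank_le (entries ds) (?c Ms) (?c X0)"
    using rank_conj_le[OF inverse_families_sym[OF ef(1)] X0m]
    unfolding ef(2) conj_tuple_inverse[OF ef(1) Ms] .
  have rank: "rank_le (entries ds) (?c X') (?c X0)"
    by (rule rank_le_trans[OF r1 rank_le_trans[OF r2 r3]])
  have sorted': "l s i - l s j \<in> uminus ` C" if "s < length ds" "i \<le> j" "j < ds ! s" for s i j
  proof -
    have "- (l s j - l s i) \<in> uminus ` C" by (rule imageI[OF sorted[OF that]])
    then show ?thesis by simp
  qed
  have W2: "w \<in> uminus ` C \<or> - w \<in> uminus ` C" if "w \<in> W" for w
    using W(2)[OF that] by (metis imageI minus_minus)
  obtain u u' where u: "inverse_families ds u u'" "conj_tuple ds u u' X' = X0"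
    unfolding X0_def
    by (rule conj_to_part0[OF cone_uminus[OF C] X'm W(1) W2 W(3) sorted' suppX[folded X'_def] rank[unfolded X0_def]])
  have "X' = conj_tuple ds u' u X0"
    unfolding u(2)[symmetric] by (rule conj_tuple_inverse[OF u(1) X'm, symmetric])
  then have "X' \<in> conj_orbit ds Ms"
    using conj_orbit_closed[OF inverse_families_sym[OF u(1)] Ms X0] by simp
  moreover have "X = conj_tuple ds a a' X'"
    unfolding X'_def by (rule conj_tuple_inverse[OF inverse_families_sym[OF a] X, symmetric])
  ultimately show ?thesis using conj_orbit_closed[OF a Ms] by simp
qed

lemma local_orbit_eq: "local_orbit ds Ms = conj_orbit ds Ms"
proof -
  have tens_list: "tensor_mat gs = tens ds ((!) gs)" if "length gs = length ds" for gs
    using that map_nth[of gs] by (simp add: tens_def)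
  have inv: "the (mat_inverse (tensor_mat gs)) = tens ds h"
    if gs: "gs \<in> GL_prod ds" and gh: "inverse_families ds ((!) gs) h" for gs h
  proof -
    let ?N = "prod_list ds" and ?T = "tensor_mat gs"
    have T: "?T = tens ds ((!) gs)" using gs by (intro tens_list) (simp add: GL_prod_def)
    obtain H where H: "H \<in> carrier_mat ?N ?N" "mat_inverse ?T = Some H" "H * ?T = 1\<^sub>m ?N"
      using tensor_mat_inverse[OF gs] by blast
    note t = tens_inverse[OF gh, folded T]
    have "H = H * (?T * tens ds h)" unfolding t(1) by (rule right_mult_one_mat[OF H(1), symmetric])
    also have "\<dots> = (H * ?T) * tens ds h" by (rule square_mult_assoc[OF H(1) t(3,4), symmetric])
    also have "\<dots> = tens ds h" unfolding H(3) by (rule left_mult_one_mat[OF t(4)])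
    finally show ?thesis using H(2) by simp
  qed
  have conj: "map (tensor_conj gs) Ms = conj_tuple ds ((!) gs) h Ms"
    if gs: "gs \<in> GL_prod ds" and gh: "inverse_families ds ((!) gs) h" for gs h
  proof -
    have T: "tensor_mat gs = tens ds ((!) gs)" using gs by (intro tens_list) (simp add: GL_prod_def)
    show ?thesis unfolding conj_tuple_def tensor_conj_def[abs_def] inv[OF that] unfolding T ..
  qed
  show ?thesis
  proof (intro equalityI subsetI)
    fix Z assume "Z \<in> local_orbit ds Ms"
    then obtain gs where Z: "Z = map (tensor_conj gs) Ms" and gs: "gs \<in> GL_prod ds"
      unfolding local_orbit_def by blast
    have "\<exists>h. s < length ds \<longrightarrow> h \<in> carrier_mat (ds ! s) (ds ! s) \<and> gs ! s * h = 1\<^sub>m (ds ! s) \<and> h * gs ! s = 1\<^sub>m (ds ! s)" for s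
    proof (cases "s < length ds")
      case True
      then have "gs ! s \<in> GL (ds ! s)" using gs by (simp add: GL_prod_def)
      then show ?thesis by (rule GL_inverse) blast
    qed simp
    then have "\<forall>s. \<exists>h. s < length ds \<longrightarrow> h \<in> carrier_mat (ds ! s) (ds ! s) \<and> gs ! s * h = 1\<^sub>m (ds ! s) \<and> h * gs ! s = 1\<^sub>m (ds ! s)" ..
    from choice[OF this] obtain h where "\<And>s. s < length ds \<Longrightarrow> h s \<in> carrier_mat (ds ! s) (ds ! s) \<and>
      gs ! s * h s = 1\<^sub>m (ds ! s) \<and> h s * gs ! s = 1\<^sub>m (ds ! s)" by blast
    then have "inverse_families ds ((!) gs) h"
      using gs by (auto simp: inverse_families_def square_family_def GL_prod_def GL_def)
    then show "Z \<in> conj_orbit ds Ms" unfolding Z conj_orbit_def using conj[OF gs] by blast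
  next
    fix Z assume "Z \<in> conj_orbit ds Ms"
    then obtain g h where Z: "Z = conj_tuple ds g h Ms" and gh: "inverse_families ds g h"
      unfolding conj_orbit_def by blast
    define gs where "gs = map g [0..<length ds]"
    have nth: "gs ! s = g s" if "s < length ds" for s using that by (simp add: gs_def)
    have "g s \<in> GL (ds ! s)" if "s < length ds" for s
    proof -
      have c: "g s \<in> carrier_mat (ds ! s) (ds ! s)" "h s \<in> carrier_mat (ds ! s) (ds ! s)"
        "g s * h s = 1\<^sub>m (ds ! s)" "h s * g s = 1\<^sub>m (ds ! s)"
        using gh that by (auto simp: inverse_families_def square_family_def)
      then have "inverts_mat (g s) (h s)" "inverts_mat (h s) (g s)" by (simp_all add: inverts_mat_def)
      then show ?thesis using c(1) unfolding GL_def invertible_mat_def by auto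
    qed
    then have GL: "gs \<in> GL_prod ds" by (simp add: GL_prod_def gs_def)
    have "inverse_families ds ((!) gs) h"
      using gh nth by (simp add: inverse_families_def square_family_def)
    from conj[OF GL this] have "map (tensor_conj gs) Ms = Z"
      unfolding Z using nth conj_tuple_cong[of ds "(!) gs" g h h] by simp
    then show "Z \<in> local_orbit ds Ms" unfolding local_orbit_def using GL by blast
  qed
qed

theorem theorem4p7:
  fixes ds :: "nat list" and m :: nat and Ms :: "complex mat list"
  assumes "m \<ge> 1"
    and "Ms \<in> mat_tuples (prod_list ds) m"
    and "\<And>M. M \<in> set Ms \<Longrightarrow> normal_mat M"
  shows "zariski_closed (prod_list ds) m (local_orbit ds Ms)"
proof -
  let ?N = "prod_list ds" and ?O = "conj_orbit ds Ms"
  define P where "P = {p \<in> poly_funs ?N m. \<forall>Y\<in>?O. p Y = 0}"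
  have normal: "Ms ! k * mat_adjoint (Ms ! k) = mat_adjoint (Ms ! k) * Ms ! k" if "k < m" for k
    using assms(2) assms(3)[of "Ms ! k"] that by (simp add: normal_mat_def mat_tuples_def)
  have "?O = {X \<in> mat_tuples ?N m. \<forall>p\<in>P. p X = 0}"
  proof (intro equalityI subsetI)
    fix X assume "X \<in> ?O"
    then show "X \<in> {X \<in> mat_tuples ?N m. \<forall>p\<in>P. p X = 0}"
      using conj_orbit_tuples[OF assms(2)] by (auto simp: P_def)
  next
    fix X assume "X \<in> {X \<in> mat_tuples ?N m. \<forall>p\<in>P. p X = 0}"
    then have X: "X \<in> mat_tuples ?N m" and P: "\<And>p. p \<in> P \<Longrightarrow> p X = 0" by blast+
    have "in_zariski_closure ?N m ?O X"
      unfolding in_zariski_closure_def using P by (auto simp: P_def)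
    then show "X \<in> ?O" by (intro closure_point_in_orbit[OF assms(2) _ X] normal)
  qed
  moreover have "P \<subseteq> poly_funs ?N m" by (auto simp: P_def)
  ultimately show ?thesis unfolding zariski_closed_def local_orbit_eq by (intro exI[of _ P] conjI)
qed

end
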